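(* Assume the setting and hypotheses (A1)–(A3) described in the context, and let $\delta>0$ be fixed. For every sufficiently large $X$, with $L=\delta^{-1}X^{1/(2A)}$ and $\varphi(u)=\varphi_0((u-1)L)$, the function $$S_\varphi(x)=\sum_{n\ge1}a_n\varphi\Big(\frac{\lambda_n}{x}\Big)-M_\varphi(x),\qquad M_\varphi(x)=\frac{1}{2\pi i}\int_{\mathcal C}\phi(s)\widehat\varphi(s)x^s\,ds,$$ satisfies, for every $x\in[X,4X]$, $$S_\varphi(x)=\frac{\omega e_0}{2Ah}(hx)^{1-\vartheta+i\xi}S_{\varphi,0}(x)+O\big(L^{-1}x^{1-\vartheta-1/(2A)}\big),$$ where $$e_0:=\sqrt{\frac{2}{\pi}}\prod_{\nu=1}^d\Big(\frac{2A}{\alpha_\nu}\Big)^{\alpha_\nu+\beta_\nu-\widetilde\beta_\nu}\in\mathbb C^\times$$ and $$S_{\varphi,0}(x):=\sum_{n\ge1}\frac{b_n}{\mu_n^{\vartheta-i\xi}}\int_0^\infty\frac{\varphi(u)}{u^{\vartheta}}u^{i\xi}\cos\big((h\mu_nxu)^{1/(2A)}+k\pi\big)\,du.$$ Moreover $S_\varphi(x)\ll x^{1-\vartheta}L^{-1}$ for all $x\in[X,4X]$. The implied constants depend only on $\varphi_0$, $\delta$ and the parameters in (A1) and (A2).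
   Context: Let $(a_n)_{n\ge1},(b_n)_{n\ge1}$ be complex sequences with $a_1\ne0$, $b_1\ne0$, and let $(\lambda_n),(\mu_n)$ be strictly increasing sequences of positive reals tending to $\infty$. Assume: (A1) $\phi(s):=\sum_{n\ge1}a_n\lambda_n^{-s}$ and $\psi(s):=\sum_{n\ge1}b_n\mu_n^{-s}$ converge absolutely for $\mathrm{Re}\,s\ge\sigma^*$, for some constant $\sigma^*>0$. (A2) There are $d\ge1$, $\alpha_\nu>0$ and $\beta_\nu,\widetilde\beta_\nu\in\mathbb C$ ($1\le\nu\le d$) such that, with $\Delta(s):=\prod_{\nu=1}^d\Gamma(\alpha_\nu s+\beta_\nu)$ and $\widetilde\Delta(s):=\prod_{\nu=1}^d\Gamma(\alpha_\nu s+\widetilde\beta_\nu)$, one has $\Delta(s)\phi(s)=\omega\widetilde\Delta(1-s)\psi(1-s)$ for some $\omega\in\mathbb C$ with $|\omega|=1$. (A3) $\Delta(s)\phi(s)$ extends meromorphically to $\mathbb C$; all its singularities lie in the open disk $\mathcal D$ bounded by the anticlockwise circle $\mathcal C:|z|=R$ for some $R>0$ (so all poles of $\phi$ lie in $\mathcal D$); and $\Delta(\sigma+it)\phi(\sigma+it)\to0$ uniformly in every vertical strip $b\le\sigma\le b'$ as $|t|\to\infty$. Notation: $A:=\sum\alpha_\nu$, $B:=\sum\beta_\nu$, $\widetilde B:=\sum\widetilde\beta_\nu$, $h:=\prod_{\nu}(2A/\alpha_\nu)^{2\alpha_\nu}$, $a:=\frac{1}{4A}-\frac12-\frac{B-\widetilde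 B}{2A}=:-\vartheta+i\xi$ and $k:=\frac d2-\frac14-\frac{A+B+\widetilde B}{2}=:\kappa+i\eta$ with $\vartheta,\xi,\kappa,\eta\in\mathbb R$. Weight: $\varphi_0$ is a fixed smooth function supported on $[-1,1]$ with $0\le\varphi_0\le1$ and $1\le\int_{\mathbb R}\varphi_0(u)\,du\le2$. For $\delta>0$ and large $X$, $L:=\delta^{-1}X^{1/(2A)}$ and $\varphi(u):=\varphi_0((u-1)L)$; $\widehat\varphi(s):=\int_0^\infty\varphi(u)u^{s-1}\,du$ is its Mellin transform. *)

theory Defs
  imports "HOL-Complex_Analysis.Complex_Analysis"
begin

text \<open>Indices: the paper's sequences (a_n)_{n>=1} etc. are represented 0-based,
  i.e. a 0 is the paper's a_1.  Gamma-factor indices nu range over {0..<d}.\<close>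

definition dser :: "(nat \<Rightarrow> complex) \<Rightarrow> (nat \<Rightarrow> real) \<Rightarrow> complex \<Rightarrow> complex" where
  "dser a lam s = (\<Sum>n. a n * of_real (lam n) powr (- s))"

definition gfac :: "nat \<Rightarrow> (nat \<Rightarrow> real) \<Rightarrow> (nat \<Rightarrow> complex) \<Rightarrow> complex \<Rightarrow> complex" where
  "gfac d al be s = (\<Prod>\<nu><d. Gamma (of_real (al \<nu>) * s + be \<nu>))"

definition rgfac :: "nat \<Rightarrow> (nat \<Rightarrow> real) \<Rightarrow> (nat \<Rightarrow> complex) \<Rightarrow> complex \<Rightarrow> complex" where
  "rgfac d al be s = (\<Prod>\<nu><d. rGamma (of_real (al \<nu>) * s + be \<nu>))"

definition gfac_regular :: "nat \<Rightarrow> (nat \<Rightarrow> real) \<Rightarrow> (nat \<Rightarrow> complex) \<Rightarrow> complex \<Rightarrow> bool" where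
  "gfac_regular d al be s \<longleftrightarrow> (\<forall>\<nu><d. of_real (al \<nu>) * s + be \<nu> \<notin> \<int>\<^sub>\<le>\<^sub>0)"

definition bigA :: "nat \<Rightarrow> (nat \<Rightarrow> real) \<Rightarrow> real" where
  "bigA d al = (\<Sum>\<nu><d. al \<nu>)"

definition bigB :: "nat \<Rightarrow> (nat \<Rightarrow> complex) \<Rightarrow> complex" where
  "bigB d be = (\<Sum>\<nu><d. be \<nu>)"

definition hconst :: "nat \<Rightarrow> (nat \<Rightarrow> real) \<Rightarrow> real" where
  "hconst d al = (\<Prod>\<nu><d. (2 * bigA d al / al \<nu>) powr (2 * al \<nu>))"

definition aconst :: "nat \<Rightarrow> (nat \<Rightarrow> real) \<Rightarrow> (nat \<Rightarrow> complex) \<Rightarrow> (nat \<Rightarrow> complex) \<Rightarrow> complex" where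
  "aconst d al be bt = 1 / (4 * of_real (bigA d al)) - 1/2
      - (bigB d be - bigB d bt) / (2 * of_real (bigA d al))"

definition theta :: "nat \<Rightarrow> (nat \<Rightarrow> real) \<Rightarrow> (nat \<Rightarrow> complex) \<Rightarrow> (nat \<Rightarrow> complex) \<Rightarrow> real" where
  "theta d al be bt = - Re (aconst d al be bt)"

definition xi :: "nat \<Rightarrow> (nat \<Rightarrow> real) \<Rightarrow> (nat \<Rightarrow> complex) \<Rightarrow> (nat \<Rightarrow> complex) \<Rightarrow> real" where
  "xi d al be bt = Im (aconst d al be bt)"

definition kconst :: "nat \<Rightarrow> (nat \<Rightarrow> real) \<Rightarrow> (nat \<Rightarrow> complex) \<Rightarrow> (nat \<Rightarrow> complex) \<Rightarrow> complex" where
  "kconst d al be bt = of_nat d / 2 - 1/4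
      - (of_real (bigA d al) + bigB d be + bigB d bt) / 2"

definition e0 :: "nat \<Rightarrow> (nat \<Rightarrow> real) \<Rightarrow> (nat \<Rightarrow> complex) \<Rightarrow> (nat \<Rightarrow> complex) \<Rightarrow> complex" where
  "e0 d al be bt = of_real (sqrt (2 / pi)) *
     (\<Prod>\<nu><d. of_real (2 * bigA d al / al \<nu>) powr (of_real (al \<nu>) + be \<nu> - bt \<nu>))"

definition Lpar :: "real \<Rightarrow> real \<Rightarrow> real \<Rightarrow> real" where
  "Lpar A \<delta> X = X powr (1 / (2 * A)) / \<delta>"

definition wt :: "(real \<Rightarrow> real) \<Rightarrow> real \<Rightarrow> real \<Rightarrow> real" where
  "wt \<phi>0 L u = \<phi>0 ((u - 1) * L)"

definition mellin :: "(real \<Rightarrow> real) \<Rightarrow> complex \<Rightarrow> complex" where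
  "mellin w s = integral {0<..} (\<lambda>u. of_real (w u) * of_real u powr (s - 1))"

end

theory Submission
  imports Defs "HOL-Probability.Probability"
begin

text \<open>
  Mellin inversion writes the smoothed sum as an integral of \<open>\<phi>(s) x\<^sup>s\<close> against the Mellin transform
  of the weight over a line far to the right. Moving the line to \<open>Re s = -c\<close> with \<open>c\<close> large produces
  the circle integral, and the functional equation turns what remains into a sum over \<open>n\<close> of
  integrals of \<open>G(s) = \<Delta>~(1-s) / \<Delta>(s)\<close>. Stirling's formula gives, on this single line,
  \<open>G = main + second + error\<close>, where main and second are multiples of \<open>\<Gamma>(W) cos(\<pi>W/2 + k\<pi>)\<close> and
  \<open>\<Gamma>(W-1) cos(\<pi>W/2 + k\<pi>)\<close> with \<open>W = 2A(1-s+a)\<close>, and the error is smaller than main by \<open>|s| powr (-3/2)\<close>.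
  The first two are Mellin transforms of cosines, so by Parseval they become the integrals in
  \<open>S\<^sub>\<phi>\<^sub>,\<^sub>0\<close> and a similar sum that carries an additional factor \<open>x powr (-1/(2A))\<close>. These are bounded by
  repeated integration by parts, because \<open>L\<close> is comparable to \<open>x powr (1/(2A))\<close>. The error is estimated
  absolutely: this loses \<open>x powr (1/(4A))\<close> against the oscillating terms, which is why two terms
  of Stirling's expansion are needed.
\<close>

subsection \<open>Stirling's formula with a correction term\<close>

text \<open>The absolute estimate of the error dictates the exponent -3/2. On
  \<open>Re s = -c\<close> the quotient has size |t| powr (\<open>rW c\<close> - 1/2), where
  \<open>rW c\<close> = 2A(1 + c + Re a), and integrating |t| powr Q against the Mellin transform of
  the weight, which lives on |t| up to about L, costs \<open>L powr Q\<close>. A relative error |s|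
  powr (-3/2) therefore leaves \<open>x powr (- c) * L powr (rW c - 2)\<close>, and L <= x powr
  (1/(2A)) / \<delta> turns this into exactly x powr (1 - \<theta> - 1/(2A)) / L. Since c cancels,
  it may be as large as convergence, poles and Stirling demand, and since it does not depend on X
  all constants are uniform. The coefficient of the second term need not be known: that term only
  has to be a Gamma factor times the same cosine. Stirling's formula is needed only in half planes
  Re z >= Z, because reflection moves the factors of 1 / \<Delta>(s) there at the price of sines,
  whose product is a single cosine up to an error exponentially smaller than the size exp (pi A
  |t|).\<close>

definition asy1 :: "(complex \<Rightarrow> complex) \<Rightarrow> bool" where
  "asy1 f \<longleftrightarrow> (\<exists>q C Z. \<forall>z. Re z \<ge> Z \<longrightarrow> cmod (f z - 1 - q / z) \<le> C * cmod z powr (- 3/2))"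

section \<open>Closure of two-term expansions under products, scaling and inverses\<close>

lemma asy1E:
  assumes "asy1 f"
  obtains q C Z where "C \<ge> 0" "Z \<ge> 1"
    "\<And>z. Re z \<ge> Z \<Longrightarrow> cmod (f z - 1 - q / z) \<le> C * cmod z powr (- 3/2)"
proof -
  from assms obtain q C Z where
    *: "\<And>z. Re z \<ge> Z \<Longrightarrow> cmod (f z - 1 - q / z) \<le> C * cmod z powr (- 3/2)"
    unfolding asy1_def by blast
  have "cmod (f z - 1 - q / z) \<le> \<bar>C\<bar> * cmod z powr (- 3/2)" if "Re z \<ge> max Z 1" for z
    using *[of z] that by (smt (verit) max.bounded_iff mult_right_mono powr_ge_zero)
  then show ?thesis by (intro that[of "\<bar>C\<bar>" "max Z 1" q]) auto
qed

lemma powr_minus_three_halves: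
  fixes x :: real
  assumes "x \<ge> 1"
  shows "x powr (-3/2) \<le> 1" "1 / x ^ 2 \<le> x powr (-3/2)" "x powr (-3/2) \<le> 1 / x"
proof -
  have 1: "1 / x = x powr (-1)" "1 / x ^ 2 = x powr (-2)" "1 = x powr 0"
    using assms by (auto simp: powr_minus_divide)
  show "x powr (-3/2) \<le> 1" by (subst 1(3)) (use assms in \<open>intro powr_mono; simp\<close>)
  show "1 / x ^ 2 \<le> x powr (-3/2)" "x powr (-3/2) \<le> 1 / x"
    unfolding 1(1,2) using assms by (intro powr_mono; simp)+
qed

lemma norm_add3_le:
  fixes a b c :: "'a :: real_normed_vector"
  shows "norm (a + b + c) \<le> norm a + norm b + norm c"
  using norm_triangle_ineq[of "a + b" c] norm_triangle_ineq[of a b] by linarith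

lemma cmod_ge_1_if_Re: "Re z \<ge> 1 \<Longrightarrow> cmod z \<ge> 1"
  using complex_Re_le_cmod[of z] by linarith

lemma asy1_near_1:
  assumes "\<And>z. Re z \<ge> Z \<Longrightarrow> cmod (f z - 1) \<le> C * cmod z powr (- 3/2)"
  shows "asy1 f"
  unfolding asy1_def using assms by (intro exI[of _ 0] exI[of _ C] exI[of _ Z]) auto

text \<open>The first-order coefficients add; the product p q / z^2 of the two 1/z terms already
  belongs to the remainder.\<close>

lemma asy1_mult:
  assumes "asy1 f" "asy1 g"
  shows "asy1 (\<lambda>z. f z * g z)"
proof -
  from asy1E[OF assms(1)] obtain p C Z where 1: "C \<ge> 0" "Z \<ge> 1"
    "\<And>z. Re z \<ge> Z \<Longrightarrow> cmod (f z - 1 - p / z) \<le> C * cmod z powr (- 3/2)" by metis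
  from asy1E[OF assms(2)] obtain q D Y where 2: "D \<ge> 0" "Y \<ge> 1"
    "\<And>z. Re z \<ge> Y \<Longrightarrow> cmod (g z - 1 - q / z) \<le> D * cmod z powr (- 3/2)" by metis
  have "cmod (f z * g z - 1 - (p + q) / z) \<le>
      (C * (1 + cmod q + D) + (1 + cmod p) * D + cmod p * cmod q) * cmod z powr (- 3/2)"
    if "Re z \<ge> max Z Y" for z
  proof -
    define u where "u = cmod z powr (- 3/2)"
    have z: "cmod z \<ge> 1" using cmod_ge_1_if_Re[of z] that 1 by auto
    have u: "0 \<le> u" "u \<le> 1" unfolding u_def using powr_minus_three_halves[OF z] by auto
    have u2: "1 / (cmod z)^2 \<le> u"
      unfolding u_def using z by (rule powr_minus_three_halves)
    have zi: "cmod (p / z) \<le> cmod p" "cmod (q / z) \<le> cmod q"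
      using z by (auto simp: norm_divide divide_le_eq mult_le_cancel_left1)
    have f: "cmod (f z - 1 - p / z) \<le> C * u" and g: "cmod (g z - 1 - q / z) \<le> D * u"
      using 1(3)[of z] 2(3)[of z] that unfolding u_def by auto
    have Du: "D * u \<le> D" using u 2(1) by (simp add: mult_left_le)
    have "cmod (g z) = cmod (1 + q / z + (g z - 1 - q / z))" by simp
    also have "\<dots> \<le> 1 + cmod (q / z) + cmod (g z - 1 - q / z)"
      using norm_add3_le[of 1 "q / z" "g z - 1 - q / z"] by simp
    finally have gb: "cmod (g z) \<le> 1 + cmod q + D" using zi g Du by linarith
    have pb: "cmod (1 + p / z) \<le> 1 + cmod p"
      using norm_triangle_ineq[of 1 "p / z"] zi by simp
    have pq: "cmod (p / z * (q / z)) \<le> cmod p * cmod q * u"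
      using mult_left_mono[OF u2, of "cmod p * cmod q"]
      by (simp add: norm_mult norm_divide power2_eq_square)
    have "z \<noteq> 0" using z by auto
    then have "f z * g z - 1 - (p + q) / z =
        (f z - 1 - p / z) * g z + (1 + p / z) * (g z - 1 - q / z) + p / z * (q / z)"
      by (simp add: algebra_simps add_divide_distrib)
    then have "cmod (f z * g z - 1 - (p + q) / z) \<le>
        cmod (f z - 1 - p / z) * cmod (g z) + cmod (1 + p / z) * cmod (g z - 1 - q / z) + cmod (p / z * (q / z))"
      using norm_add3_le[of "(f z - 1 - p / z) * g z" "(1 + p / z) * (g z - 1 - q / z)" "p / z * (q / z)"]
      by (simp add: norm_mult)
    also have "\<dots> \<le> (C * u) * (1 + cmod q + D) + (1 + cmod p) * (D * u) + cmod p * cmod q * u"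
      using f g gb pb pq u 1 2 by (intro add_mono mult_mono) auto
    finally show ?thesis unfolding u_def by (simp add: algebra_simps)
  qed
  then show ?thesis unfolding asy1_def by blast
qed

lemma asy1_const_1: "asy1 (\<lambda>_. 1)"
  by (rule asy1_near_1[of 1 _ 1]) auto

lemma asy1_prod:
  assumes "finite I" "\<And>i. i \<in> I \<Longrightarrow> asy1 (f i)"
  shows "asy1 (\<lambda>z. \<Prod>i\<in>I. f i z)"
  using assms by (induction I) (auto intro: asy1_const_1 asy1_mult)

lemma asy1_scale:
  assumes "asy1 f" "\<alpha> > 0"
  shows "asy1 (\<lambda>z. f (of_real \<alpha> * z))"
proof -
  from asy1E[OF assms(1)] obtain p C Z where 1: "C \<ge> 0" "Z \<ge> 1"
    "\<And>z. Re z \<ge> Z \<Longrightarrow> cmod (f z - 1 - p / z) \<le> C * cmod z powr (- 3/2)" by metis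
  have "cmod (f (of_real \<alpha> * z) - 1 - (p / of_real \<alpha>) / z) \<le> (C * \<alpha> powr (-3/2)) * cmod z powr (- 3/2)"
    if "Re z \<ge> Z / \<alpha>" for z
  proof -
    have "Re (of_real \<alpha> * z) \<ge> Z" using that assms by (simp add: field_simps)
    from 1(3)[OF this] show ?thesis using assms by (simp add: norm_mult powr_mult mult_ac)
  qed
  then show ?thesis unfolding asy1_def by blast
qed

lemma asy1_inverse:
  assumes "asy1 f"
  shows "asy1 (\<lambda>z. inverse (f z))"
proof -
  from asy1E[OF assms(1)] obtain p C Z where 1: "C \<ge> 0" "Z \<ge> 1"
    "\<And>z. Re z \<ge> Z \<Longrightarrow> cmod (f z - 1 - p / z) \<le> C * cmod z powr (- 3/2)" by metis
  \<comment> \<open>The threshold \<open>2 * (cmod p + C)\<close> forces |f z - 1| <= 1/2, so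
    dividing by f z costs at most the factor 2.\<close>
  have "cmod (inverse (f z) - 1 - (-p) / z) \<le> 2 * (C * (1 + cmod p) + cmod p * cmod p) * cmod z powr (- 3/2)"
    if "Re z \<ge> max Z (2 * (cmod p + C))" for z
  proof -
    define u where "u = cmod z powr (- 3/2)"
    have z: "cmod z \<ge> 1" using cmod_ge_1_if_Re[of z] that 1 by auto
    have u: "0 \<le> u" "u \<le> 1" unfolding u_def using powr_minus_three_halves[OF z] by auto
    have u2: "1 / (cmod z)^2 \<le> u"
      unfolding u_def using z by (rule powr_minus_three_halves)
    have u1: "u \<le> 1 / cmod z"
      unfolding u_def using z by (rule powr_minus_three_halves)
    have zi: "cmod (p / z) \<le> cmod p"
      using z by (auto simp: norm_divide divide_le_eq mult_le_cancel_left1)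
    have f: "cmod (f z - 1 - p / z) \<le> C * u"
      using 1(3)[of z] that unfolding u_def by auto
    have "cmod (f z - 1) \<le> cmod (p / z) + cmod (f z - 1 - p / z)"
      using norm_triangle_ineq[of "p / z" "f z - 1 - p / z"] by simp
    also have "\<dots> \<le> cmod p / cmod z + C * (1 / cmod z)"
      using f mult_left_mono[OF u1 1(1)] by (simp add: norm_divide)
    also have "\<dots> = (cmod p + C) / cmod z" by (simp add: add_divide_distrib)
    also have "\<dots> \<le> 1 / 2"
    proof -
      have "2 * (cmod p + C) \<le> cmod z" "cmod z > 0" using that z complex_Re_le_cmod[of z] by auto
      then show ?thesis by (simp add: divide_le_eq)
    qed
    finally have "cmod (f z - 1) \<le> 1/2" .
    then have fl: "cmod (f z) \<ge> 1/2"
      using norm_triangle_ineq2[of 1 "1 - f z"] by (simp add: norm_minus_commute)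
    then have fn: "f z \<noteq> 0" by auto
    have pb: "cmod (1 - p / z) \<le> 1 + cmod p"
      using norm_triangle_ineq4[of 1 "p / z"] zi by simp
    have pq: "cmod (p / z * (p / z)) \<le> cmod p * cmod p * u"
      using mult_left_mono[OF u2, of "cmod p * cmod p"]
      by (simp add: norm_mult norm_divide power2_eq_square)
    have "z \<noteq> 0" using z by auto
    then have "inverse (f z) - 1 - (-p) / z =
       (- (f z - 1 - p / z) * (1 - p / z) + p / z * (p / z)) / f z"
      using fn by (simp add: divide_simps) (simp add: algebra_simps)
    then have "cmod (inverse (f z) - 1 - (-p) / z) =
       cmod (- (f z - 1 - p / z) * (1 - p / z) + p / z * (p / z)) / cmod (f z)"
      by (simp add: norm_divide)
    also have "\<dots> \<le> (cmod (f z - 1 - p / z) * cmod (1 - p / z) + cmod (p / z * (p / z))) / cmod (f z)"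
      using norm_triangle_ineq[of "- (f z - 1 - p / z) * (1 - p / z)" "p / z * (p / z)"]
      by (intro divide_right_mono) (simp_all only: norm_mult norm_minus_cancel norm_ge_zero)
    also have "\<dots> \<le> (C * u * (1 + cmod p) + cmod p * cmod p * u) / (1/2)"
      using f pb pq fl u 1 by (intro frac_le add_mono mult_mono) auto
    finally show ?thesis unfolding u_def by (simp add: algebra_simps)
  qed
  then show ?thesis unfolding asy1_def by blast
qed

lemma asy1_cong:
  assumes "asy1 f" "\<And>z. Re z \<ge> Z0 \<Longrightarrow> f z = g z"
  shows "asy1 g"
proof -
  from asy1E[OF assms(1)] obtain p C Z where 1: "C \<ge> 0" "Z \<ge> 1"
    "\<And>z. Re z \<ge> Z \<Longrightarrow> cmod (f z - 1 - p / z) \<le> C * cmod z powr (- 3/2)" by metis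
  show ?thesis unfolding asy1_def
    using 1 assms(2) by (intro exI[of _ p] exI[of _ C] exI[of _ "max Z Z0"] allI impI) (metis max.bounded_iff)
qed

lemma norm_exp_minus_1_le:
  fixes y :: complex
  shows "cmod (exp y - 1) \<le> cmod y * exp (cmod y)"
proof -
  have "cmod (exp y - 1) \<le> exp (cmod y) * cmod y"
    using Taylor_exp[of y 0] mult_right_mono[of "exp \<bar>Re y\<bar>" "exp (cmod y)" "cmod y"] abs_Re_le_cmod[of y]
    by simp
  then show ?thesis by (simp add: mult.commute)
qed

lemma asy1_exp: "asy1 (\<lambda>z. exp (q / z))"
proof -
  have "cmod (exp (q / z) - 1 - q / z) \<le> exp (cmod q) * (cmod q)^2 * cmod z powr (-3/2)"
    if "Re z \<ge> 1" for z
  proof -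
    have z: "cmod z \<ge> 1" using cmod_ge_1_if_Re[of z] that by auto
    define y where "y = q / z"
    have yq: "cmod y \<le> cmod q" 
      using z by (auto simp: y_def norm_divide divide_le_eq mult_le_cancel_left1)
    have "cmod (exp y - (\<Sum>k\<le>1. y ^ k / fact k)) \<le> exp \<bar>Re y\<bar> * (cmod y) ^ 2 / fact 1"
      using Taylor_exp[of y 1] by (simp add: numeral_2_eq_2)
    also have "\<dots> \<le> exp (cmod q) * (cmod y)^2"
      using yq abs_Re_le_cmod[of y] by (auto intro!: mult_right_mono)
    also have "\<dots> = exp (cmod q) * (cmod q)^2 * (1 / (cmod z)^2)"
      by (simp add: y_def norm_divide power_divide)
    also have "\<dots> \<le> exp (cmod q) * (cmod q)^2 * cmod z powr (-3/2)"
      using powr_minus_three_halves[OF z] by (intro mult_left_mono) auto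
    finally show ?thesis by (simp add: y_def algebra_simps)
  qed
  then show ?thesis unfolding asy1_def by blast
qed

text \<open>The summand at n = 0 is a division by zero and hence 0, so the sum over n < m is the
  Taylor polynomial of degree m - 1. The tail is dominated by a geometric series of ratio at most
  1/2, which gives the factor 2.\<close>

lemma norm_Ln_1_plus_minus_Taylor_le:
  assumes "cmod y \<le> 1/2"
  shows "cmod (Ln (1 + y) - (\<Sum>n<m. - ((-y)^n) / of_nat n)) \<le> 2 * cmod y ^ m"
proof -
  have s: "(\<lambda>n. - ((-y)^n) / of_nat n) sums Ln (1 + y)"
    using Ln_series'[of y] assms by simp
  then have "(\<lambda>n. - ((-y)^(n+m)) / of_nat (n+m)) sums (Ln (1 + y) - (\<Sum>n<m. - ((-y)^n) / of_nat n))"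
    by (subst sums_iff_shift) simp
  moreover have g: "(\<lambda>n. cmod y ^ (n+m)) sums (1 / (1 - cmod y) * cmod y ^ m)"
    unfolding power_add using assms by (intro sums_mult2 geometric_sums) auto
  moreover have "cmod (- ((-y)^(n+m)) / of_nat (n+m)) \<le> cmod y ^ (n+m)" for n
    by (cases "n + m = 0") (simp_all add: norm_divide norm_power divide_le_eq mult_le_cancel_left1 Suc_leI del: of_nat_add)
  ultimately have "cmod (Ln (1 + y) - (\<Sum>n<m. - ((-y)^n) / of_nat n)) \<le> 1 / (1 - cmod y) * cmod y ^ m"
    using norm_suminf_le[of "\<lambda>n. - ((-y)^(n+m)) / of_nat (n+m)" "\<lambda>n. cmod y ^ (n+m)"]
    by (simp add: sums_iff)
  also have "\<dots> \<le> 2 * cmod y ^ m"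
    using assms by (intro mult_right_mono) (auto simp: field_simps)
  finally show ?thesis .
qed

text \<open>The value of \<open>q\<close> is the one for which the logarithm of \<open>stirling_quot b (z + 1) / stirling_quot b z\<close>
  is \<open>O(z powr (-3))\<close>; the expansion of \<open>Gamma\<close> then follows by telescoping along \<open>z + n\<close>.\<close>

definition stirling_q :: "complex \<Rightarrow> complex" where
  "stirling_q b = b^2/2 - b/2 + 1/12"

definition stirling_step :: "complex \<Rightarrow> complex \<Rightarrow> complex" where
  "stirling_step b z = Ln (1 + b/z) - (z + b + 1/2) * Ln (1 + 1/z) + 1
     + stirling_q b / z - stirling_q b / (z + 1)"

definition stirling_quot :: "complex \<Rightarrow> complex \<Rightarrow> complex" where
  "stirling_quot b z = Gamma (z + b) * exp (z - (z + b - 1/2) * Ln z - stirling_q b / z)"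

text \<open>In y = 1/z the logarithm of 1 + b y is needed to second order, but that of 1 + y to
  third, because its coefficient z + b + 1/2 costs one power of y. The lower powers then cancel, the
  y^2 terms thanks to the value of \<open>stirling_q\<close>.\<close>

lemma stirling_step_bound:
  assumes z: "cmod z \<ge> 2 + 2 * cmod b"
  shows "cmod (stirling_step b z) \<le>
    (2 * cmod b ^ 3 + 5 + 2 * cmod (stirling_q b) + cmod b) * (1 / cmod z ^ 3)"
proof -
  define y where "y = 1 / z"
  define q where "q = stirling_q b"
  have cz: "cmod z \<ge> 2" using z norm_ge_zero[of b] by linarith
  then have z0: "z \<noteq> 0" by auto
  have y0: "y \<noteq> 0" and zy: "z = 1 / y" using z0 by (auto simp: y_def)
  have y1: "cmod y \<le> 1/2" using frac_le[of 1 1 2 "cmod z"] cz by (simp add: y_def norm_divide)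
  have by1: "cmod (b * y) \<le> 1/2"
    using z cz frac_le[of "cmod b" "cmod b" "2 * cmod b" "cmod z"]
    by (cases "b = 0") (simp_all add: y_def norm_mult norm_divide)
  have n1: "1 + y \<noteq> 0" using y1 by (auto simp: add_eq_0_iff)
  define R1 where "R1 = Ln (1 + b * y) - (b * y - b^2 * y^2 / 2)"
  define R2 where "R2 = Ln (1 + y) - (y - y^2 / 2 + y^3 / 3)"
  have R1: "cmod R1 \<le> 2 * cmod (b * y) ^ 3"
    using norm_Ln_1_plus_minus_Taylor_le[OF by1, of 3]
    by (simp add: R1_def eval_nat_numeral power_mult_distrib algebra_simps)
  have R2: "cmod R2 \<le> 2 * cmod y ^ 4"
    using norm_Ln_1_plus_minus_Taylor_le[OF y1, of 4]
    by (simp add: R2_def eval_nat_numeral power_mult_distrib algebra_simps)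
  have "stirling_step b z = Ln (1 + b * y) - (z + b + 1/2) * Ln (1 + y) + 1 + q * y - q * (y / (1 + y))"
    using z0 n1 by (simp add: stirling_step_def y_def q_def divide_simps add_ac)
  also have "\<dots> = R1 - (z + b + 1/2) * R2 + (b * y - b^2 * y^2 / 2
       - (1/y + b + 1/2) * (y - y^2 / 2 + y^3 / 3) + 1 + q * y - q * (y / (1 + y)))"
    by (simp add: R1_def R2_def zy algebra_simps)
  also have "b * y - b^2 * y^2 / 2 - (1/y + b + 1/2) * (y - y^2 / 2 + y^3 / 3) + 1 + q * y - q * (y / (1 + y))
      = - (q / (1 + y)) * y^3 - (b + 1/2) / 3 * y^3"
  proof -
    have "q * y - q * (y / (1 + y)) = q * y^2 - q / (1 + y) * y^3"
      using n1 by (simp add: field_simps power2_eq_square power3_eq_cube)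
    moreover have "b * y - b^2 * y^2 / 2 - (1/y + b + 1/2) * (y - y^2 / 2 + y^3 / 3) + 1 =
       - q * y^2 - (b + 1/2) / 3 * y^3"
      using y0 by (simp add: q_def stirling_q_def field_simps power2_eq_square power3_eq_cube)
    ultimately show ?thesis by simp
  qed
  finally have eq: "stirling_step b z = R1 - (z + b + 1/2) * R2 + (- (q / (1 + y)) * y^3 - (b + 1/2) / 3 * y^3)" .
  have zb: "cmod (z + b + 1/2) \<le> 2 * cmod z"
  proof -
    have "cmod (z + b + 1/2) \<le> cmod z + cmod b + 1/2"
      using norm_add3_le[of z b "1/2"] by simp
    then show ?thesis using z norm_ge_zero[of b] by linarith
  qed
  have "cmod ((z + b + 1/2) * R2) \<le> (2 * cmod z) * (2 * cmod y ^ 4)"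
    unfolding norm_mult using zb R2 by (intro mult_mono) auto
  also have "\<dots> = 4 * cmod y ^ 3"
    using z0 by (simp add: y_def norm_divide eval_nat_numeral field_simps)
  finally have R2': "cmod ((z + b + 1/2) * R2) \<le> 4 * cmod y ^ 3" .
  have "cmod (1 + y) \<ge> 1/2" using norm_triangle_ineq2[of 1 "- y"] y1 by simp
  then have "cmod (q / (1 + y)) \<le> 2 * cmod q"
    using mult_left_mono[of "1/2" "cmod (1+y)" "cmod q * 2"] n1 by (simp add: norm_divide field_simps)
  then have R3: "cmod (- (q / (1 + y)) * y^3) \<le> 2 * cmod q * cmod y ^ 3"
    by (simp only: norm_mult norm_minus_cancel norm_power mult_right_mono zero_le_power norm_ge_zero)
  have "cmod ((b + 1/2) / 3) \<le> cmod b + 1"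
  proof -
    have "cmod ((b + 1/2) / 3) = cmod (b + 1/2) / 3" by (simp add: norm_divide)
    moreover have "cmod (b + 1/2) \<le> cmod b + 1/2" using norm_triangle_ineq[of b "1/2"] by simp
    ultimately show ?thesis using norm_ge_zero[of b] by linarith
  qed
  then have R4: "cmod ((b + 1/2) / 3 * y^3) \<le> (cmod b + 1) * cmod y ^ 3"
    by (simp only: norm_mult norm_power mult_right_mono zero_le_power norm_ge_zero)
  have "cmod (stirling_step b z) \<le> cmod R1 + cmod ((z + b + 1/2) * R2)
      + (cmod (- (q / (1 + y)) * y^3) + cmod ((b + 1/2) / 3 * y^3))"
    unfolding eq by (intro norm_triangle_le add_mono norm_triangle_ineq4)
  also have "\<dots> \<le> 2 * cmod (b * y) ^ 3 + 4 * cmod y ^ 3 + (2 * cmod q * cmod y ^ 3 + (cmod b + 1) * cmod y ^ 3)"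
    by (intro add_mono R1 R2' R3 R4)
  also have "\<dots> = (2 * cmod b ^ 3 + 5 + 2 * cmod q + cmod b) * cmod y ^ 3"
    by (simp add: norm_mult power_mult_distrib algebra_simps)
  finally show ?thesis by (simp add: y_def q_def norm_divide power_divide)
qed

text \<open>Both factors of z (1 + 1/z) lie in the right half plane, so their arguments add up to
  less than pi in modulus and no branch correction occurs.\<close>

lemma Ln_add_1:
  assumes "Re z > 0"
  shows "Ln (z + 1) = Ln z + Ln (1 + 1/z)"
proof -
  have z0: "z \<noteq> 0" using assms by auto
  have "Re (1 / z) > 0" using assms z0 by (simp add: Re_divide field_simps sum_power2_gt_zero_iff complex_eq_iff)
  then have p: "Re (1 + 1/z) > 0" by simp
  then have n: "1 + 1/z \<noteq> 0" by (metis less_irrefl zero_complex.sel(1))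
  have "\<bar>Im (Ln z)\<bar> < pi/2" "\<bar>Im (Ln (1 + 1/z))\<bar> < pi/2"
    using assms p z0 n Re_Ln_pos_lt by blast+
  then have "Ln (z * (1 + 1/z)) = Ln z + Ln (1 + 1/z)"
    using z0 n by (intro Ln_times_simple) linarith+
  then show ?thesis using z0 by (simp add: distrib_left)
qed

lemma Re_pos_not_nonpos_Ints: "Re z > 0 \<Longrightarrow> z \<notin> \<int>\<^sub>\<le>\<^sub>0"
  by (auto elim!: nonpos_Ints_cases)

lemma stirling_quot_Suc:
  assumes "Re z > 0" "Re (z + b) > 0"
  shows "stirling_quot b (z + 1) = stirling_quot b z * exp (stirling_step b z)"
proof -
  have z0: "z \<noteq> 0" "z + b \<noteq> 0" using assms by (auto simp: complex_eq_iff)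
  have "z + b \<notin> \<int>\<^sub>\<le>\<^sub>0" using assms(2) by (rule Re_pos_not_nonpos_Ints)
  then have G: "Gamma (z + 1 + b) = (z + b) * Gamma (z + b)"
    using Gamma_plus1[of "z + b"] by (simp add: add_ac)
  have b1: "z + b = exp (Ln z + Ln (1 + b / z))"
    using z0 by (simp add: exp_add field_simps)
  show ?thesis
    unfolding stirling_quot_def G Ln_add_1[OF assms(1)]
    by (subst b1, simp only: mult_ac exp_add[symmetric])
       (simp add: stirling_step_def algebra_simps flip: exp_add)
qed

lemma stirling_quot_add_nat:
  assumes "Re z > 0" "Re (z + b) > 0"
  shows "stirling_quot b (z + of_nat n) = stirling_quot b z * exp (\<Sum>k<n. stirling_step b (z + of_nat k))"
proof (induction n)
  case (Suc n)
  have "stirling_quot b (z + of_nat n + 1) = stirling_quot b (z + of_nat n) * exp (stirling_step b (z + of_nat n))"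
    using assms by (intro stirling_quot_Suc) auto
  then show ?case using Suc by (simp add: exp_add add_ac mult_ac)
qed simp

lemma tendsto_of_nat_mult_Ln:
  "(\<lambda>n. of_nat n * Ln (1 + z / of_nat n)) \<longlonglongrightarrow> z"
proof (rule Lim_null_comparison[THEN LIM_zero_cancel])
  show "(\<lambda>n. 2 * cmod z ^ 2 / real n) \<longlonglongrightarrow> 0" by real_asymp
  have "eventually (\<lambda>n. n > 2 * cmod z \<and> n > 0) sequentially"
    by (intro eventually_conj eventually_gt_at_top
      eventually_compose_filterlim[OF eventually_gt_at_top filterlim_real_sequentially])
  then show "eventually (\<lambda>n. cmod (of_nat n * Ln (1 + z / of_nat n) - z) \<le> 2 * cmod z ^ 2 / real n) sequentially"
  proof eventually_elim
    case (elim n)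
    define y where "y = z / of_nat n"
    have y: "cmod y \<le> 1/2" using elim by (simp add: y_def norm_divide field_simps)
    have "of_nat n * Ln (1 + z / of_nat n) - z = of_nat n * (Ln (1 + y) - y)"
      using elim by (simp add: y_def algebra_simps)
    moreover have "cmod (Ln (1 + y) - y) \<le> 2 * cmod y ^ 2"
      using norm_Ln_1_plus_minus_Taylor_le[OF y, of 2] by (simp add: eval_nat_numeral)
    then have "real n * cmod (Ln (1 + y) - y) \<le> real n * (2 * cmod y ^ 2)"
      by (intro mult_left_mono) auto
    moreover have "real n * (2 * cmod y ^ 2) = 2 * cmod z ^ 2 / real n"
      using elim by (simp add: y_def norm_divide field_simps power2_eq_square)
    ultimately show ?case by (simp add: norm_mult)
  qed
qed

text \<open>The product formula behind \<open>Gamma_series'\<close> compares Gamma (z + b + n) with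
  (n - 1)! times n powr (z + b), and n Ln (1 + z/n) tends to z, so all dependence on z and b drops
  out. The numerator is free of z and b; hence all quotients
  \<open>stirling_quot b (z + of_nat n)\<close> share one limit as soon as one of them converges to
  a nonzero limit.\<close>

lemma stirling_quot_limit_indep:
  assumes "Re z > 0" "Re (z + b) > 0"
  shows "(\<lambda>n. fact (n - 1) * exp (of_nat n - (of_nat n - 1/2) * of_real (ln (of_nat n)))
      / stirling_quot b (z + of_nat n)) \<longlonglongrightarrow> 1"
proof -
  define z' where "z' = z + b"
  have z': "z' \<notin> \<int>\<^sub>\<le>\<^sub>0" using assms(2) Re_pos_not_nonpos_Ints unfolding z'_def by blast
  then have G0: "Gamma z' \<noteq> 0" by (simp add: Gamma_eq_zero_iff)
  have "(\<lambda>n. Gamma_series' z' n / Gamma z') \<longlonglongrightarrow> Gamma z' / Gamma z'"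
    by (intro tendsto_intros Gamma_series'_LIMSEQ G0)
  then have 1: "(\<lambda>n. fact (n - 1) * exp (z' * of_real (ln (of_nat n))) / Gamma (z' + of_nat n)) \<longlonglongrightarrow> 1"
    using G0 by (simp add: Gamma_series'_def pochhammer_Gamma[OF z'])
  define D where "D = (\<lambda>n::nat. of_nat n * Ln (1 + z / of_nat n) + (z + b - 1/2) * Ln (1 + z / of_nat n)
      - z + stirling_q b / (z + of_nat n))"
  have L0: "(\<lambda>n. z / of_nat n) \<longlonglongrightarrow> 0" by (rule lim_const_over_n)
  have q0: "(\<lambda>n. stirling_q b / (z + of_nat n)) \<longlonglongrightarrow> 0"
    by (intro tendsto_divide_0[OF tendsto_const] tendsto_add_filterlim_at_infinity[OF tendsto_const]
        tendsto_of_nat)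
  have "D \<longlonglongrightarrow> z + (z + b - 1/2) * Ln (1 + 0) - z + 0"
    unfolding D_def by (intro tendsto_intros tendsto_of_nat_mult_Ln L0 q0) auto
  then have "(\<lambda>n. exp (D n)) \<longlonglongrightarrow> exp 0"
    by (intro tendsto_intros) simp
  from tendsto_mult[OF 1 this]
  have "(\<lambda>n. fact (n - 1) * exp (z' * of_real (ln (of_nat n))) / Gamma (z' + of_nat n) * exp (D n)) \<longlonglongrightarrow> 1"
    by simp
  moreover have "eventually (\<lambda>n. fact (n - 1) * exp (z' * of_real (ln (of_nat n))) / Gamma (z' + of_nat n) * exp (D n)
     = fact (n - 1) * exp (of_nat n - (of_nat n - 1/2) * of_real (ln (of_nat n)))
      / stirling_quot b (z + of_nat n)) sequentially"
    using eventually_gt_at_top[of 0]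
  proof eventually_elim
    case (elim n)
    define l where "l = complex_of_real (ln (of_nat n))"
    have z0: "z \<noteq> 0" using assms by auto
    have "Re (z / of_nat n) > 0" using assms elim by (simp add: Re_divide_of_nat)
    then have n0: "1 + z / of_nat n \<noteq> 0"
      by (metis add_less_same_cancel1 add_eq_0_iff uminus_complex.sel(1) one_complex.sel(1) not_less_iff_gr_or_eq
        less_trans neg_less_0_iff_less zero_less_one)
    have L: "Ln (z + of_nat n) = l + Ln (1 + z / of_nat n)"
      using Ln_times_of_real[of "real n" "1 + z / of_nat n"] elim n0
      by (simp add: l_def distrib_left add_ac)
    have "stirling_quot b (z + of_nat n) = Gamma (z' + of_nat n) *
       exp (z + of_nat n - (z + of_nat n + b - 1/2) * (l + Ln (1 + z / of_nat n)) - stirling_q b / (z + of_nat n))"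
      by (simp add: stirling_quot_def L z'_def add_ac)
    also have "\<dots> = Gamma (z' + of_nat n) * exp ((of_nat n - (of_nat n - 1/2) * l) - z' * l - D n)"
      by (simp add: D_def z'_def algebra_simps)
    finally have S: "stirling_quot b (z + of_nat n) =
        Gamma (z' + of_nat n) * (exp (of_nat n - (of_nat n - 1/2) * l) / exp (z' * l) / exp (D n))"
      by (simp only: exp_diff)
    show ?case unfolding S l_def[symmetric] by simp
  qed
  ultimately show ?thesis by (rule Lim_transform_eventually)
qed

lemma summable_stirling_step:
  assumes "Re z \<ge> 2 + 2 * cmod b"
  defines "C \<equiv> 2 * cmod b ^ 3 + 5 + 2 * cmod (stirling_q b) + cmod b"
    and "S \<equiv> (\<Sum>n. real (Suc n) powr (- 3/2))"
  shows "summable (\<lambda>n. stirling_step b (z + of_nat n))"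
    and "cmod (\<Sum>n. stirling_step b (z + of_nat n)) \<le> C * S * cmod z powr (-3/2)"
proof -
  have sS: "summable (\<lambda>n. real (Suc n) powr (- 3/2))"
    unfolding summable_Suc_iff[of "\<lambda>n. real n powr (- 3/2)"] by (simp add: summable_real_powr_iff)
  have C: "C \<ge> 0" unfolding C_def by simp
  have b: "cmod (stirling_step b (z + of_nat n)) \<le> C * cmod z powr (-3/2) * real (Suc n) powr (-3/2)" for n
  proof -
    have R: "Re z \<ge> 2" using assms(1) norm_ge_zero[of b] by linarith
    have 1: "cmod (z + of_nat n) \<ge> cmod z"
    proof -
      have "cmod z ^ 2 \<le> cmod (z + of_nat n) ^ 2"
        using R unfolding cmod_power2 by (simp add: power2_eq_square algebra_simps)
      then show ?thesis by (rule power2_le_imp_le) simp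
    qed
    have 2: "cmod (z + of_nat n) \<ge> real (Suc n)"
      using complex_Re_le_cmod[of "z + of_nat n"] R by simp
    have 3: "cmod z \<ge> 2 + 2 * cmod b" using assms(1) complex_Re_le_cmod[of z] by linarith
    have p: "cmod (z + of_nat n) > 0" using 2 by linarith
    have zp: "cmod z > 0" using 3 norm_ge_zero[of b] by linarith
    have "cmod (stirling_step b (z + of_nat n)) \<le> C * (1 / cmod (z + of_nat n) ^ 3)"
      unfolding C_def using 1 3 by (intro stirling_step_bound) linarith
    \<comment> \<open>The third power is split into equal halves: one is bounded through |z + n| >=
      |z| and gives the decay in z, the other through |z + n| >= n + 1 and gives
      summability.\<close>
    also have "1 / cmod (z + of_nat n) ^ 3 = cmod (z + of_nat n) powr (-3/2) * cmod (z + of_nat n) powr (-3/2)"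
      using p by (simp add: powr_add[symmetric] powr_minus_divide)
    also have "C * \<dots> \<le> C * (cmod z powr (-3/2) * real (Suc n) powr (-3/2))"
      using 1 2 p zp C by (intro mult_left_mono mult_mono powr_mono2') auto
    finally show ?thesis by (simp only: mult_ac)
  qed
  have s: "summable (\<lambda>n. C * cmod z powr (-3/2) * real (Suc n) powr (-3/2))"
    by (intro summable_mult sS)
  show "summable (\<lambda>n. stirling_step b (z + of_nat n))"
    by (rule summable_comparison_test'[OF s]) (use b in auto)
  have "cmod (\<Sum>n. stirling_step b (z + of_nat n)) \<le> (\<Sum>n. C * cmod z powr (-3/2) * real (Suc n) powr (-3/2))"
    by (rule norm_suminf_le[OF b s])
  also have "\<dots> = C * cmod z powr (-3/2) * S"
    unfolding S_def by (rule suminf_mult[OF sS])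
  finally show "cmod (\<Sum>n. stirling_step b (z + of_nat n)) \<le> C * S * cmod z powr (-3/2)"
    by (simp add: mult_ac)
qed

lemma stirling_quot_tendsto_exp:
  assumes "Re z \<ge> 2 + 2 * cmod b"
  shows "(\<lambda>n. stirling_quot b (z + of_nat n)) \<longlonglongrightarrow>
     stirling_quot b z * exp (\<Sum>k. stirling_step b (z + of_nat k))"
proof -
  have "Re z > 0" "Re (z + b) > 0" 
    using assms norm_ge_zero[of b] abs_Re_le_cmod[of b] unfolding plus_complex.sel by linarith+
  then show ?thesis
    using summable_stirling_step(1)[OF assms]
    by (auto simp: stirling_quot_add_nat intro!: tendsto_intros summable_LIMSEQ)
qed

text \<open>Telescoping at the point 2 with b = 0 shows that a nonzero limit K exists, and by
  \<open>stirling_quot_limit_indep\<close> it is common to all z and b. Its value comes from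
  Legendre duplication: the quotient of the values at m with b = 0 and b = 1/2 by the value at 2m
  tends to K K / K, while the formula evaluates it as sqrt (2 pi) times a factor tending to
  1.\<close>

lemma stirling_quot_limit:
  assumes "Re z > 0" "Re (z + b) > 0"
  shows "(\<lambda>n. stirling_quot b (z + of_nat n)) \<longlonglongrightarrow> of_real (sqrt (2 * pi))"
proof -
  let ?e = "\<lambda>n. fact (n - 1) * exp (of_nat n - (of_nat n - 1/2) * of_real (ln (of_nat n))) :: complex"
  define K where "K = stirling_quot 0 2 * exp (\<Sum>k. stirling_step 0 (2 + of_nat k))"
  have K0: "K \<noteq> 0"
    by (auto simp: K_def stirling_quot_def Gamma_eq_zero_iff Re_pos_not_nonpos_Ints)
  have SQ2: "(\<lambda>n. stirling_quot 0 (2 + of_nat n)) \<longlonglongrightarrow> K"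
    unfolding K_def by (rule stirling_quot_tendsto_exp) simp
  have ev2: "eventually (\<lambda>n. stirling_quot 0 (2 + of_nat n) \<noteq> 0) sequentially"
    using SQ2 K0 by (rule tendsto_imp_eventually_ne)
  have "(\<lambda>n. ?e n / stirling_quot 0 (2 + of_nat n) * stirling_quot 0 (2 + of_nat n)) \<longlonglongrightarrow> 1 * K"
    by (intro tendsto_mult stirling_quot_limit_indep SQ2) auto
  moreover have "eventually (\<lambda>n. ?e n / stirling_quot 0 (2 + of_nat n) * stirling_quot 0 (2 + of_nat n) = ?e n) sequentially"
    using ev2 by eventually_elim simp
  ultimately have e: "?e \<longlonglongrightarrow> K" by (simp add: Lim_transform_eventually)
  have lim: "(\<lambda>n. stirling_quot b (z + of_nat n)) \<longlonglongrightarrow> K" if "Re z > 0" "Re (z + b) > 0" for z b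
  proof -
    have "(\<lambda>n. ?e n / (?e n / stirling_quot b (z + of_nat n))) \<longlonglongrightarrow> K / 1"
      using that by (intro tendsto_divide e stirling_quot_limit_indep) auto
    then show ?thesis by simp
  qed
  have a: "(\<lambda>n. stirling_quot 0 (1 + of_nat n)) \<longlonglongrightarrow> K" "(\<lambda>n. stirling_quot (1/2) (1 + of_nat n)) \<longlonglongrightarrow> K"
    by (rule lim; simp)+
  \<comment> \<open>The even subsequence is taken because 2 + 2n = 2m for m = n + 1, the argument in
    the duplication formula.\<close>
  have "(\<lambda>n. stirling_quot 0 (2 + of_nat (2 * n))) \<longlonglongrightarrow> K"
    using LIMSEQ_subseq_LIMSEQ[OF SQ2, of "\<lambda>n. 2 * n"] by (simp add: strict_mono_def o_def)
  then have "(\<lambda>n. stirling_quot 0 (1 + of_nat n) * stirling_quot (1/2) (1 + of_nat n) / stirling_quot 0 (2 + of_nat (2 * n)))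
     \<longlonglongrightarrow> K * K / K" by (intro tendsto_intros a K0)
  moreover have "stirling_quot 0 (1 + of_nat n) * stirling_quot (1/2) (1 + of_nat n) / stirling_quot 0 (2 + of_nat (2 * n))
     = of_real (sqrt (2 * pi)) * exp ((stirling_q 0 / 2 - stirling_q 0 - stirling_q (1/2)) * (1 / of_nat (Suc n)))" for n
  proof -
    define m :: complex where "m = of_nat (Suc n)"
    define l where "l = complex_of_real (ln (real (Suc n)))"
    have m0: "m \<noteq> 0" unfolding m_def by (metis of_nat_neq_0)
    have L: "Ln m = l" unfolding m_def l_def by (metis Ln_of_nat_over_of_nat Ln_of_real of_nat_0_less_iff of_real_of_nat_eq zero_less_Suc)
    have L2: "Ln (2 * m) = of_real (ln 2) + l"
      using Ln_times_of_real[of 2 m] m0 Ln_of_real[of 2] by (simp add: L)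
    have G: "Gamma m * Gamma (m + 1/2) = exp ((1 - 2 * m) * of_real (ln 2)) * of_real (sqrt pi) * Gamma (2 * m)"
      by (rule Gamma_legendre_duplication; rule Re_pos_not_nonpos_Ints; simp add: m_def)
    have G0: "Gamma (2 * m) \<noteq> 0"
      by (simp add: Gamma_eq_zero_iff, rule Re_pos_not_nonpos_Ints) (simp add: m_def)
    have s2: "of_real (sqrt (2 * pi)) = exp (1/2 * of_real (ln 2)) * complex_of_real (sqrt pi)"
    proof -
      have "sqrt (2 * pi) = exp (1/2 * ln 2) * sqrt pi"
        by (simp add: real_sqrt_mult powr_half_sqrt[symmetric] powr_def)
      then show ?thesis by (simp flip: exp_of_real)
    qed
    have "stirling_quot 0 m * stirling_quot (1/2) m =
       (Gamma m * Gamma (m + 1/2)) * (exp (m - (m - 1/2) * l - stirling_q 0 / m) * exp (m - m * l - stirling_q (1/2) / m))"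
      by (simp add: stirling_quot_def L)
    also have "\<dots> / stirling_quot 0 (2 * m) = of_real (sqrt pi) * (exp ((1 - 2 * m) * of_real (ln 2)) *
       exp (m - (m - 1/2) * l - stirling_q 0 / m) * exp (m - m * l - stirling_q (1/2) / m)
        / exp (2 * m - (2 * m - 1/2) * (of_real (ln 2) + l) - stirling_q 0 / (2 * m)))"
      using G0 unfolding G by (simp add: stirling_quot_def L2)
    also have "\<dots> = of_real (sqrt pi) * exp (1/2 * of_real (ln 2) + (stirling_q 0 / 2 - stirling_q 0 - stirling_q (1/2)) * (1 / m))"
      unfolding exp_diff[symmetric] exp_add[symmetric]
      using m0 by (intro arg_cong2[of _ _ _ _ "(*)"] refl arg_cong[of _ _ exp]) (simp add: field_simps)
    also have "\<dots> = of_real (sqrt (2 * pi)) * exp ((stirling_q 0 / 2 - stirling_q 0 - stirling_q (1/2)) * (1 / m))"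
      unfolding exp_add s2 by simp
    finally show ?thesis by (simp add: m_def add_ac algebra_simps)
  qed
  ultimately have "(\<lambda>n. of_real (sqrt (2 * pi)) * exp ((stirling_q 0 / 2 - stirling_q 0 - stirling_q (1/2)) * (1 / of_nat (Suc n)))) \<longlonglongrightarrow> K"
    using K0 by simp
  moreover have "(\<lambda>n. of_real (sqrt (2 * pi)) * exp ((stirling_q 0 / 2 - stirling_q 0 - stirling_q (1/2)) * (1 / of_nat (Suc n))))
     \<longlonglongrightarrow> of_real (sqrt (2 * pi)) * exp ((stirling_q 0 / 2 - stirling_q 0 - stirling_q (1/2)) * 0)"
    by (intro tendsto_intros LIMSEQ_Suc[of "\<lambda>n. 1 / of_nat n"] lim_1_over_n)
  ultimately have "K = of_real (sqrt (2 * pi))"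
    using LIMSEQ_unique by fastforce
  then show ?thesis using lim[OF assms] by simp
qed

text \<open>Telescoping to infinity gives \<open>stirling_quot b z * exp (s z)\<close> = sqrt (2
  pi), so the quotient in question equals \<open>exp (- s z) * exp (stirling_q b / z)\<close>. Since
  s z = O(|z| powr (-3/2)), only the second factor contributes at order 1/z.\<close>

theorem Gamma_stirling:
  "asy1 (\<lambda>z. Gamma (z + b) / (of_real (sqrt (2 * pi)) * exp ((z + b - 1/2) * Ln z - z)))"
proof -
  define C where "C = (2 * cmod b ^ 3 + 5 + 2 * cmod (stirling_q b) + cmod b) * (\<Sum>n. real (Suc n) powr (- 3/2))"
  define s where "s = (\<lambda>z. \<Sum>k. stirling_step b (z + of_nat k))"
  have eq: "stirling_quot b z * exp (s z) = of_real (sqrt (2 * pi))" if "Re z \<ge> 2 + 2 * cmod b" for z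
  proof -
    have "Re z > 0" "Re (z + b) > 0" 
      using that norm_ge_zero[of b] abs_Re_le_cmod[of b] unfolding plus_complex.sel by linarith+
    then show ?thesis unfolding s_def
      using LIMSEQ_unique[OF stirling_quot_limit stirling_quot_tendsto_exp[OF that]] by metis
  qed
  have "asy1 (\<lambda>z. exp (- s z))"
  proof (rule asy1_near_1)
    fix z assume z: "Re z \<ge> 2 + 2 * cmod b"
    have z1: "cmod z \<ge> 1" using z norm_ge_zero[of b] by (intro cmod_ge_1_if_Re) linarith
    have s: "cmod (s z) \<le> C * cmod z powr (-3/2)"
      using summable_stirling_step(2)[OF z] unfolding s_def C_def by simp
    then have C0: "C * cmod z powr (-3/2) \<ge> 0" using norm_ge_zero[of "s z"] by linarith
    have "cmod z powr (-3/2) > 0" using z1 by auto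
    then have "C \<ge> 0" using C0 by (simp add: zero_le_mult_iff)
    then have "C * cmod z powr (-3/2) \<le> C" using powr_minus_three_halves(1)[OF z1] by (simp add: mult_left_le)
    then have s1: "cmod (s z) \<le> C" using s by linarith
    have "cmod (exp (- s z) - 1) \<le> cmod (s z) * exp (cmod (s z))"
      using norm_exp_minus_1_le[of "- s z"] by simp
    also have "\<dots> \<le> (C * cmod z powr (-3/2)) * exp C"
      using s s1 C0 by (intro mult_mono) auto
    finally show "cmod (exp (- s z) - 1) \<le> (C * exp C) * cmod z powr (-3/2)" by (simp add: mult_ac)
  qed
  then have "asy1 (\<lambda>z. exp (- s z) * exp (stirling_q b / z))"
    by (intro asy1_mult asy1_exp)
  then show ?thesis
  proof (rule asy1_cong)
    fix z assume z: "Re z \<ge> 2 + 2 * cmod b"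
    define E where "E = exp ((z + b - 1/2) * Ln z - z)"
    have "exp (z - (z + b - 1/2) * Ln z - stirling_q b / z) = 1 / E / exp (stirling_q b / z)"
      unfolding E_def by (simp add: exp_diff)
    then have "stirling_quot b z = Gamma (z + b) / E / exp (stirling_q b / z)"
      by (simp add: stirling_quot_def)
    then have *: "of_real (sqrt (2 * pi)) = Gamma (z + b) / E / exp (stirling_q b / z) * exp (s z)"
      using eq[OF z] by simp
    have E0: "E \<noteq> 0" by (simp add: E_def)
    have "Gamma (z + b) \<noteq> 0"
    proof
      assume "Gamma (z + b) = 0"
      then show False using * by simp
    qed
    moreover have "inverse S * Q = G / (G / E / Q * S * E)" if "G \<noteq> 0" "Q \<noteq> 0" "S \<noteq> 0" for G Q S
      using that E0 by (simp add: field_simps)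
    ultimately show "exp (- s z) * exp (stirling_q b / z) =
        Gamma (z + b) / (of_real (sqrt (2 * pi)) * exp ((z + b - 1/2) * Ln z - z))"
      unfolding E_def[symmetric] * exp_minus by simp
  qed
qed

section \<open>Growth of Gamma and 1/Gamma in right half planes\<close>

lemma mult_cos_le_sin:
  fixes x :: real
  assumes "0 \<le> x" "x \<le> pi/2"
  shows "x * cos x \<le> sin x"
proof (cases "x = pi/2")
  case False
  have "arctan (tan x) \<le> tan x" if "x > 0"
    using assms False that by (intro arctan_le_self) (auto intro: tan_pos_pi2_le less_imp_le tan_gt_zero)
  then have "x \<le> tan x" using assms False by (cases "x = 0") (auto simp: arctan_tan)
  then show ?thesis using assms False cos_gt_zero_pi[of x] by (simp add: tan_def field_simps)
next
  case True
  then show ?thesis by (simp only: cos_pi_half sin_pi_half)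
qed

text \<open>With y = pi/2 - |arg z| this is y cos y <= sin y scaled by |z|. The loss
  \<open>Re z\<close> cancels the term \<open>- Re z\<close> in \<open>norm_stirling_main\<close>,
  so Stirling's main term is at most exp (- pi/2 |Im z|) times a power of |z|, uniformly in the half
  plane.\<close>

lemma Im_Ln_lower:
  assumes "Re z > 0"
  shows "Im z * Im (Ln z) \<ge> pi/2 * \<bar>Im z\<bar> - Re z"
proof -
  have z0: "z \<noteq> 0" using assms by auto
  define t where "t = Im (Ln z)"
  have t: "\<bar>t\<bar> < pi/2" using assms z0 Re_Ln_pos_lt unfolding t_def by blast
  have "exp (Ln z) = z" using z0 by simp
  then have z: "Re z = cmod z * cos t" "Im z = cmod z * sin t"
    using Re_exp[of "Ln z"] Im_exp[of "Ln z"] z0 unfolding t_def by auto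
  have s: "t \<ge> 0 \<Longrightarrow> sin t \<ge> 0" "t < 0 \<Longrightarrow> sin t \<le> 0"
    using t sin_ge_zero[of t] sin_ge_zero[of "-t"] by auto
  have a: "\<bar>Im z\<bar> = cmod z * cos (pi/2 - \<bar>t\<bar>)" "Re z = cmod z * sin (pi/2 - \<bar>t\<bar>)"
  proof -
    have "sin (pi/2 - \<bar>t\<bar>) = cos \<bar>t\<bar>" using cos_sin_eq[of "\<bar>t\<bar>"] by simp
    moreover have "cos (pi/2 - \<bar>t\<bar>) = sin \<bar>t\<bar>" using sin_cos_eq[of "\<bar>t\<bar>"] by simp
    moreover have "cos \<bar>t\<bar> = cos t" by (cases "t \<ge> 0") (simp_all only: abs_of_nonneg abs_of_neg not_le cos_minus)
    moreover have "sin \<bar>t\<bar> = \<bar>sin t\<bar>" using s by (cases "t \<ge> 0") auto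
    ultimately have *: "sin (pi/2 - \<bar>t\<bar>) = cos t" "cos (pi/2 - \<bar>t\<bar>) = \<bar>sin t\<bar>" by simp_all
    show "\<bar>Im z\<bar> = cmod z * cos (pi/2 - \<bar>t\<bar>)" unfolding * by (metis z(2) abs_mult abs_norm_cancel)
    show "Re z = cmod z * sin (pi/2 - \<bar>t\<bar>)" unfolding * by (rule z(1))
  qed
  have b: "Im z * t = \<bar>Im z\<bar> * \<bar>t\<bar>"
  proof -
    have "sin t * t = \<bar>sin t\<bar> * \<bar>t\<bar>" using s by (cases "t \<ge> 0") auto
    then show ?thesis unfolding z(2) abs_mult by simp
  qed
  have "(pi/2 - \<bar>t\<bar>) * cos (pi/2 - \<bar>t\<bar>) \<le> sin (pi/2 - \<bar>t\<bar>)"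
    using t by (intro mult_cos_le_sin) auto
  then have "cmod z * ((pi/2 - \<bar>t\<bar>) * cos (pi/2 - \<bar>t\<bar>)) \<le> cmod z * sin (pi/2 - \<bar>t\<bar>)"
    by (intro mult_left_mono) auto
  then have "(pi/2 - \<bar>t\<bar>) * \<bar>Im z\<bar> \<le> Re z" unfolding a by (simp add: mult_ac)
  then show ?thesis using b unfolding t_def by (simp add: algebra_simps)
qed

lemma asy1_bounds:
  assumes "asy1 f"
  obtains C Z where "Z \<ge> 1" "\<And>z. Re z \<ge> Z \<Longrightarrow> cmod (f z) \<le> C" "\<And>z. Re z \<ge> Z \<Longrightarrow> cmod (f z) \<ge> 1/2"
proof -
  from asy1E[OF assms] obtain p C Z where 1: "C \<ge> 0" "Z \<ge> 1"
    "\<And>z. Re z \<ge> Z \<Longrightarrow> cmod (f z - 1 - p / z) \<le> C * cmod z powr (- 3/2)" by metis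
  have "cmod (f z - 1) \<le> 1/2" if "Re z \<ge> max Z (2 * (cmod p + C))" for z
  proof -
    have z: "cmod z \<ge> 1" using cmod_ge_1_if_Re[of z] that 1 by auto
    have "cmod (f z - 1) \<le> cmod (p / z) + cmod (f z - 1 - p / z)"
      using norm_triangle_ineq[of "p / z" "f z - 1 - p / z"] by simp
    also have "\<dots> \<le> cmod p / cmod z + C * (1 / cmod z)"
      using 1(3)[of z] that mult_left_mono[OF powr_minus_three_halves(3)[OF z] 1(1)] by (simp add: norm_divide)
    also have "\<dots> = (cmod p + C) / cmod z" by (simp add: add_divide_distrib)
    also have "\<dots> \<le> 1 / 2"
    proof -
      have "2 * (cmod p + C) \<le> cmod z" "cmod z > 0" using that z complex_Re_le_cmod[of z] by auto
      then show ?thesis by (simp add: divide_le_eq)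
    qed
    finally show ?thesis .
  qed
  note * = this
  show ?thesis
  proof (rule that[of "max Z (2 * (cmod p + C))" "3/2"])
    fix z assume "Re z \<ge> max Z (2 * (cmod p + C))"
    from *[OF this] show "cmod (f z) \<le> 3/2" "cmod (f z) \<ge> 1/2"
      using norm_triangle_ineq[of 1 "f z - 1"] norm_triangle_ineq2[of 1 "1 - f z"]
      by (auto simp: norm_minus_commute)
  qed (use 1 in auto)
qed

lemma norm_stirling_main:
  assumes "Re z > 0"
  shows "cmod (exp ((z - 1/2) * Ln z - z)) = exp ((Re z - 1/2) * ln (cmod z) - Im z * Im (Ln z) - Re z)"
proof -
  have "z \<noteq> 0" using assms by auto
  then have "Re (Ln z) = ln (cmod z)" by simp
  then show ?thesis by (simp only: norm_exp_eq_Re minus_complex.sel times_complex.sel) simp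
qed

lemma Gamma_upper_bound:
  obtains C Z where "C > 0" "Z \<ge> 1" "\<And>z. Re z \<ge> Z \<Longrightarrow>
     cmod (Gamma z) * exp (pi/2 * \<bar>Im z\<bar>) \<le> C * cmod z powr (Re z - 1/2)"
proof -
  from asy1_bounds[OF Gamma_stirling[of 0]] obtain C Z where C: "Z \<ge> 1"
    "\<And>z. Re z \<ge> Z \<Longrightarrow> cmod (Gamma z / (of_real (sqrt (2 * pi)) * exp ((z - 1/2) * Ln z - z))) \<le> C"
    by (metis add.right_neutral)
  have "cmod (Gamma z) * exp (pi/2 * \<bar>Im z\<bar>) \<le> (max C 1 * sqrt (2 * pi)) * cmod z powr (Re z - 1/2)" if z: "Re z \<ge> Z" for z
  proof -
    have z0: "Re z > 0" "z \<noteq> 0" using z C(1) by auto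
    have "cmod (Gamma z) \<le> C * (sqrt (2 * pi) * exp ((Re z - 1/2) * ln (cmod z) - Im z * Im (Ln z) - Re z))"
      using C(2)[OF z] by (simp add: norm_divide norm_mult divide_le_eq norm_stirling_main[OF z0(1)] del: norm_exp_eq_Re)
    also have "\<dots> \<le> max C 1 * (sqrt (2 * pi) * exp ((Re z - 1/2) * ln (cmod z) - pi/2 * \<bar>Im z\<bar>))"
      using Im_Ln_lower[OF z0(1)] by (intro mult_mono) auto
    finally have "cmod (Gamma z) * exp (pi/2 * \<bar>Im z\<bar>) \<le>
      max C 1 * (sqrt (2 * pi) * exp ((Re z - 1/2) * ln (cmod z) - pi/2 * \<bar>Im z\<bar>)) * exp (pi/2 * \<bar>Im z\<bar>)"
      by (intro mult_right_mono) auto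
    also have "\<dots> = (max C 1 * sqrt (2 * pi)) * cmod z powr (Re z - 1/2)"
      using z0 by (simp add: powr_def exp_diff)
    finally show ?thesis .
  qed
  then show ?thesis using that[of "max C 1 * sqrt (2 * pi)" Z] C(1) by auto
qed

text \<open>The constant 3 is 2 from |arg z| < pi/2 < 2 plus 1 from Re z <= |z|; the logarithmic
  term of Stirling's formula has a favourable sign for 1/Gamma.\<close>

lemma rGamma_exp_bound_right:
  obtains K Z where "K \<ge> 0" "\<And>z. Re z \<ge> Z \<Longrightarrow> cmod (rGamma z) \<le> K * exp (3 * cmod z)"
proof -
  from asy1_bounds[OF Gamma_stirling[of 0]] obtain C Z where C: "Z \<ge> 1"
    "\<And>z. Re z \<ge> Z \<Longrightarrow> cmod (Gamma z / (of_real (sqrt (2 * pi)) * exp ((z - 1/2) * Ln z - z))) \<ge> 1/2"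
    by (metis add.right_neutral)
  have "cmod (rGamma z) \<le> 2 / sqrt (2 * pi) * exp (3 * cmod z)" if z: "Re z \<ge> Z" for z
  proof -
    have z0: "Re z > 0" "z \<noteq> 0" "cmod z \<ge> 1" "Re z \<ge> 1" using z C(1) cmod_ge_1_if_Re[of z] by auto
    define E where "E = exp ((Re z - 1/2) * ln (cmod z) - Im z * Im (Ln z) - Re z)"
    have E: "E > 0" by (simp add: E_def)
    have G: "cmod (Gamma z) \<ge> 1/2 * (sqrt (2 * pi) * E)"
      using C(2)[OF z] E unfolding E_def
      by (simp add: norm_divide norm_mult le_divide_eq norm_stirling_main[OF z0(1)] del: norm_exp_eq_Re)
    have "cmod (rGamma z) = 1 / cmod (Gamma z)"
      by (simp add: Gamma_def norm_inverse divide_inverse)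
    also have "\<dots> \<le> 1 / (1/2 * (sqrt (2 * pi) * E))"
      using G E by (intro divide_left_mono) (auto intro!: mult_pos_pos less_le_trans[OF _ G])
    also have "\<dots> = 2 / sqrt (2 * pi) * (1 / E)" by simp
    finally have rG: "cmod (rGamma z) \<le> 2 / sqrt (2 * pi) * (1 / E)" .
    have "1 / E \<le> exp (3 * cmod z)"
    proof -
      have "Im z * Im (Ln z) \<le> \<bar>Im z\<bar> * \<bar>Im (Ln z)\<bar>" by (metis abs_ge_self abs_mult)
      also have "\<dots> \<le> cmod z * 2"
      proof (intro mult_mono)
        have "\<bar>Im (Ln z)\<bar> < pi/2" using z0 Re_Ln_pos_lt by blast
        then show "\<bar>Im (Ln z)\<bar> \<le> 2" using pi_less_4 by linarith
      qed (auto intro: abs_Im_le_cmod)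
      finally have "Im z * Im (Ln z) \<le> 2 * cmod z" by simp
      moreover have "(Re z - 1/2) * ln (cmod z) \<ge> 0" using z0 by (intro mult_nonneg_nonneg) auto
      moreover have "Re z \<le> cmod z" by (rule complex_Re_le_cmod)
      ultimately have "- ((Re z - 1/2) * ln (cmod z) - Im z * Im (Ln z) - Re z) \<le> 3 * cmod z" by linarith
      moreover have "1 / E = exp (- ((Re z - 1/2) * ln (cmod z) - Im z * Im (Ln z) - Re z))"
        unfolding E_def by (simp only: exp_minus divide_inverse mult_1)
      ultimately show ?thesis by (simp only: exp_le_cancel_iff)
    qed
    then have "2 / sqrt (2 * pi) * (1 / E) \<le> 2 / sqrt (2 * pi) * exp (3 * cmod z)"
      by (intro mult_left_mono) auto
    then show ?thesis using rG by linarith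
  qed
  then show ?thesis using that[of "2 / sqrt (2 * pi)" Z] by auto
qed

text \<open>The recursion \<open>rGamma z = z * rGamma (z + 1)\<close> moves the half plane left by
  one unit; the factor |z| is absorbed by raising M by 1, and b fixes the number of moves. In a
  vertical strip this is growth of the kind that \<open>contour_shift\<close> admits.\<close>

lemma rGamma_exp_bound:
  obtains K M where "K \<ge> 0" "M \<ge> 0" "\<And>z. Re z \<ge> b \<Longrightarrow> cmod (rGamma z) \<le> K * exp (M * cmod z)"
proof -
  obtain K0 Z where K0: "K0 \<ge> 0" "\<And>z. Re z \<ge> Z \<Longrightarrow> cmod (rGamma z) \<le> K0 * exp (3 * cmod z)"
    using rGamma_exp_bound_right by blast
  have *: "\<exists>K M. K \<ge> 0 \<and> M \<ge> 0 \<and> (\<forall>z. Re z \<ge> Z - real n \<longrightarrow> cmod (rGamma z) \<le> K * exp (M * cmod z))" for n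
  proof (induction n)
    case 0
    show ?case using K0 by (intro exI[of _ K0] exI[of _ 3]) auto
  next
    case (Suc n)
    then obtain K M where KM: "K \<ge> 0" "M \<ge> 0" 
      "\<And>z. Re z \<ge> Z - real n \<Longrightarrow> cmod (rGamma z) \<le> K * exp (M * cmod z)" by blast
    have "cmod (rGamma z) \<le> (K * exp M) * exp ((M + 1) * cmod z)" if "Re z \<ge> Z - real (Suc n)" for z
    proof -
      have "cmod (rGamma z) = cmod z * cmod (rGamma (z + 1))"
        by (metis norm_mult rGamma_plus1)
      also have "\<dots> \<le> exp (cmod z) * (K * exp (M * cmod (z + 1)))"
        using that KM order_trans[OF _ exp_ge_add_one_self[of "cmod z"], of "cmod z"] by (intro mult_mono KM(3)) auto
      also have "\<dots> \<le> exp (cmod z) * (K * exp (M * (cmod z + 1)))"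
        using KM norm_triangle_ineq[of z 1] by (auto intro!: mult_left_mono)
      also have "\<dots> = (K * exp M) * exp ((M + 1) * cmod z)"
        by (simp add: exp_add algebra_simps)
      finally show ?thesis .
    qed
    then show ?case using KM by (intro exI[of _ "K * exp M"] exI[of _ "M + 1"]) auto
  qed
  obtain n where "real n \<ge> Z - b" using real_arch_simple by blast
  then have "Z - real n \<le> b" by simp
  with *[of n] that show ?thesis by (meson order_trans)
qed

lemma rgfac_exp_bound:
  assumes "\<And>\<nu>. \<nu> < d \<Longrightarrow> al \<nu> > 0"
  obtains K M where "K \<ge> 0" "M \<ge> 0" "\<And>s. Re s \<ge> b \<Longrightarrow> cmod (rgfac d al be s) \<le> K * exp (M * cmod s)"
proof -
  have "\<exists>K M. K \<ge> 0 \<and> M \<ge> 0 \<and> (\<forall>s. Re s \<ge> b \<longrightarrow> cmod (rgfac d al be s) \<le> K * exp (M * cmod s))"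
    using assms
  proof (induction d)
    case 0
    show ?case by (intro exI[of _ 1] exI[of _ 0]) (auto simp: rgfac_def)
  next
    case (Suc d)
    then obtain K M where KM: "K \<ge> 0" "M \<ge> 0" "\<And>s. Re s \<ge> b \<Longrightarrow> cmod (rgfac d al be s) \<le> K * exp (M * cmod s)"
      by (meson less_Suc_eq)
    obtain K' M' where KM': "K' \<ge> 0" "M' \<ge> 0"
      "\<And>z. Re z \<ge> al d * b + Re (be d) \<Longrightarrow> cmod (rGamma z) \<le> K' * exp (M' * cmod z)"
      using rGamma_exp_bound by blast
    have al: "al d > 0" using Suc by auto
    have "cmod (rgfac (Suc d) al be s) \<le> (K * K' * exp (M' * cmod (be d))) * exp ((M + M' * al d) * cmod s)"
      if s: "Re s \<ge> b" for s
    proof -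
      have "cmod (rgfac (Suc d) al be s) = cmod (rgfac d al be s) * cmod (rGamma (of_real (al d) * s + be d))"
        by (simp add: rgfac_def norm_mult)
      also have "\<dots> \<le> (K * exp (M * cmod s)) * (K' * exp (M' * cmod (of_real (al d) * s + be d)))"
        using s al KM KM' by (intro mult_mono KM KM'(3)) auto
      also have "\<dots> \<le> (K * exp (M * cmod s)) * (K' * exp (M' * (al d * cmod s + cmod (be d))))"
        using norm_triangle_ineq[of "of_real (al d) * s" "be d"] al KM(1,2) KM'(1,2)
        by (intro mult_left_mono iffD2[OF exp_le_cancel_iff]) (auto simp: norm_mult)
      also have "\<dots> = (K * K' * exp (M' * cmod (be d))) * exp ((M + M' * al d) * cmod s)"
        by (simp add: exp_add algebra_simps)
      finally show ?thesis .
    qed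
    then show ?case using KM KM' al
      by (intro exI[of _ "K * K' * exp (M' * cmod (be d))"] exI[of _ "M + M' * al d"]) auto
  qed
  then show ?thesis using that by blast
qed

subsection \<open>Fourier and Mellin inversion\<close>

lemma LBINT_eq_integral_supp:
  fixes f :: "real \<Rightarrow> complex"
  assumes "continuous_on {a..b} f" "\<And>x. x \<notin> {a..b} \<Longrightarrow> f x = 0"
  shows "integrable lborel f" "(LBINT x. f x) = integral {a..b} f"
proof -
  have s: "set_integrable lborel {a..b} f"
    using assms(1) by (rule borel_integrable_atLeastAtMost')
  have eq: "(\<lambda>x. indicat_real {a..b} x *\<^sub>R f x) = f"
    using assms(2) by (auto simp: indicator_def fun_eq_iff)
  show "integrable lborel f" using s by (simp add: set_integrable_def eq)
  show "(LBINT x. f x) = integral {a..b} f"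
    using set_borel_integral_eq_integral(2)[OF s] by (simp add: set_lebesgue_integral_def eq)
qed

lemma integrable_pair_mult:
  fixes f g :: "real \<Rightarrow> complex"
  assumes f: "integrable lborel f" and g: "integrable lborel g"
  shows "integrable (lborel \<Otimes>\<^sub>M lborel) (\<lambda>(x, y). f x * g y)"
proof (rule lborel_pair.Fubini_integrable)
  have [measurable]: "f \<in> borel_measurable borel" "g \<in> borel_measurable borel"
    using f g by auto
  show "(\<lambda>(x, y). f x * g y) \<in> borel_measurable (lborel \<Otimes>\<^sub>M lborel)"
    by measurable
  show "integrable lborel (\<lambda>x. LBINT y. norm (case (x, y) of (x, y) \<Rightarrow> f x * g y))"
    using f by (simp add: norm_mult)
  show "AE x in lborel. integrable lborel (\<lambda>y. case (x, y) of (x, y) \<Rightarrow> f x * g y)"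
    using g by simp
qed

lemma gauss_fourier:
  fixes e w :: real
  assumes "e > 0"
  shows "(LBINT t. exp (\<i> * of_real (t * w)) * of_real (exp (- ((e * t)^2) / 2))) =
     of_real (sqrt (2 * pi) / e * exp (- ((w / e)^2) / 2))"
proof -
  have "(LBINT t. of_real (std_normal_density t) * iexp (x * t)) = complex_of_real (exp (- (x^2) / 2))" for x
  proof -
    have "char std_normal_distribution x = (LBINT t. std_normal_density t *\<^sub>R iexp (x * t))"
      unfolding char_def by (subst integral_density) auto
    then show ?thesis by (simp add: char_std_normal_distribution scaleR_conv_of_real)
  qed
  note 1 = this[of "w / e"]
  have "(LBINT t. exp (\<i> * of_real (t * w)) * of_real (exp (- ((e * t)^2) / 2))) =
     \<bar>1/e\<bar> *\<^sub>R (LBINT t. exp (\<i> * of_real ((0 + 1/e * t) * w)) * of_real (exp (- ((e * (0 + 1/e * t))^2) / 2)))"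
    using assms by (intro lborel_integral_real_affine) auto
  also have "(LBINT t. exp (\<i> * of_real ((0 + 1/e * t) * w)) * of_real (exp (- ((e * (0 + 1/e * t))^2) / 2)))
     = (LBINT t. of_real (sqrt (2 * pi)) * (of_real (std_normal_density t) * iexp ((w / e) * t)))"
    using assms by (intro Bochner_Integration.integral_cong) (auto simp: std_normal_density_def field_simps)
  also have "\<dots> = of_real (sqrt (2 * pi)) * complex_of_real (exp (- ((w/e)^2) / 2))"
    using 1 by simp
  finally show ?thesis using assms by (simp add: scaleR_conv_of_real)
qed

lemma integrable_gauss:
  assumes "e > 0"
  shows "integrable lborel (\<lambda>t. exp (- ((e * t)^2) / 2) :: real)"
proof -
  have "integrable lborel (\<lambda>t. sqrt (2 * pi) * std_normal_density (0 + e * t))"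
    using assms by (intro integrable_mult_right lborel_integrable_real_affine) auto
  then show ?thesis by (simp add: std_normal_density_def)
qed

text \<open>Gaussian summation: the damping exp (- (e t)^2 / 2) permits Fubini, after which the
  integral is the average of g around w against a normal density of width e. As e tends to 0 both
  sides converge by domination, the left one because the transform is assumed integrable, the right
  one because g is bounded and continuous.\<close>

theorem fourier_inversion:
  fixes g :: "real \<Rightarrow> complex"
  assumes cont: "continuous_on UNIV g" and supp: "\<And>v. v \<notin> {a..b} \<Longrightarrow> g v = 0"
    and int: "integrable lborel (\<lambda>t. LBINT v. g v * exp (\<i> * of_real (t * v)))"
  shows "(LBINT t. (LBINT v. g v * exp (\<i> * of_real (t * v))) * exp (- \<i> * of_real (t * w))) = 2 * pi * g w"
proof -
  define G where "G = (\<lambda>t. LBINT v. g v * exp (\<i> * of_real (t * v)))"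
  define e where "e = (\<lambda>n. 1 / real (Suc n))"
  have e: "e n > 0" for n by (simp add: e_def)
  have e0: "e \<longlonglongrightarrow> 0" unfolding e_def by real_asymp
  have gm[measurable]: "g \<in> borel_measurable borel" using cont by (rule borel_measurable_continuous_onI)
  have gi: "integrable lborel g"
    by (rule LBINT_eq_integral_supp(1)[of a b]) (use cont continuous_on_subset supp in auto)
  obtain B where B: "\<And>v. cmod (g v) \<le> B"
  proof -
    have "compact (g ` {a..b})" by (intro compact_continuous_image continuous_on_subset[OF cont]) auto
    then have "bounded (g ` {a..b})" by (rule compact_imp_bounded)
    then obtain B where B: "\<forall>x\<in>g ` {a..b}. cmod x \<le> B" unfolding bounded_iff by blast
    have "cmod (g v) \<le> max B 0" for v
    proof (cases "v \<in> {a..b}")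
      case True
      then have "cmod (g v) \<le> B" using B by blast
      then show ?thesis by simp
    qed (simp add: supp)
    then show ?thesis using that by blast
  qed
  have Gi: "integrable lborel G" using int unfolding G_def .
  then have Gm[measurable]: "G \<in> borel_measurable borel" by auto
  define I where "I = (\<lambda>n. LBINT t. G t * exp (- \<i> * of_real (t * w)) * of_real (exp (- ((e n * t)^2) / 2)))"
  have "I \<longlonglongrightarrow> (LBINT t. G t * exp (- \<i> * of_real (t * w)))"
    unfolding I_def
  proof (rule integral_dominated_convergence[where w = "\<lambda>t. cmod (G t)"])
    show "integrable lborel (\<lambda>t. cmod (G t))" using Gi by simp
    show "AE t in lborel. (\<lambda>n. G t * exp (- \<i> * of_real (t * w)) * of_real (exp (- ((e n * t)^2) / 2)))
       \<longlonglongrightarrow> G t * exp (- \<i> * of_real (t * w))"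
    proof (intro AE_I2)
      fix t
      have "(\<lambda>n. G t * exp (- \<i> * of_real (t * w)) * of_real (exp (- ((e n * t)^2) / 2)))
       \<longlonglongrightarrow> G t * exp (- \<i> * of_real (t * w)) * of_real (exp (- ((0 * t)^2) / 2))"
        by (intro tendsto_intros e0) auto
      then show "(\<lambda>n. G t * exp (- \<i> * of_real (t * w)) * of_real (exp (- ((e n * t)^2) / 2)))
       \<longlonglongrightarrow> G t * exp (- \<i> * of_real (t * w))" by simp
    qed
    show "AE t in lborel. cmod (G t * exp (- \<i> * of_real (t * w)) * of_real (exp (- ((e n * t)^2) / 2))) \<le> cmod (G t)" for n
      by (intro AE_I2) (auto simp: norm_mult mult_left_le)
  qed measurable
  moreover have In: "I n = 2 * pi * (LBINT z. of_real (std_normal_density z) * g (w + e n * z))" for n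
  proof -
    have "I n = (LBINT t. LBINT v. g v * (exp (\<i> * of_real (t * (v - w))) * of_real (exp (- ((e n * t)^2) / 2))))"
      unfolding I_def
    proof (intro Bochner_Integration.integral_cong refl)
      fix t
      define c where "c = exp (- \<i> * of_real (t * w)) * of_real (exp (- ((e n * t)^2) / 2))"
      have "G t * exp (- \<i> * of_real (t * w)) * of_real (exp (- ((e n * t)^2) / 2)) = G t * c"
        by (simp only: c_def mult.assoc)
      also have "\<dots> = (LBINT v. g v * exp (\<i> * of_real (t * v)) * c)"
        unfolding G_def by (rule integral_mult_left_zero[symmetric])
      also have "\<dots> = (LBINT v. g v * (exp (\<i> * of_real (t * (v - w))) * of_real (exp (- ((e n * t)^2) / 2))))"
      proof (intro Bochner_Integration.integral_cong refl)
        fix v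
        have "exp (\<i> * of_real (t * (v - w))) = exp (\<i> * of_real (t * v)) * exp (- \<i> * of_real (t * w))"
          by (simp add: exp_add[symmetric] algebra_simps)
        then show "g v * exp (\<i> * of_real (t * v)) * c = g v * (exp (\<i> * of_real (t * (v - w))) * of_real (exp (- ((e n * t)^2) / 2)))"
          by (simp only: c_def mult_ac)
      qed
      finally show "G t * exp (- \<i> * of_real (t * w)) * of_real (exp (- ((e n * t)^2) / 2)) =
        (LBINT v. g v * (exp (\<i> * of_real (t * (v - w))) * of_real (exp (- ((e n * t)^2) / 2))))" .
    qed
    also have "\<dots> = (LBINT v. LBINT t. g v * (exp (\<i> * of_real (t * (v - w))) * of_real (exp (- ((e n * t)^2) / 2))))"
    proof (rule lborel_pair.Fubini_integral[of "\<lambda>t v. g v * (exp (\<i> * of_real (t * (v - w))) * of_real (exp (- ((e n * t)^2) / 2)))", symmetric])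
      have "integrable (lborel \<Otimes>\<^sub>M lborel) (\<lambda>p. of_real (exp (- ((e n * fst p)^2) / 2)) * g (snd p))"
        using integrable_pair_mult[of "\<lambda>t. complex_of_real (exp (- ((e n * t)^2) / 2))" g] gi integrable_gauss[OF e[of n]]
        by (simp add: case_prod_unfold)
      then show "integrable (lborel \<Otimes>\<^sub>M lborel) (\<lambda>(t, v). g v * (exp (\<i> * of_real (t * (v - w))) * of_real (exp (- ((e n * t)^2) / 2))))"
        by (rule Bochner_Integration.integrable_bound) (auto simp: norm_mult)
    qed
    also have "\<dots> = (LBINT v. g v * of_real (sqrt (2 * pi) / e n * exp (- (((v - w) / e n)^2) / 2)))"
      by (simp only: integral_mult_right_zero gauss_fourier[OF e[of n]])
    also have "\<dots> = \<bar>e n\<bar> *\<^sub>R (LBINT z. g (w + e n * z) * of_real (sqrt (2 * pi) / e n * exp (- (((w + e n * z - w) / e n)^2) / 2)))"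
      using e[of n] by (intro lborel_integral_real_affine) auto
    also have "(LBINT z. g (w + e n * z) * of_real (sqrt (2 * pi) / e n * exp (- (((w + e n * z - w) / e n)^2) / 2))) =
       (LBINT z. of_real (2 * pi / e n) * (of_real (std_normal_density z) * g (w + e n * z)))"
    proof (intro Bochner_Integration.integral_cong refl)
      fix z
      have "sqrt (2 * pi) / e n * exp (- (((w + e n * z - w) / e n)^2) / 2) = 2 * pi / e n * std_normal_density z"
      proof -
        have "(w + e n * z - w) / e n = z" using e[of n] by simp
        moreover have sq: "sqrt (2 * pi) = 2 * pi * (1 / sqrt (2 * pi))" using real_div_sqrt[of "2 * pi"] by simp
        have "sqrt (2 * pi) / e n * exp (- (z^2) / 2) = (2 * pi * (1 / sqrt (2 * pi))) / e n * exp (- (z^2) / 2)"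
          by (subst sq) (rule refl)
        ultimately show ?thesis unfolding std_normal_density_def by simp
      qed
      then show "g (w + e n * z) * of_real (sqrt (2 * pi) / e n * exp (- (((w + e n * z - w) / e n)^2) / 2)) =
        of_real (2 * pi / e n) * (of_real (std_normal_density z) * g (w + e n * z))"
        by (simp only: of_real_mult mult_ac)
    qed
    also have "\<dots> = of_real (2 * pi / e n) * (LBINT z. of_real (std_normal_density z) * g (w + e n * z))"
      by simp
    finally show ?thesis using e[of n] by (simp add: scaleR_conv_of_real)
  qed
  moreover have gl: "(\<lambda>n. LBINT z. of_real (std_normal_density z) * g (w + e n * z)) \<longlonglongrightarrow> (LBINT z. of_real (std_normal_density z) * g w)"
  proof (rule integral_dominated_convergence[where w = "\<lambda>z. std_normal_density z * B"])
    show "AE z in lborel. (\<lambda>n. of_real (std_normal_density z) * g (w + e n * z)) \<longlonglongrightarrow> of_real (std_normal_density z) * g w"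
    proof (intro AE_I2 tendsto_intros)
      fix z
      have "(\<lambda>n. w + e n * z) \<longlonglongrightarrow> w + 0 * z" by (intro tendsto_intros e0)
      then show "(\<lambda>n. g (w + e n * z)) \<longlonglongrightarrow> g w"
        using cont by (intro isCont_tendsto_compose[of w g]) (auto simp: continuous_on_eq_continuous_at)
    qed
    show "AE z in lborel. cmod (of_real (std_normal_density z) * g (w + e n * z)) \<le> std_normal_density z * B" for n
      by (intro AE_I2) (auto simp: norm_mult B mult_left_mono)
  qed auto
  moreover have gw: "(LBINT z. of_real (std_normal_density z) * g w) = g w"
  proof -
    have "(LBINT z. complex_of_real (std_normal_density z)) = of_real 1"
      by (subst integral_complex_of_real) (simp add: prob_space.prob_space)
    then show ?thesis by simp
  qed
  moreover have "I \<longlonglongrightarrow> 2 * pi * g w"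
    unfolding In[abs_def] using gl unfolding gw by (intro tendsto_intros)
  ultimately have "(LBINT t. G t * exp (- \<i> * of_real (t * w))) = 2 * pi * g w"
    using LIMSEQ_unique by blast
  then show ?thesis unfolding G_def .
qed

text \<open>The Mellin transform of a function supported on [1/2, 3/2]; on this compact interval the
  power of u is continuous and the singularity at 0 never appears.\<close>

definition mell :: "(real \<Rightarrow> complex) \<Rightarrow> complex \<Rightarrow> complex" where
  "mell f s = integral {1/2..3/2} (\<lambda>u. f u * of_real u powr (s - 1))"

text \<open>The substitution u = exp v turns the Mellin transform on the line Re s = c into the
  Fourier transform of \<open>f (exp v) * exp (c * v)\<close>.\<close>

theorem mellin_inversion:
  fixes f :: "real \<Rightarrow> complex"
  assumes cont: "continuous_on UNIV f" and supp: "\<And>u. u \<notin> {1/2..3/2} \<Longrightarrow> f u = 0"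
    and int: "integrable lborel (\<lambda>t. mell f (Complex c t))" and y: "y > 0"
  shows "(LBINT t. mell f (Complex c t) * of_real y powr (- Complex c t)) = 2 * pi * f y"
proof -
  define g where "g = (\<lambda>v. f (exp v) * of_real (exp (c * v)))"
  have gc: "continuous_on UNIV g"
    unfolding g_def by (intro continuous_intros continuous_on_compose2[OF cont]) auto
  have gs: "g v = 0" if "v \<notin> {ln (1/2)..ln (3/2)}" for v
  proof -
    have "exp v \<notin> {1/2..3/2}"
    proof
      assume "exp v \<in> {1/2..3/2}"
      then have "ln (1/2) \<le> ln (exp v)" "ln (exp v) \<le> ln (3/2)"
        by (subst ln_le_cancel_iff; simp)+
      then show False using that by simp
    qed
    then show ?thesis by (simp add: g_def supp)
  qed
  have M: "(LBINT v. g v * exp (\<i> * of_real (t * v))) = mell f (Complex c t)" for t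
  proof -
    have "(LBINT v. g v * exp (\<i> * of_real (t * v))) = integral {ln (1/2)..ln (3/2)} (\<lambda>v. g v * exp (\<i> * of_real (t * v)))"
      by (intro LBINT_eq_integral_supp(2) continuous_intros continuous_on_subset[OF gc]) (auto simp: gs)
    also have "\<dots> = integral {exp (ln (1/2))..exp (ln (3/2 :: real))} (\<lambda>u. f u * of_real u powr (Complex c t - 1))"
    proof (rule integral_unique)
      have "((\<lambda>v. exp v *\<^sub>R (f (exp v) * of_real (exp v) powr (Complex c t - 1))) has_integral
         integral {exp (ln (1/2))..exp (ln (3/2 :: real))} (\<lambda>u. f u * of_real u powr (Complex c t - 1))) {ln (1/2)..ln (3/2)}"
      proof (rule has_integral_substitution[where c = "1/2" and d = "3/2"])
        show "exp ` {ln (1/2)..ln (3/2)} \<subseteq> {1/2..3/2::real}"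
        proof (intro image_subsetI)
          fix x :: real assume "x \<in> {ln (1/2)..ln (3/2)}"
          then have "exp (ln (1/2)) \<le> exp x" "exp x \<le> exp (ln (3/2))" by (simp_all only: exp_le_cancel_iff atLeastAtMost_iff)
          then show "exp x \<in> {1/2..3/2}" by simp
        qed
        show "continuous_on {1/2..3/2} (\<lambda>u. f u * of_real u powr (Complex c t - 1))"
          by (intro continuous_intros continuous_on_subset[OF cont]) auto
      qed (auto intro!: derivative_eq_intros)
      moreover have "exp v *\<^sub>R (f (exp v) * of_real (exp v) powr (Complex c t - 1)) = g v * exp (\<i> * of_real (t * v))" for v
      proof -
        have "complex_of_real (exp v) powr (Complex c t - 1) = exp ((Complex c t - 1) * of_real v)"
          by (simp add: powr_def Ln_of_real)
        moreover have "exp (of_real v) * exp ((Complex c t - 1) * of_real v) = exp (of_real (c * v)) * exp (\<i> * of_real (t * v))"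
          unfolding exp_add[symmetric] by (rule arg_cong[of _ _ exp]) (simp add: Complex_eq algebra_simps)
        then have "of_real (exp v) * exp ((Complex c t - 1) * of_real v) = of_real (exp (c * v)) * exp (\<i> * of_real (t * v))"
          by (simp only: exp_of_real)
        ultimately show ?thesis by (simp only: g_def scaleR_conv_of_real mult.assoc mult.left_commute[of _ "f (exp v)"])
      qed
      ultimately show "((\<lambda>v. g v * exp (\<i> * of_real (t * v))) has_integral
         integral {exp (ln (1/2))..exp (ln (3/2 :: real))} (\<lambda>u. f u * of_real u powr (Complex c t - 1))) {ln (1/2)..ln (3/2)}"
        by simp
    qed
    finally show ?thesis by (simp add: mell_def)
  qed
  have "(LBINT t. (LBINT v. g v * exp (\<i> * of_real (t * v))) * exp (- \<i> * of_real (t * ln y))) = 2 * pi * g (ln y)"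
    by (rule fourier_inversion[OF gc gs]) (use int in \<open>simp_all only: M\<close>)
  then have 1: "(LBINT t. mell f (Complex c t) * exp (- \<i> * of_real (t * ln y))) = 2 * pi * g (ln y)"
    by (simp only: M)
  have "(LBINT t. mell f (Complex c t) * of_real y powr (- Complex c t)) =
     (LBINT t. mell f (Complex c t) * exp (- \<i> * of_real (t * ln y)) * of_real (exp (- c * ln y)))"
  proof (intro Bochner_Integration.integral_cong refl)
    fix t
    have "of_real y powr (- Complex c t) = exp (- \<i> * of_real (t * ln y)) * of_real (exp (- c * ln y))"
    proof -
      have "of_real y powr (- Complex c t) = exp (- Complex c t * of_real (ln y))"
        using y by (simp add: powr_def Ln_of_real)
      also have "- Complex c t * of_real (ln y) = - \<i> * of_real (t * ln y) + of_real (- c * ln y)"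
        by (simp add: Complex_eq algebra_simps)
      finally show ?thesis by (simp only: exp_add exp_of_real)
    qed
    then show "mell f (Complex c t) * of_real y powr (- Complex c t) =
      mell f (Complex c t) * exp (- \<i> * of_real (t * ln y)) * of_real (exp (- c * ln y))" by (simp only: mult.assoc)
  qed
  also have "\<dots> = (LBINT t. mell f (Complex c t) * exp (- \<i> * of_real (t * ln y))) * of_real (exp (- c * ln y))"
    by (rule integral_mult_left_zero)
  also have "\<dots> = 2 * pi * f y * (of_real (exp (c * ln y)) * of_real (exp (- c * ln y)))"
    unfolding 1 using y by (simp add: g_def)
  also have "of_real (exp (c * ln y)) * complex_of_real (exp (- c * ln y)) = 1"
    by (simp only: of_real_mult[symmetric] exp_add[symmetric]) simp
  finally show ?thesis by simp
qed

subsection \<open>Moving the line of integration\<close>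

lemma norm_exp_square: "cmod (exp (of_real e * (Complex x t)^2)) = exp (e * (x^2 - t^2))"
  by (simp add: power2_eq_square algebra_simps)

text \<open>The rectangle contains the disk, so both curves wind once around every singularity and
  the residue theorem gives the same value.\<close>

lemma contour_integral_rectpath_eq_circlepath:
  assumes P: "finite P" "P \<subseteq> ball 0 R" and f: "f holomorphic_on - P" and R: "0 < R"
    and a: "Re a < -R" "Im a < -R" and b: "R < Re b" "R < Im b"
  shows "contour_integral (rectpath a b) f = contour_integral (circlepath 0 R) f"
proof -
  have f': "f holomorphic_on UNIV - P" using f by (simp add: Compl_eq_Diff_UNIV)
  have Pb: "cmod p < R" if "p \<in> P" for p using that P by auto
  have inb: "p \<in> box a b" if "p \<in> P" for p
    using Pb[OF that] abs_Re_le_cmod[of p] abs_Im_le_cmod[of p] a b by (auto simp: in_box_complex_iff)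
  have "contour_integral (rectpath a b) f = 2 * pi * \<i> * (\<Sum>p\<in>P. winding_number (rectpath a b) p * residue f p)"
  proof (rule Residue_theorem[OF open_UNIV connected_UNIV P(1) f'])
    show "path_image (rectpath a b) \<subseteq> UNIV - P"
      using inb a b R by (auto simp: path_image_rectpath_cbox_minus_box)
  qed auto
  also have "(\<Sum>p\<in>P. winding_number (rectpath a b) p * residue f p) = (\<Sum>p\<in>P. residue f p)"
    by (intro sum.cong refl) (simp add: winding_number_rectpath inb)
  also have "\<dots> = (\<Sum>p\<in>P. winding_number (circlepath 0 R) p * residue f p)"
    by (intro sum.cong refl) (simp add: winding_number_circlepath Pb)
  also have "2 * pi * \<i> * \<dots> = contour_integral (circlepath 0 R) f"
  proof (rule Residue_theorem[OF open_UNIV connected_UNIV P(1) f', symmetric])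
    show "path_image (circlepath 0 R) \<subseteq> UNIV - P" using Pb R by force
  qed auto
  finally show ?thesis .
qed

lemma contour_integral_rectpath_split:
  assumes f: "continuous_on (path_image (rectpath a b)) f" and ab: "Re a < Re b" "Im a < Im b"
  shows "contour_integral (rectpath a b) f =
      contour_integral (linepath a (Complex (Re b) (Im a))) f
    + \<i> * integral {Im a..Im b} (\<lambda>t. f (Complex (Re b) t))
    - contour_integral (linepath (Complex (Re a) (Im b)) b) f
    - \<i> * integral {Im a..Im b} (\<lambda>t. f (Complex (Re a) t))"
proof -
  let ?a2 = "Complex (Re b) (Im a)" and ?a4 = "Complex (Re a) (Im b)"
  have seg: "path_image (rectpath a b) = closed_segment a ?a2 \<union> closed_segment ?a2 b \<union> closed_segment b ?a4 \<union> closed_segment ?a4 a"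
    by (simp add: rectpath_def Let_def path_image_join Un_assoc)
  have i: "f contour_integrable_on linepath a ?a2" "f contour_integrable_on linepath ?a2 b"
    "f contour_integrable_on linepath b ?a4" "f contour_integrable_on linepath ?a4 a"
    by (intro contour_integrable_continuous_linepath continuous_on_subset[OF f]; simp add: seg; blast)+
  have "contour_integral (rectpath a b) f = contour_integral (linepath a ?a2) f + contour_integral (linepath ?a2 b) f
     + contour_integral (linepath b ?a4) f + contour_integral (linepath ?a4 a) f"
    using i by (simp add: rectpath_def Let_def contour_integral_join contour_integrable_join)
  moreover have "contour_integral (linepath ?a2 b) f = \<i> * integral {Im a..Im b} (\<lambda>t. f (Complex (Re b) t))"
    using ab by (intro contour_integral_linepath_same_Re) auto
  moreover have "contour_integral (linepath a ?a4) f = \<i> * integral {Im a..Im b} (\<lambda>t. f (Complex (Re a) t))"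
    using ab by (intro contour_integral_linepath_same_Re) auto
  moreover have "contour_integral (linepath ?a4 a) f = - contour_integral (linepath a ?a4) f"
    by (intro contour_integral_reverse_linepath continuous_on_subset[OF f]) (simp add: seg)
  moreover have "contour_integral (linepath b ?a4) f = - contour_integral (linepath ?a4 b) f"
    by (intro contour_integral_reverse_linepath continuous_on_subset[OF f]) (simp add: seg closed_segment_commute, blast)
  ultimately show ?thesis by simp
qed

lemma LBINT_eq_lim_integral:
  fixes f :: "real \<Rightarrow> complex"
  assumes "continuous_on UNIV f" "integrable lborel f"
  shows "(\<lambda>n. integral {- real n..real n} f) \<longlonglongrightarrow> (LBINT t. f t)"
proof -
  have "(\<lambda>n. LBINT t. indicator {- real n..real n} t *\<^sub>R f t) \<longlonglongrightarrow> (LBINT t. f t)"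
  proof (rule integral_dominated_convergence[where w = "\<lambda>t. cmod (f t)"])
    show "AE t in lborel. (\<lambda>n. indicator {- real n..real n} t *\<^sub>R f t) \<longlonglongrightarrow> f t"
    proof (intro AE_I2 tendsto_eventually)
      fix t :: real
      have "eventually (\<lambda>n. real n \<ge> \<bar>t\<bar>) sequentially"
        by (rule eventually_compose_filterlim[OF eventually_ge_at_top filterlim_real_sequentially])
      then show "eventually (\<lambda>n. indicator {- real n..real n} t *\<^sub>R f t = f t) sequentially"
        by eventually_elim (auto simp: indicator_def)
    qed
    show "AE t in lborel. cmod (indicator {- real n..real n} t *\<^sub>R f t) \<le> cmod (f t)" for n
      by (auto simp: indicator_def)
  qed (use assms in auto)
  moreover have "(LBINT t. indicator {- real n..real n} t *\<^sub>R f t) = integral {- real n..real n} f" for n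
    using set_borel_integral_eq_integral(2)[OF borel_integrable_atLeastAtMost'[OF continuous_on_subset[OF assms(1)]]]
    by (simp add: set_lebesgue_integral_def)
  ultimately show ?thesis by simp
qed

lemma continuous_on_vertical_line:
  assumes "f holomorphic_on - P" "\<And>p. p \<in> P \<Longrightarrow> Re p \<noteq> c"
  shows "continuous_on UNIV (\<lambda>t. f (Complex c t))"
  by (intro continuous_on_compose2[OF holomorphic_on_imp_continuous_on[OF assms(1)]] continuous_intros)
     (auto dest: assms(2))

text \<open>The factor \<open>exp (\<epsilon> s\<^sup>2)\<close> kills any growth of finite order below 2 in the strip, so no
  Phragmen-Lindeloef argument is needed.\<close>

theorem contour_shift:
  assumes P: "finite P" "P \<subseteq> ball 0 R" and f: "f holomorphic_on - P" and R: "0 < R"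
    and c: "R < c1" "R < c2"
    and growth: "\<And>s. - c2 \<le> Re s \<Longrightarrow> Re s \<le> c1 \<Longrightarrow> \<bar>Im s\<bar> \<ge> T0 \<Longrightarrow> cmod (f s) \<le> K * exp (M * \<bar>Im s\<bar>)"
    and int: "integrable lborel (\<lambda>t. f (Complex c1 t))" "integrable lborel (\<lambda>t. f (Complex (- c2) t))"
  shows "(LBINT t. f (Complex c1 t)) - (LBINT t. f (Complex (- c2) t)) = - \<i> * contour_integral (circlepath 0 R) f"
proof -
  define fe where "fe = (\<lambda>e s. f s * exp (of_real e * s^2))"
  have fe_hol: "fe e holomorphic_on - P" for e
    unfolding fe_def by (intro holomorphic_intros f)
  have Pb: "cmod p < R" if "p \<in> P" for p using that P by auto
  have PRe: "Re p \<noteq> c1" "Re p \<noteq> - c2" if "p \<in> P" for p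
    using Pb[OF that] abs_Re_le_cmod[of p] c by auto
  note conte = continuous_on_vertical_line[OF fe_hol PRe(1)] continuous_on_vertical_line[OF fe_hol PRe(2)]
  have fe_int: "integrable lborel (\<lambda>t. fe e (Complex x t))"
    if "e \<ge> 0" "integrable lborel (\<lambda>t. f (Complex x t))" "continuous_on UNIV (\<lambda>t. fe e (Complex x t))" for e x
  proof (rule Bochner_Integration.integrable_bound[of _ "\<lambda>t. of_real (exp (e * x^2)) * f (Complex x t)"])
    show "(\<lambda>t. fe e (Complex x t)) \<in> borel_measurable lborel" 
      using borel_measurable_continuous_onI[OF that(3)] by simp
    show "AE t in lborel. cmod (fe e (Complex x t)) \<le> cmod (of_real (exp (e * x^2)) * f (Complex x t))"
    proof (intro AE_I2)
      fix t
      have "e * (x^2 - t^2) \<le> e * x^2" using that(1) by (intro mult_left_mono) auto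
      then have "exp (e * (x^2 - t^2)) \<le> exp (e * x^2)" by simp
      then have "cmod (f (Complex x t)) * exp (e * (x^2 - t^2)) \<le> cmod (f (Complex x t)) * exp (e * x^2)"
        by (intro mult_left_mono) auto
      then show "cmod (fe e (Complex x t)) \<le> cmod (of_real (exp (e * x^2)) * f (Complex x t))"
        unfolding fe_def norm_mult norm_exp_square by (simp add: mult.commute)
    qed
  qed (use that in auto)
  have step: "(LBINT t. fe e (Complex c1 t)) - (LBINT t. fe e (Complex (- c2) t)) = - \<i> * contour_integral (circlepath 0 R) (fe e)"
    if e: "e > 0" for e
  proof -
    define a b where "a = (\<lambda>n. Complex (- c2) (- real n))" and "b = (\<lambda>n. Complex c1 (real n))"
    define bot top where "bot = (\<lambda>n. contour_integral (linepath (a n) (Complex c1 (- real n))) (fe e))"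
      and "top = (\<lambda>n. contour_integral (linepath (Complex (- c2) (real n)) (b n)) (fe e))"
    define m where "m = max c1 c2"
    \<comment> \<open>Bound on the horizontal edges at height n: the growth hypothesis times the
      modulus of the Gaussian factor, with m bounding |Re s| in the strip.\<close>
    define B where "B = (\<lambda>n. K * exp (M * real n) * exp (e * (m^2 - (real n)^2)))"
    have ev: "eventually (\<lambda>n. real n > R \<and> real n \<ge> T0) sequentially"
      by (intro eventually_conj eventually_compose_filterlim[OF eventually_gt_at_top filterlim_real_sequentially]
          eventually_compose_filterlim[OF eventually_ge_at_top filterlim_real_sequentially])
    have fb: "cmod (fe e s) \<le> B n" if "- c2 \<le> Re s" "Re s \<le> c1" "\<bar>Im s\<bar> = real n" "real n \<ge> T0" for s n
    proof -
      have "(Re s)^2 \<le> m^2"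
        using that c R unfolding m_def by (intro abs_le_square_iff[THEN iffD1]) auto
      moreover have "(Im s)^2 = (real n)^2" using that(3) by (metis power2_abs)
      ultimately have "exp (e * ((Re s)^2 - (Im s)^2)) \<le> exp (e * (m^2 - (real n)^2))"
        using e by simp
      moreover have "cmod (f s) \<le> K * exp (M * real n)" using growth[of s] that by simp
      moreover have "cmod (exp (of_real e * s^2)) = exp (e * ((Re s)^2 - (Im s)^2))"
        using norm_exp_square[of e "Re s" "Im s"] by (simp only: complex_surj)
      moreover have "0 \<le> K * exp (M * real n)"
        using order_trans[OF norm_ge_zero \<open>cmod (f s) \<le> K * exp (M * real n)\<close>] .
      ultimately show ?thesis
        unfolding fe_def B_def norm_mult by (intro mult_mono) (simp_all only: norm_ge_zero exp_ge_zero)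
    qed
    have main: "eventually (\<lambda>n. \<i> * (integral {- real n..real n} (\<lambda>t. fe e (Complex c1 t)) -
         integral {- real n..real n} (\<lambda>t. fe e (Complex (- c2) t))) =
         contour_integral (circlepath 0 R) (fe e) + (top n - bot n)) sequentially"
      using ev
    proof eventually_elim
      case (elim n)
      have ab: "Re (a n) < -R" "Im (a n) < -R" "R < Re (b n)" "R < Im (b n)"
        using elim c by (auto simp: a_def b_def)
      have "path_image (rectpath (a n) (b n)) \<subseteq> - P"
      proof -
        have "p \<in> box (a n) (b n)" if "p \<in> P" for p
          using Pb[OF that] abs_Re_le_cmod[of p] abs_Im_le_cmod[of p] ab by (auto simp: in_box_complex_iff)
        then show ?thesis using ab R by (auto simp: path_image_rectpath_cbox_minus_box)
      qed
      then have "continuous_on (path_image (rectpath (a n) (b n))) (fe e)"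
        using holomorphic_on_imp_continuous_on[OF fe_hol] continuous_on_subset by blast
      from contour_integral_rectpath_split[OF this]
      have "contour_integral (rectpath (a n) (b n)) (fe e) = bot n + \<i> * integral {- real n..real n} (\<lambda>t. fe e (Complex c1 t))
        - top n - \<i> * integral {- real n..real n} (\<lambda>t. fe e (Complex (- c2) t))"
        using elim c R unfolding bot_def top_def by (simp add: a_def b_def)
      moreover have "contour_integral (rectpath (a n) (b n)) (fe e) = contour_integral (circlepath 0 R) (fe e)"
        using ab by (intro contour_integral_rectpath_eq_circlepath[OF P fe_hol R])
      ultimately show "\<i> * (integral {- real n..real n} (\<lambda>t. fe e (Complex c1 t)) -
         integral {- real n..real n} (\<lambda>t. fe e (Complex (- c2) t))) =
         contour_integral (circlepath 0 R) (fe e) + (top n - bot n)"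
        by (simp add: algebra_simps)
    qed
    have bound: "eventually (\<lambda>n. cmod (top n - bot n) \<le> 2 * B n * (c1 + c2)) sequentially"
      using ev
    proof eventually_elim
      case (elim n)
      have segs: "s \<notin> P \<and> cmod (fe e s) \<le> B n"
        if "s \<in> closed_segment (Complex (- c2) y) (Complex c1 y)" "\<bar>y\<bar> = real n" for s y
      proof -
        have s: "Im s = y" "- c2 \<le> Re s" "Re s \<le> c1"
          using that c R by (auto simp: closed_segment_same_Im closed_segment_eq_real_ivl)
        have "s \<notin> P" using Pb[of s] abs_Im_le_cmod[of s] s(1) that(2) elim by auto
        then show ?thesis using fb[of s n] s that elim by auto
      qed
      have bd: "cmod (contour_integral (linepath (Complex (- c2) y) (Complex c1 y)) (fe e)) \<le> B n * (c1 + c2)"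
        if y: "\<bar>y\<bar> = real n" for y
      proof -
        have "cmod (contour_integral (linepath (Complex (- c2) y) (Complex c1 y)) (fe e)) \<le> B n * cmod (Complex c1 y - Complex (- c2) y)"
        proof (rule contour_integral_bound_linepath)
          show "fe e contour_integrable_on linepath (Complex (- c2) y) (Complex c1 y)"
            using segs[OF _ y]
            by (intro contour_integrable_continuous_linepath continuous_on_subset[OF holomorphic_on_imp_continuous_on[OF fe_hol]]) auto
          show "0 \<le> B n" using segs[of "Complex c1 y" y] y by (auto intro: order_trans[OF norm_ge_zero])
        qed (use segs[OF _ y] in auto)
        also have "cmod (Complex c1 y - Complex (- c2) y) = c1 + c2"
          using c R by (simp add: Complex_eq flip: of_real_add)
        finally show ?thesis .
      qed
      have "cmod (top n - bot n) \<le> cmod (top n) + cmod (bot n)" by (rule norm_triangle_ineq4)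
      also have "\<dots> \<le> B n * (c1 + c2) + B n * (c1 + c2)"
        unfolding top_def bot_def a_def b_def by (intro add_mono bd) auto
      finally show "cmod (top n - bot n) \<le> 2 * B n * (c1 + c2)" by simp
    qed
    have "(\<lambda>n. 2 * B n * (c1 + c2)) \<longlonglongrightarrow> 0"
    proof -
      have "(\<lambda>n. exp (M * real n - e * (real n)^2)) \<longlonglongrightarrow> 0" using e by real_asymp
      then have "(\<lambda>n. 2 * (K * exp (e * m^2)) * exp (M * real n - e * (real n)^2) * (c1 + c2)) \<longlonglongrightarrow> 2 * (K * exp (e * m^2)) * 0 * (c1 + c2)"
        by (intro tendsto_intros)
      moreover have eq: "2 * B n * (c1 + c2) = 2 * (K * exp (e * m^2)) * exp (M * real n - e * (real n)^2) * (c1 + c2)" for n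
        by (simp add: B_def exp_diff right_diff_distrib)
      ultimately show ?thesis unfolding eq by simp
    qed
    then have "(\<lambda>n. top n - bot n) \<longlonglongrightarrow> 0"
      using bound by (rule Lim_null_comparison[rotated])
    then have "(\<lambda>n. contour_integral (circlepath 0 R) (fe e) + (top n - bot n)) \<longlonglongrightarrow> contour_integral (circlepath 0 R) (fe e) + 0"
      by (intro tendsto_intros)
    moreover have "(\<lambda>n. contour_integral (circlepath 0 R) (fe e) + (top n - bot n)) \<longlonglongrightarrow>
       \<i> * ((LBINT t. fe e (Complex c1 t)) - (LBINT t. fe e (Complex (- c2) t)))"
    proof (rule Lim_transform_eventually)
      show "(\<lambda>n. \<i> * (integral {- real n..real n} (\<lambda>t. fe e (Complex c1 t)) -
         integral {- real n..real n} (\<lambda>t. fe e (Complex (- c2) t)))) \<longlonglongrightarrow> 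
         \<i> * ((LBINT t. fe e (Complex c1 t)) - (LBINT t. fe e (Complex (- c2) t)))"
        using e by (intro tendsto_intros LBINT_eq_lim_integral fe_int int conte) auto
    qed (use main in auto)
    ultimately have "\<i> * ((LBINT t. fe e (Complex c1 t)) - (LBINT t. fe e (Complex (- c2) t))) = contour_integral (circlepath 0 R) (fe e)"
      using LIMSEQ_unique by fastforce
    then show ?thesis by (metis mult.assoc i_squared mult_minus_left mult_1 minus_minus)
  qed
  \<comment> \<open>Removal of the damping: for e n <= 1 the factor is at most exp (x^2) on a
    vertical line, which dominates there, and on the circle the convergence is uniform.\<close>
  define e where "e = (\<lambda>n. 1 / real (Suc n))"
  have e: "e n > 0" "e n \<le> 1" for n by (auto simp: e_def field_simps)
  have e0: "e \<longlonglongrightarrow> 0" unfolding e_def by real_asymp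
  have lim: "(\<lambda>n. LBINT t. fe (e n) (Complex x t)) \<longlonglongrightarrow> (LBINT t. f (Complex x t))"
    if i: "integrable lborel (\<lambda>t. f (Complex x t))" and "\<And>e. continuous_on UNIV (\<lambda>t. fe e (Complex x t))" for x
  proof (rule integral_dominated_convergence[where w = "\<lambda>t. exp (x^2) * cmod (f (Complex x t))"])
    show "AE t in lborel. (\<lambda>n. fe (e n) (Complex x t)) \<longlonglongrightarrow> f (Complex x t)"
    proof (intro AE_I2)
      fix t
      have "(\<lambda>n. fe (e n) (Complex x t)) \<longlonglongrightarrow> f (Complex x t) * exp (of_real 0 * (Complex x t)^2)"
        unfolding fe_def by (intro tendsto_intros e0)
      then show "(\<lambda>n. fe (e n) (Complex x t)) \<longlonglongrightarrow> f (Complex x t)" by simp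
    qed
    show "AE t in lborel. cmod (fe (e n) (Complex x t)) \<le> exp (x^2) * cmod (f (Complex x t))" for n
    proof (intro AE_I2)
      fix t
      have "e n * (x^2 - t^2) \<le> e n * x^2" using e[of n] by (intro mult_left_mono) auto
      also have "\<dots> \<le> 1 * x^2" using e[of n] by (intro mult_right_mono) auto
      finally have "exp (e n * (x^2 - t^2)) \<le> exp (x^2)" by simp
      then have "cmod (f (Complex x t)) * exp (e n * (x^2 - t^2)) \<le> cmod (f (Complex x t)) * exp (x^2)"
        by (intro mult_left_mono) auto
      then show "cmod (fe (e n) (Complex x t)) \<le> exp (x^2) * cmod (f (Complex x t))"
        unfolding fe_def norm_mult norm_exp_square by (simp add: mult.commute)
    qed
    show "(\<lambda>t. fe (e n) (Complex x t)) \<in> borel_measurable lborel" for n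
      using borel_measurable_continuous_onI[OF that(2)[of "e n"]] by simp
  qed (use i in auto)
  have "(\<lambda>n. (LBINT t. fe (e n) (Complex c1 t)) - (LBINT t. fe (e n) (Complex (- c2) t)))
      \<longlonglongrightarrow> (LBINT t. f (Complex c1 t)) - (LBINT t. f (Complex (- c2) t))"
    by (intro tendsto_diff lim int conte)
  moreover have "(\<lambda>n. - \<i> * contour_integral (circlepath 0 R) (fe (e n))) \<longlonglongrightarrow> - \<i> * contour_integral (circlepath 0 R) f"
  proof (intro tendsto_mult tendsto_const contour_integral_uniform_limit_circlepath(2))
    have sub: "sphere 0 R \<subseteq> - P" using Pb by fastforce
    show "\<forall>\<^sub>F n in sequentially. fe (e n) contour_integrable_on circlepath 0 R"
      using R by (intro always_eventually allI contour_integrable_continuous_circlepath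
        continuous_on_subset[OF holomorphic_on_imp_continuous_on[OF fe_hol]]) (use sub in auto)
    have "compact (f ` sphere 0 R)"
      by (intro compact_continuous_image continuous_on_subset[OF holomorphic_on_imp_continuous_on[OF f]] sub) auto
    then have "bounded (f ` sphere 0 R)" by (rule compact_imp_bounded)
    then obtain D where D: "\<And>s. s \<in> sphere 0 R \<Longrightarrow> cmod (f s) \<le> D" unfolding bounded_iff by blast
    show "uniform_limit (sphere 0 R) (\<lambda>n. fe (e n)) f sequentially"
    proof (rule uniform_limitI)
      fix r :: real assume r: "r > 0"
      have "(\<lambda>n. D * (e n * R^2 * exp (R^2))) \<longlonglongrightarrow> D * (0 * R^2 * exp (R^2))"
        by (intro tendsto_intros e0)
      then have "eventually (\<lambda>n. D * (e n * R^2 * exp (R^2)) < r) sequentially"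
        using r by (intro order_tendstoD(2)) auto
      then show "\<forall>\<^sub>F n in sequentially. \<forall>s\<in>sphere 0 R. dist (fe (e n) s) (f s) < r"
      proof eventually_elim
        case (elim n)
        show ?case
        proof
          fix s :: complex assume s: "s \<in> sphere 0 R"
          define y where "y = of_real (e n) * s^2"
          have y: "cmod y = e n * R^2" using s e[of n] by (simp add: y_def norm_mult norm_power)
          have "e n * R^2 \<le> 1 * R^2" using e[of n] by (intro mult_right_mono) auto
          then have "cmod (exp y - 1) \<le> e n * R^2 * exp (R^2)"
            using norm_exp_minus_1_le[of y] e[of n] unfolding y
            by (auto elim!: order_trans intro!: mult_left_mono)
          then have "cmod (f s) * cmod (exp y - 1) \<le> D * (e n * R^2 * exp (R^2))"
            using D[OF s] by (intro mult_mono) (auto intro: order_trans[OF norm_ge_zero])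
          moreover have "fe (e n) s - f s = f s * (exp y - 1)"
            by (simp add: fe_def y_def algebra_simps)
          ultimately show "dist (fe (e n) s) (f s) < r" using elim by (simp add: dist_norm norm_mult)
        qed
      qed
    qed
  qed (use R in auto)
  ultimately show ?thesis
    using step[OF e(1)] by (simp add: LIMSEQ_unique)
qed

subsection \<open>The Mellin transform of a cosine\<close>

definition gker :: "complex \<Rightarrow> complex \<Rightarrow> real \<Rightarrow> complex" where
  "gker p W y = (if y > 0 then exp (- p * of_real y) * of_real y powr (W - 1) else 0)"

lemma gker_measurable [measurable]: "gker p W \<in> borel_measurable borel"
  unfolding gker_def by measurable

lemma gker_integral_1:
  assumes "Re W > 0"
  shows "integrable lborel (gker 1 W)" "(LBINT y. gker 1 W y) = Gamma W"
proof -
  have eq: "gker 1 W = (\<lambda>y. indicator {0<..} y *\<^sub>R (complex_of_real y powr (W - 1) / of_real (exp y)))"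
    by (auto simp: gker_def fun_eq_iff indicator_def exp_minus field_simps exp_of_real)
  have "set_integrable lebesgue {0<..} (\<lambda>y. complex_of_real y powr (W - 1) / of_real (exp y))"
    using absolutely_integrable_Gamma_integral'[OF assms] by simp
  then have "integrable lebesgue (gker 1 W)" unfolding set_integrable_def eq .
  then show i: "integrable lborel (gker 1 W)" by (simp add: integrable_completion)
  have "((\<lambda>y. if y \<in> {0<..} then complex_of_real y powr (W - 1) / of_real (exp y) else 0) has_integral Gamma W) UNIV"
    using Gamma_integral_complex'[OF assms] by (subst has_integral_restrict_UNIV)
  moreover have "(\<lambda>y. if y \<in> {0<..} then complex_of_real y powr (W - 1) / of_real (exp y) else 0) = gker 1 W"
    by (auto simp: eq fun_eq_iff indicator_def)
  ultimately have "(gker 1 W has_integral Gamma W) UNIV" by simp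
  then show "(LBINT y. gker 1 W y) = Gamma W"
    using has_integral_integral_lborel[OF i] has_integral_unique by blast
qed

lemma gker_integral_real:
  assumes "Re W > 0" and p: "p > 0"
  shows "integrable lborel (gker (of_real p) W)" "(LBINT y. gker (of_real p) W y) = Gamma W * of_real p powr (- W)"
proof -
  have eq: "gker 1 W (0 + p * y) = of_real p powr (W - 1) * gker (of_real p) W y" for y
    using p by (auto simp: gker_def zero_less_mult_iff powr_times_real)
  have p0: "complex_of_real p powr (W - 1) \<noteq> 0" using p by simp
  have "integrable lborel (\<lambda>y. gker 1 W (0 + p * y))"
    using p by (intro lborel_integrable_real_affine gker_integral_1 assms) auto
  then have "integrable lborel (\<lambda>y. inverse (of_real p powr (W - 1)) * (of_real p powr (W - 1) * gker (of_real p) W y))"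
    unfolding eq by (rule integrable_mult_right)
  moreover have "inverse (of_real p powr (W - 1)) * (of_real p powr (W - 1) * gker (of_real p) W y) = gker (of_real p) W y" for y
    by (metis p0 left_inverse mult.assoc mult_1)
  ultimately show "integrable lborel (gker (of_real p) W)" by simp
  have "Gamma W = \<bar>p\<bar> *\<^sub>R (LBINT y. gker 1 W (0 + p * y))"
    unfolding gker_integral_1(2)[OF assms(1), symmetric] using p by (intro lborel_integral_real_affine) auto
  also have "\<dots> = of_real p * (of_real p powr (W - 1)) * (LBINT y. gker (of_real p) W y)"
    unfolding eq using p by (simp add: scaleR_conv_of_real)
  also have "of_real p * (of_real p powr (W - 1)) = complex_of_real p powr W"
    using p powr_add[of "of_real p" 1 "W - 1"] by simp
  finally show "(LBINT y. gker (of_real p) W y) = Gamma W * of_real p powr (- W)"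
    using p by (simp add: powr_minus field_simps)
qed

lemma norm_gker_real:
  assumes "p > 0"
  shows "complex_of_real (cmod (gker (of_real p) W y)) = gker (of_real p) (of_real (Re W)) y"
proof (cases "y > 0")
  case True
  have "complex_of_real (exp (- (p * y))) = exp (- (of_real p * of_real y))"
    using exp_of_real[of "- (p * y)", where 'a = complex] by simp
  moreover have "complex_of_real (y powr (Re W - 1)) = of_real y powr (of_real (Re W) - 1)"
    using powr_of_real[of y "Re W - 1"] True by simp
  ultimately show ?thesis using True by (simp add: gker_def norm_mult norm_powr_real_powr)
qed (simp add: gker_def)

lemma norm_gker_integral:
  assumes "Re W > 0" "p > 0"
  shows "(LBINT y. cmod (gker (of_real p) W y)) = Gamma (Re W) * p powr (- Re W)"
proof -
  have "complex_of_real (LBINT y. cmod (gker (of_real p) W y)) = (LBINT y. complex_of_real (cmod (gker (of_real p) W y)))"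
    by (rule integral_complex_of_real[symmetric])
  also have "\<dots> = Gamma (of_real (Re W)) * of_real p powr (- of_real (Re W))"
    unfolding norm_gker_real[OF assms(2)] using assms by (intro gker_integral_real) auto
  also have "\<dots> = of_real (Gamma (Re W) * p powr (- Re W))"
    using assms powr_of_real[of p "- Re W"] by (simp add: Gamma_complex_of_real)
  finally show ?thesis by (simp only: of_real_eq_iff)
qed

text \<open>Matches a term of the exponential series, integrated against a Gamma kernel, with a term
  of the binomial series for exponent -a; the two signs (-1)^k cancel.\<close>

lemma gbinomial_minus_mult_power:
  fixes a c r :: "'a :: field_char_0"
  shows "((- a) gchoose k) * (- c / r)^k = pochhammer a k / fact k * (c^k / r^k)"
proof -
  have "(- c / r)^k = (-1)^k * (c^k / r^k)"
    using power_minus[of "c / r" k] by (simp only: power_divide minus_divide_left)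
  then have "((- a) gchoose k) * (- c / r)^k = ((-1)^k * (-1)^k) * (pochhammer a k / fact k * (c^k / r^k))"
    unfolding gbinomial_pochhammer by (simp only: minus_minus divide_inverse mult_ac)
  then show ?thesis by (simp only: minus_one_mult_self mult_1)
qed

text \<open>For complex \<open>p\<close>, expand \<open>exp (-p y)\<close> around the real number \<open>r = |p|\<^sup>2 / Re p\<close>, which satisfies
  \<open>|p - r| < r\<close>, and resum the termwise integrals with the binomial series.\<close>

theorem gker_integral:
  assumes W: "Re W > 0" and p: "Re p > 0"
  shows "integrable lborel (gker p W)" "(LBINT y. gker p W y) = Gamma W * p powr (- W)"
proof -
  define r where "r = (cmod p)^2 / Re p"
  define q where "q = p - of_real r"
  have p0: "p \<noteq> 0" using p by auto
  have r: "r > 0" using p p0 by (simp add: r_def)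
  have "(cmod q)^2 < r^2"
  proof -
    have "(cmod q)^2 = (cmod p)^2 - 2 * r * Re p + r^2"
      unfolding q_def cmod_power2 by (simp add: power2_eq_square algebra_simps)
    also have "r * Re p = (cmod p)^2" using p by (simp add: r_def)
    then have "(cmod p)^2 - 2 * r * Re p + r^2 = r^2 - (cmod p)^2" by simp
    finally show ?thesis using p0 by simp
  qed
  then have q: "cmod q < r" using r by (simp add: power2_less_imp_less)
  define f where "f = (\<lambda>k y. (- q)^k / fact k * gker (of_real r) (W + of_nat k) y)"
  have fi: "integrable lborel (f k)" for k
    unfolding f_def using W r by (intro integrable_mult_right gker_integral_real) auto
  have fn: "f k y = ((- q * of_real y)^k / fact k) * gker (of_real r) W y" for k y
  proof (cases "y > 0")
    case True
    have "complex_of_real y powr (W + of_nat k - 1) = of_real y powr (W - 1) * of_real y ^ k"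
      using True powr_add[of "of_real y" "W - 1" "of_nat k"] by (simp add: powr_nat algebra_simps)
    then show ?thesis using True by (simp only: f_def gker_def power_mult_distrib if_True) (simp add: mult_ac)
  qed (simp add: f_def gker_def)
  have sc: "((- q * of_real y)^k /\<^sub>R fact k) = (- q * of_real y)^k / fact k" for k and y :: real
    by (simp only: scaleR_conv_of_real of_real_inverse of_real_fact divide_inverse mult.commute)
  have fs: "(\<lambda>k. f k y) sums gker p W y" for y
  proof -
    have "(\<lambda>k. ((- q * of_real y)^k /\<^sub>R fact k) * gker (of_real r) W y) sums (exp (- q * of_real y) * gker (of_real r) W y)"
      by (intro sums_mult2 exp_converges)
    moreover have "exp (- q * of_real y) * gker (of_real r) W y = gker p W y"
    proof -
      have "exp (- q * of_real y) * exp (- of_real r * of_real y) = exp (- p * of_real y)"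
        unfolding exp_add[symmetric] by (rule arg_cong[of _ _ exp]) (simp add: q_def algebra_simps)
      then show ?thesis unfolding gker_def by (cases "y > 0") (simp_all only: if_True if_False mult.assoc[symmetric] mult_zero_right)
    qed
    ultimately show ?thesis unfolding fn by (simp only: sc)
  qed
  have fa: "summable (\<lambda>k. cmod (f k y))" for y
    unfolding fn norm_mult[of "_ / _"] using summable_norm_exp[of "- q * of_real y"] unfolding sc
    by (rule summable_mult2)
  \<comment> \<open>The L1 norms are the terms of the binomial series for (1 - |q|/r) powr (- Re W);
    they are summable because |q| < r, which is what the choice of r secures.\<close>
  have fint: "(LBINT y. cmod (f k y)) = Gamma (Re W) * r powr (- Re W) * (((- Re W) gchoose k) * (- cmod q / r)^k)" for k
  proof -
    have nn: "Re W \<notin> \<int>\<^sub>\<le>\<^sub>0" using W by (auto elim!: nonpos_Ints_cases)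
    have "(LBINT y. cmod (f k y)) = cmod q ^ k / fact k * (Gamma (Re (W + of_nat k)) * r powr (- Re (W + of_nat k)))"
      unfolding f_def norm_mult using norm_gker_integral[of "W + of_nat k" r] W r
      by (simp add: norm_divide norm_power)
    also have "Gamma (Re (W + of_nat k)) = pochhammer (Re W) k * Gamma (Re W)"
      using pochhammer_Gamma[OF nn, of k] Gamma_real_pos[OF W] by simp
    also have "r powr (- Re (W + of_nat k)) = r powr (- Re W) / r ^ k"
      using r by (simp add: powr_diff powr_realpow)
    finally show ?thesis unfolding gbinomial_minus_mult_power by (simp only: divide_inverse mult_ac)
  qed
  have fsum: "summable (\<lambda>k. LBINT y. cmod (f k y))"
    unfolding fint using gen_binomial_real[of "- cmod q / r" "- Re W"] q r
    by (intro summable_mult) (auto simp: sums_iff)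
  have eq: "(\<lambda>y. \<Sum>k. f k y) = gker p W" using fs by (auto simp: sums_iff)
  show "integrable lborel (gker p W)"
    using integrable_suminf[OF fi _ fsum] fa unfolding eq by simp
  have "(\<lambda>k. LBINT y. f k y) sums (LBINT y. gker p W y)"
    using sums_integral[OF fi _ fsum] fa unfolding eq by simp
  moreover have "(\<lambda>k. LBINT y. f k y) sums (Gamma W * p powr (- W))"
  proof -
    have nn: "W \<notin> \<int>\<^sub>\<le>\<^sub>0" using W by (rule Re_pos_not_nonpos_Ints)
    have "(LBINT y. f k y) = Gamma W * of_real r powr (- W) * ((- W gchoose k) * (q / of_real r)^k)" for k
    proof -
      have "(LBINT y. f k y) = (- q)^k / fact k * (Gamma (W + of_nat k) * of_real r powr (- (W + of_nat k)))"
        unfolding f_def using gker_integral_real[of "W + of_nat k" r] W r by simp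
      also have "Gamma (W + of_nat k) = pochhammer W k * Gamma W"
        using pochhammer_Gamma[OF nn, of k] Gamma_eq_zero_iff[of W] nn by simp
      also have "of_real r powr (- (W + of_nat k)) = of_real r powr (- W) / complex_of_real r ^ k"
        using r by (simp add: powr_diff powr_nat)
      finally show ?thesis using gbinomial_minus_mult_power[of W k "- q" "of_real r"]
        by (simp only: minus_minus) (simp only: divide_inverse mult_ac)
    qed
    moreover have "(\<lambda>k. Gamma W * of_real r powr (- W) * ((- W gchoose k) * (q / of_real r)^k)) sums
        (Gamma W * of_real r powr (- W) * (1 + q / of_real r) powr (- W))"
      using q r by (intro sums_mult gen_binomial_complex) (simp add: norm_divide)
    moreover have "of_real r powr (- W) * (1 + q / of_real r) powr (- W) = p powr (- W)"
    proof -
      have e: "of_real r * (1 + q / of_real r) = p" using r by (simp add: q_def field_simps)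
      then have "1 + q / of_real r \<noteq> 0" using p0 by auto
      \<comment> \<open>Since r is a positive real, splitting the logarithm creates no branch
        term.\<close>
      then have "Ln p = of_real (ln r) + Ln (1 + q / of_real r)"
        using Ln_times_of_real[OF r, of "1 + q / of_real r"] Ln_of_real[OF r] unfolding e by simp
      then show ?thesis using p0 r \<open>1 + q / of_real r \<noteq> 0\<close>
        by (simp add: powr_def Ln_of_real exp_add[symmetric] algebra_simps)
    qed
    ultimately show ?thesis by (simp add: mult.assoc)
  qed
  ultimately show "(LBINT y. gker p W y) = Gamma W * p powr (- W)"
    by (rule sums_unique2)
qed

section \<open>From Gamma kernels to the Mellin-Parseval identity for cosines\<close>

lemma powr_of_real_pos_eq_exp: "y > 0 \<Longrightarrow> complex_of_real y powr z = exp (z * of_real (ln y))"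
  by (simp add: powr_def Ln_of_real)

lemma norm_gker:
  "cmod (gker p W y) = cmod (gker p (of_real (Re W)) y)"
  by (auto simp: gker_def norm_mult norm_powr_real_powr)

text \<open>Used with D = 2A, Y = h mu_n x and the exponent a or a - 1/(2A). The condition
  \<open>Wpos\<close> keeps Re W positive on the whole line, so that Gamma W has its integral
  representation.\<close>

locale mellin_setup =
  fixes f :: "real \<Rightarrow> complex" and c D Y :: real and a :: complex
  assumes cont: "continuous_on UNIV f" and supp: "\<And>u. u \<notin> {1/2..3/2} \<Longrightarrow> f u = 0"
    and int0: "integrable lborel (\<lambda>t. mell f (Complex (- c) t))"
    and D: "D > 0" and Y: "Y > 0" and Wpos: "1 + c + Re a > 0"
begin

definition W :: "real \<Rightarrow> complex" where
  "W t = of_real D * (1 - Complex (- c) t + a)"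

lemma Re_W: "Re (W t) = D * (1 + c + Re a)" by (simp add: W_def algebra_simps)

lemma Re_W_pos: "Re (W t) > 0" using D Wpos by (simp add: Re_W)

lemma measurable_mell [measurable]: "(\<lambda>t. mell f (Complex (- c) t)) \<in> borel_measurable borel"
  using int0 by auto

lemma continuous_W [continuous_intros]: "continuous_on UNIV W"
  unfolding W_def by (intro continuous_intros)

lemma measurable_W [measurable]: "W \<in> borel_measurable borel"
  by (intro borel_measurable_continuous_onI continuous_intros)

text \<open>Writing \<open>Gamma (W t) * p powr (- W t)\<close> as an integral of
  \<open>gker\<close> and exchanging the integrals leaves Mellin inversion at the point
  \<open>y powr D / Y\<close>; the substitution \<open>y = (Y * u) powr (1 / D)\<close> then returns
  to the variable of f. Re p > 0 supplies the absolute convergence that Fubini needs.\<close>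

lemma parseval_gker:
  assumes p: "Re p > 0"
  shows "(LBINT t. mell f (Complex (- c) t) * of_real Y powr (Complex (- c) t) * (Gamma (W t) * p powr (- W t))) =
    2 * pi / D * of_real Y powr (1 + a) *
    integral {1/2..3/2} (\<lambda>u. f u * of_real u powr a * exp (- p * of_real ((Y * u) powr (1 / D))))"
proof -
  let ?m = "\<lambda>t. mell f (Complex (- c) t)" and ?s = "\<lambda>t. Complex (- c) t"
  have "(LBINT t. ?m t * of_real Y powr ?s t * (Gamma (W t) * p powr (- W t))) =
     (LBINT t. LBINT y. ?m t * of_real Y powr ?s t * gker p (W t) y)"
    using gker_integral(2)[OF Re_W_pos p] by simp
  also have "\<dots> = (LBINT y. LBINT t. ?m t * of_real Y powr ?s t * gker p (W t) y)"
  proof (rule lborel_pair.Fubini_integral[symmetric])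
    define Wr where "Wr = complex_of_real (D * (1 + c + Re a))"
    have "integrable lborel (\<lambda>t. of_real (Y powr (- c)) * ?m t)" using int0 by simp
    moreover have "integrable lborel (gker p Wr)"
      using D Wpos p unfolding Wr_def by (intro gker_integral) auto
    ultimately have i: "integrable (lborel \<Otimes>\<^sub>M lborel) (\<lambda>(t, y). (of_real (Y powr (- c)) * ?m t) * gker p Wr y)"
      by (rule integrable_pair_mult)
    show "integrable (lborel \<Otimes>\<^sub>M lborel) (\<lambda>(t, y). ?m t * of_real Y powr ?s t * gker p (W t) y)"
    proof (rule Bochner_Integration.integrable_bound[OF i])
      have [measurable]: "(\<lambda>t. complex_of_real Y powr ?s t) \<in> borel_measurable borel"
        using Y by (intro borel_measurable_continuous_onI continuous_intros) auto
      have [measurable]: "(\<lambda>(t, y). gker p (W t) y) \<in> borel_measurable (lborel \<Otimes>\<^sub>M lborel)"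
      proof -
        have "(\<lambda>(t, y). gker p (W t) y) = (\<lambda>(t, y). if y > 0 then exp (- p * of_real y) * exp ((W t - 1) * of_real (ln y)) else 0)"
          by (auto simp: fun_eq_iff gker_def powr_of_real_pos_eq_exp)
        then show ?thesis by simp
      qed
      show "(\<lambda>(t, y). ?m t * of_real Y powr ?s t * gker p (W t) y) \<in> borel_measurable (lborel \<Otimes>\<^sub>M lborel)"
        by measurable
      \<comment> \<open>The modulus of the kernel depends on W only through Re W, which is constant
        on the line; hence the double integrand is dominated by a product of two integrable
        functions of one variable.\<close>
      have "cmod (gker p (W t) y) = cmod (gker p Wr y)" for t y
        by (subst norm_gker) (simp add: Re_W Wr_def)
      then show "AE x in lborel \<Otimes>\<^sub>M lborel. cmod (case x of (t, y) \<Rightarrow> ?m t * of_real Y powr ?s t * gker p (W t) y)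
         \<le> cmod (case x of (t, y) \<Rightarrow> (of_real (Y powr (- c)) * ?m t) * gker p Wr y)"
        using Y by (intro AE_I2) (auto simp: norm_mult norm_powr_real_powr)
    qed
  qed
  also have "\<dots> = (LBINT y. if y > 0 then exp (- p * of_real y) * of_real y powr (of_real D * (1 + a) - 1) * (2 * pi * f (y powr D / Y)) else 0)"
  proof (intro Bochner_Integration.integral_cong refl)
    fix y :: real
    show "(LBINT t. ?m t * of_real Y powr ?s t * gker p (W t) y) =
      (if y > 0 then exp (- p * of_real y) * of_real y powr (of_real D * (1 + a) - 1) * (2 * pi * f (y powr D / Y)) else 0)"
    proof (cases "y > 0")
      case True
      have yD: "y powr D / Y > 0" using True Y by simp
      have "complex_of_real Y powr ?s t * of_real y powr (W t - 1) =
         of_real y powr (of_real D * (1 + a) - 1) * of_real (y powr D / Y) powr (- ?s t)" for t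
      proof -
        have l: "ln (y powr D / Y) = D * ln y - ln Y" using True Y by (simp add: ln_div ln_powr)
        show ?thesis
          unfolding powr_of_real_pos_eq_exp[OF True] powr_of_real_pos_eq_exp[OF Y] powr_of_real_pos_eq_exp[OF yD] l exp_add[symmetric]
          by (rule arg_cong[of _ _ exp]) (simp add: W_def algebra_simps)
      qed
      then have "?m t * of_real Y powr ?s t * gker p (W t) y =
         exp (- p * of_real y) * of_real y powr (of_real D * (1 + a) - 1) * (?m t * of_real (y powr D / Y) powr (- ?s t))" for t
        using True unfolding gker_def by (simp add: mult_ac)
      then have "(LBINT t. ?m t * of_real Y powr ?s t * gker p (W t) y) =
         exp (- p * of_real y) * of_real y powr (of_real D * (1 + a) - 1) * (LBINT t. ?m t * of_real (y powr D / Y) powr (- ?s t))"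
        by (simp only: integral_mult_right_zero)
      also have "(LBINT t. ?m t * of_real (y powr D / Y) powr (- ?s t)) = 2 * pi * f (y powr D / Y)"
        by (rule mellin_inversion[OF cont supp int0 yD])
      finally show ?thesis using True by simp
    qed (simp add: gker_def)
  qed
  also have "\<dots> = integral {(Y * (1/2)) powr (1 / D)..(Y * (3/2)) powr (1 / D)}
      (\<lambda>y. exp (- p * of_real y) * of_real y powr (of_real D * (1 + a) - 1) * (2 * pi * f (y powr D / Y)))"
  proof -
    have pos: "(Y * (1/2)) powr (1 / D) > 0" using Y by simp
    have y0: "y > 0" if "y \<in> {(Y * (1/2)) powr (1 / D)..(Y * (3/2)) powr (1 / D)}" for y
      using less_le_trans[OF pos] that by (simp only: atLeastAtMost_iff)
    let ?h = "\<lambda>y. if y > 0 then exp (- p * of_real y) * of_real y powr (of_real D * (1 + a) - 1) * (2 * pi * f (y powr D / Y)) else 0"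
    have c: "continuous_on {(Y * (1/2)) powr (1 / D)..(Y * (3/2)) powr (1 / D)}
       (\<lambda>y. exp (- p * of_real y) * of_real y powr (of_real D * (1 + a) - 1) * (2 * pi * f (y powr D / Y)))"
    proof -
      have "continuous_on {y1..y2} (\<lambda>y. exp (- p * of_real y) * of_real y powr (of_real D * (1 + a) - 1) * (2 * pi * f (y powr D / Y)))"
        if "y1 > 0" for y1 y2
        using that Y by (intro continuous_intros continuous_on_compose2[OF cont]) auto
      then show ?thesis using pos by blast
    qed
    have "(LBINT y. ?h y) = integral {(Y * (1/2)) powr (1 / D)..(Y * (3/2)) powr (1 / D)} ?h"
    proof (rule LBINT_eq_integral_supp(2))
      show "continuous_on {(Y * (1/2)) powr (1 / D)..(Y * (3/2)) powr (1 / D)} ?h"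
        by (rule continuous_on_eq[OF c]) (simp only: y0 if_True)
      fix y assume y: "y \<notin> {(Y * (1/2)) powr (1 / D)..(Y * (3/2)) powr (1 / D)}"
      have "f (y powr D / Y) = 0" if "y > 0"
      proof (rule supp)
        have "y = (y powr D) powr (1 / D)" using that D by (simp add: powr_powr)
        then have "\<not> ((Y * (1/2)) powr (1 / D) \<le> (y powr D) powr (1 / D) \<and> (y powr D) powr (1 / D) \<le> (Y * (3/2)) powr (1 / D))"
          using y by auto
        moreover have "Y * (1/2) \<le> y powr D \<Longrightarrow> (Y * (1/2)) powr (1 / D) \<le> (y powr D) powr (1 / D)"
          using Y D by (intro powr_mono2) auto
        moreover have "y powr D \<le> Y * (3/2) \<Longrightarrow> (y powr D) powr (1 / D) \<le> (Y * (3/2)) powr (1 / D)"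
          using Y D by (intro powr_mono2) auto
        ultimately show "y powr D / Y \<notin> {1/2..3/2}" using Y by (auto simp: field_simps)
      qed
      then show "?h y = 0" by simp
    qed
    also have "\<dots> = integral {(Y * (1/2)) powr (1 / D)..(Y * (3/2)) powr (1 / D)}
      (\<lambda>y. exp (- p * of_real y) * of_real y powr (of_real D * (1 + a) - 1) * (2 * pi * f (y powr D / Y)))"
      by (intro integral_cong) (simp only: y0 if_True)
    finally show ?thesis .
  qed
  also have "\<dots> = integral {1/2..3/2} (\<lambda>u. (2 * pi / D * of_real Y powr (1 + a)) *
      (f u * of_real u powr a * exp (- p * of_real ((Y * u) powr (1 / D)))))"
  proof (rule sym, rule integral_unique)
    let ?h = "\<lambda>y. exp (- p * of_real y) * of_real y powr (of_real D * (1 + a) - 1) * (2 * pi * f (y powr D / Y))"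
    let ?g = "\<lambda>u. (Y * u) powr (1 / D)" and ?g' = "\<lambda>u. (Y * u) powr (1 / D - 1) * Y / D"
    have "((\<lambda>u. ?g' u *\<^sub>R ?h (?g u)) has_integral (integral {?g (1/2)..?g (3/2)} ?h)) {1/2..3/2}"
    proof (rule has_integral_substitution[where c = "?g (1/2)" and d = "?g (3/2)"])
      show "?g ` {1/2..3/2} \<subseteq> {?g (1/2)..?g (3/2)}"
        using Y D by (auto intro!: powr_mono2 mult_left_mono)
      show "continuous_on {?g (1/2)..?g (3/2)} ?h"
      proof -
        have "continuous_on {y1..y2} ?h" if "y1 > 0" for y1 y2
          using that Y by (intro continuous_intros continuous_on_compose2[OF cont]) auto
        moreover have "?g (1/2) > 0" using Y by simp
        ultimately show ?thesis by blast
      qed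
      show "(?g has_field_derivative ?g' x) (at x within {1/2..3/2})" if "x \<in> {1/2..3/2}" for x
        using that Y D by (auto intro!: derivative_eq_intros simp: powr_diff field_simps)
      show "?g (1/2) \<le> ?g (3/2)" using Y D by (intro powr_mono2) auto
    qed auto
    moreover have "?g' u *\<^sub>R ?h (?g u) = (2 * pi / D * of_real Y powr (1 + a)) *
      (f u * of_real u powr a * exp (- p * of_real ((Y * u) powr (1 / D))))" if "u \<in> {1/2..3/2}" for u
    proof -
      have u: "u > 0" and Yu: "Y * u > 0" and g0: "?g u > 0" using that Y by auto
      have gD: "?g u powr D / Y = u" using Yu Y D by (simp add: powr_powr)
      have lg: "ln (?g u) = (ln Y + ln u) / D" using Yu Y u D by (simp add: ln_powr ln_mult)
      have lYu: "ln (Y * u) = ln Y + ln u" using Y u by (simp add: ln_mult)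
      have "complex_of_real ((Y * u) powr (1 / D - 1)) = of_real (Y * u) powr of_real (1 / D - 1)"
        by (rule powr_of_real[symmetric]) (use Yu in simp)
      then have 1: "complex_of_real ((Y * u) powr (1 / D - 1)) = exp (of_real ((1 / D - 1) * (ln Y + ln u)))"
        unfolding powr_of_real_pos_eq_exp[OF Yu] lYu by (simp only: of_real_mult)
      have 2: "of_real (?g u) powr (of_real D * (1 + a) - 1) = exp ((of_real D * (1 + a) - 1) * of_real ((ln Y + ln u) / D))"
        using powr_of_real_pos_eq_exp[OF g0] by (simp only: lg)
      have 3: "complex_of_real Y powr (1 + a) = exp (a * of_real (ln Y)) * of_real Y"
        using Y by (simp add: powr_of_real_pos_eq_exp[OF Y] exp_add distrib_right exp_of_real)
      have 4: "of_real u powr a = exp (a * of_real (ln u))" using powr_of_real_pos_eq_exp[OF u] .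
      have "exp (of_real ((1 / D - 1) * (ln Y + ln u))) * exp ((of_real D * (1 + a) - 1) * of_real ((ln Y + ln u) / D))
         = exp (a * of_real (ln Y)) * exp (a * complex_of_real (ln u))"
        unfolding exp_add[symmetric] using D by (intro arg_cong[of _ _ exp]) (simp add: field_simps)
      note e = this[folded 1 2 4]
      have "?g' u *\<^sub>R ?h (?g u) = (of_real ((Y * u) powr (1 / D - 1)) * of_real (?g u) powr (of_real D * (1 + a) - 1)) *
          (of_real Y / of_real D * exp (- p * of_real (?g u)) * (2 * pi * f u))"
        unfolding gD by (simp add: scaleR_conv_of_real del: of_real_mult of_real_divide) (simp add: mult_ac)
      then show ?thesis unfolding e 3 by (simp add: mult_ac)
    qed
    ultimately show "((\<lambda>u. (2 * pi / D * of_real Y powr (1 + a)) *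
      (f u * of_real u powr a * exp (- p * of_real ((Y * u) powr (1 / D))))) has_integral (integral {?g (1/2)..?g (3/2)} ?h)) {1/2..3/2}"
      by (rule has_integral_eq[rotated])
  qed
  finally show ?thesis by (simp only: integral_mult_right)
qed


text \<open>At p = i or p = - i the factor \<open>p powr (- W)\<close> can grow like exp (pi/2 |Im
  W|) and use up the exponential decay of Gamma W. Convergence on this boundary therefore rests on
  the decay of \<open>mell f\<close>, and that is the integrability assumed here.\<close>

context
  assumes int1: "integrable lborel (\<lambda>t. cmod (mell f (Complex (- c) t)) * (cmod (Gamma (W t)) * exp (pi/2 * \<bar>Im (W t)\<bar>)))"
begin

lemma measurable_Gamma_W [measurable]: "(\<lambda>t. Gamma (W t)) \<in> borel_measurable borel"
proof (rule borel_measurable_continuous_onI)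
  have "Gamma holomorphic_on {z. Re z > 0}"
    by (intro holomorphic_Gamma) (use Re_pos_not_nonpos_Ints in auto)
  then show "continuous_on UNIV (\<lambda>t. Gamma (W t))"
    by (intro continuous_on_compose2[OF holomorphic_on_imp_continuous_on continuous_W]) (use Re_W_pos in auto)
qed

lemma measurable_Y [measurable]: "(\<lambda>t. complex_of_real Y powr Complex (- c) t) \<in> borel_measurable borel"
  using Y by (intro borel_measurable_continuous_onI continuous_intros) auto

lemma int_bound:
  assumes [measurable]: "h \<in> borel_measurable borel" and h: "\<And>t. cmod (h t) \<le> exp (pi/2 * \<bar>Im (W t)\<bar>)"
  shows "integrable lborel (\<lambda>t. mell f (Complex (- c) t) * of_real Y powr (Complex (- c) t) * (Gamma (W t) * h t))"
    and "cmod (mell f (Complex (- c) t) * of_real Y powr (Complex (- c) t) * (Gamma (W t) * h t)) \<le>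
      Y powr (- c) * (cmod (mell f (Complex (- c) t)) * (cmod (Gamma (W t)) * exp (pi/2 * \<bar>Im (W t)\<bar>)))"
proof -
  show b: "cmod (mell f (Complex (- c) t) * of_real Y powr (Complex (- c) t) * (Gamma (W t) * h t)) \<le>
      Y powr (- c) * (cmod (mell f (Complex (- c) t)) * (cmod (Gamma (W t)) * exp (pi/2 * \<bar>Im (W t)\<bar>)))" for t
  proof -
    have "cmod (mell f (Complex (- c) t) * of_real Y powr (Complex (- c) t) * (Gamma (W t) * h t)) =
        Y powr (- c) * (cmod (mell f (Complex (- c) t)) * (cmod (Gamma (W t)) * cmod (h t)))"
      using Y by (simp add: norm_mult norm_powr_real_powr)
    also have "\<dots> \<le> Y powr (- c) * (cmod (mell f (Complex (- c) t)) * (cmod (Gamma (W t)) * exp (pi/2 * \<bar>Im (W t)\<bar>)))"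
      by (intro mult_left_mono h) auto
    finally show ?thesis .
  qed
  have "integrable lborel (\<lambda>t. Y powr (- c) * (cmod (mell f (Complex (- c) t)) * (cmod (Gamma (W t)) * exp (pi/2 * \<bar>Im (W t)\<bar>))))"
    using int1 by (rule integrable_mult_right)
  then show "integrable lborel (\<lambda>t. mell f (Complex (- c) t) * of_real Y powr (Complex (- c) t) * (Gamma (W t) * h t))"
    by (rule Bochner_Integration.integrable_bound) (use order_trans[OF b abs_ge_self] in auto)
qed

text \<open>The condition |p| >= 1 makes the contribution |p| powr (- Re W) harmless, and |arg p| <
  pi/2 bounds the rest. The bound is uniform in p, as dominated convergence towards the imaginary
  axis requires.\<close>

lemma norm_powr_W_le:
  assumes "Re p > 0" "cmod p \<ge> 1"
  shows "cmod (p powr (- W t)) \<le> exp (pi/2 * \<bar>Im (W t)\<bar>)"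
proof -
  have p0: "p \<noteq> 0" using assms by auto
  have l: "Re (Ln p) \<ge> 0" using p0 assms by simp
  have i: "\<bar>Im (Ln p)\<bar> < pi/2" using assms p0 Re_Ln_pos_lt by blast
  have "Re (- W t * Ln p) = - (Re (W t) * Re (Ln p)) + Im (W t) * Im (Ln p)" by simp
  also have "\<dots> \<le> Im (W t) * Im (Ln p)"
    using mult_nonneg_nonneg[OF less_imp_le[OF Re_W_pos[of t]] l] by linarith
  also have "\<dots> \<le> \<bar>Im (W t)\<bar> * \<bar>Im (Ln p)\<bar>" by (metis abs_ge_self abs_mult)
  also have "\<dots> \<le> \<bar>Im (W t)\<bar> * (pi/2)" using i by (intro mult_left_mono) auto
  finally have "Re (- W t * Ln p) \<le> pi/2 * \<bar>Im (W t)\<bar>" by (simp only: mult.commute)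
  then show ?thesis using p0 by (simp only: powr_def norm_exp_eq_Re exp_le_cancel_iff if_False)
qed

text \<open>Let \<open>p\<close> tend to \<open>-\<i> sg\<close> from the right half plane in \<open>parseval_gker\<close>; the integral on the left is
  dominated because \<open>p powr (-W)\<close> costs at most the factor \<open>exp (\<pi>/2 |Im W|)\<close> that \<open>Gamma W\<close> gains.\<close>

lemma main_term_exp:
  assumes sg: "sg = 1 \<or> sg = -1"
  shows "(LBINT t. mell f (Complex (- c) t) * of_real Y powr (Complex (- c) t) * (Gamma (W t) * exp (of_real sg * \<i> * (pi/2) * W t))) =
    2 * pi / D * of_real Y powr (1 + a) *
    integral {1/2..3/2} (\<lambda>u. f u * of_real u powr a * exp (of_real sg * \<i> * of_real ((Y * u) powr (1 / D))))"
proof -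
  define e where "e = (\<lambda>n. 1 / real (Suc n))"
  have e: "e n > 0" for n by (auto simp: e_def field_simps)
  have e0: "e \<longlonglongrightarrow> 0" unfolding e_def by real_asymp
  define p where "p = (\<lambda>n. Complex (e n) (- sg))"
  define p0 where "p0 = Complex 0 (- sg)"
  have p: "Re (p n) > 0" "cmod (p n) \<ge> 1" for n
    using e[of n] sg abs_Im_le_cmod[of "p n"] by (auto simp: p_def)
  have plim: "p \<longlonglongrightarrow> p0" unfolding p_def p0_def by (intro tendsto_Complex e0 tendsto_const)
  have Lnp0: "Ln p0 = - of_real sg * \<i> * (pi/2)"
  proof -
    have "sg = 1 \<and> p0 = - \<i> \<or> sg = -1 \<and> p0 = \<i>" using sg by (auto simp: p0_def complex_eq_iff)
    then show ?thesis by auto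
  qed
  have p0n: "p0 \<notin> \<real>\<^sub>\<le>\<^sub>0" "p0 \<noteq> 0" using sg by (auto simp: p0_def complex_nonpos_Reals_iff complex_eq_iff)
  have p0W: "p0 powr (- W t) = exp (of_real sg * \<i> * (pi/2) * W t)" for t
    using p0n by (simp add: powr_def Lnp0 mult_ac)
  have 1: "(\<lambda>n. LBINT t. mell f (Complex (- c) t) * of_real Y powr (Complex (- c) t) * (Gamma (W t) * p n powr (- W t)))
     \<longlonglongrightarrow> (LBINT t. mell f (Complex (- c) t) * of_real Y powr (Complex (- c) t) * (Gamma (W t) * p0 powr (- W t)))"
  proof (rule integral_dominated_convergence)
    have mp: "(\<lambda>t. q powr (- W t)) \<in> borel_measurable borel" if "q \<noteq> 0" for q
      unfolding powr_def by measurable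
    have pn: "p n \<noteq> 0" for n using p(1)[of n] by auto
    note [measurable] = mp[OF pn] mp[OF p0n(2)]
    show "(\<lambda>t. mell f (Complex (- c) t) * of_real Y powr (Complex (- c) t) * (Gamma (W t) * p0 powr (- W t))) \<in> borel_measurable lborel"
      "(\<lambda>t. mell f (Complex (- c) t) * of_real Y powr (Complex (- c) t) * (Gamma (W t) * p n powr (- W t))) \<in> borel_measurable lborel" for n
      by measurable
    show "integrable lborel (\<lambda>t. Y powr (- c) * (cmod (mell f (Complex (- c) t)) * (cmod (Gamma (W t)) * exp (pi/2 * \<bar>Im (W t)\<bar>))))"
      using int1 by (rule integrable_mult_right)
    show "AE t in lborel. (\<lambda>n. mell f (Complex (- c) t) * of_real Y powr (Complex (- c) t) * (Gamma (W t) * p n powr (- W t)))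
       \<longlonglongrightarrow> mell f (Complex (- c) t) * of_real Y powr (Complex (- c) t) * (Gamma (W t) * p0 powr (- W t))"
      using p0n by (intro AE_I2 tendsto_intros plim) auto
    show "AE t in lborel. cmod (mell f (Complex (- c) t) * of_real Y powr (Complex (- c) t) * (Gamma (W t) * p n powr (- W t)))
      \<le> Y powr (- c) * (cmod (mell f (Complex (- c) t)) * (cmod (Gamma (W t)) * exp (pi/2 * \<bar>Im (W t)\<bar>)))" for n
      by (intro AE_I2 int_bound(2) norm_powr_W_le p) measurable
  qed
  have L: "integrable lborel (\<lambda>u. f u * of_real u powr a * exp (- q * of_real ((Y * u) powr (1 / D))))"
    "integral {1/2..3/2} (\<lambda>u. f u * of_real u powr a * exp (- q * of_real ((Y * u) powr (1 / D)))) =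
     (LBINT u. f u * of_real u powr a * exp (- q * of_real ((Y * u) powr (1 / D))))" for q
  proof -
    have c: "continuous_on {1/2..3/2} (\<lambda>u. f u * of_real u powr a * exp (- q * of_real ((Y * u) powr (1 / D))))"
      using Y by (intro continuous_intros continuous_on_subset[OF cont]) auto
    show "integrable lborel (\<lambda>u. f u * of_real u powr a * exp (- q * of_real ((Y * u) powr (1 / D))))"
      using LBINT_eq_integral_supp(1)[OF c] supp by simp
    show "integral {1/2..3/2} (\<lambda>u. f u * of_real u powr a * exp (- q * of_real ((Y * u) powr (1 / D)))) =
     (LBINT u. f u * of_real u powr a * exp (- q * of_real ((Y * u) powr (1 / D))))"
      using LBINT_eq_integral_supp(2)[OF c] supp by simp
  qed
  have 2: "(\<lambda>n. integral {1/2..3/2} (\<lambda>u. f u * of_real u powr a * exp (- p n * of_real ((Y * u) powr (1 / D)))))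
     \<longlonglongrightarrow> integral {1/2..3/2} (\<lambda>u. f u * of_real u powr a * exp (- p0 * of_real ((Y * u) powr (1 / D))))"
    unfolding L(2)
  proof (rule integral_dominated_convergence)
    show "integrable lborel (\<lambda>u. cmod (f u * of_real u powr a))"
      using L(1)[of 0] by simp
    show "(\<lambda>u. f u * of_real u powr a * exp (- p0 * of_real ((Y * u) powr (1 / D)))) \<in> borel_measurable lborel"
      "(\<lambda>u. f u * of_real u powr a * exp (- p n * of_real ((Y * u) powr (1 / D)))) \<in> borel_measurable lborel" for n
      using L(1) by (blast intro: borel_measurable_integrable)+
    show "AE u in lborel. (\<lambda>n. f u * of_real u powr a * exp (- p n * of_real ((Y * u) powr (1 / D)))) \<longlonglongrightarrow>
      f u * of_real u powr a * exp (- p0 * of_real ((Y * u) powr (1 / D)))"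
      by (intro AE_I2 tendsto_intros plim)
    show "AE u in lborel. cmod (f u * of_real u powr a * exp (- p n * of_real ((Y * u) powr (1 / D)))) \<le> cmod (f u * of_real u powr a)" for n
      using p(1)[of n] by (intro AE_I2) (simp add: norm_mult mult_left_le)
  qed
  have "(\<lambda>n. 2 * pi / D * of_real Y powr (1 + a) * integral {1/2..3/2} (\<lambda>u. f u * of_real u powr a * exp (- p n * of_real ((Y * u) powr (1 / D)))))
     \<longlonglongrightarrow> 2 * pi / D * of_real Y powr (1 + a) * integral {1/2..3/2} (\<lambda>u. f u * of_real u powr a * exp (- p0 * of_real ((Y * u) powr (1 / D))))"
    by (intro tendsto_intros 2)
  from LIMSEQ_unique[OF this 1[unfolded parseval_gker[OF p(1)]]]
  have "(LBINT t. mell f (Complex (- c) t) * of_real Y powr (Complex (- c) t) * (Gamma (W t) * p0 powr (- W t))) =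
    2 * pi / D * of_real Y powr (1 + a) * integral {1/2..3/2} (\<lambda>u. f u * of_real u powr a * exp (- p0 * of_real ((Y * u) powr (1 / D))))"
    by simp
  moreover have "- p0 = of_real sg * \<i>" by (simp add: p0_def complex_eq_iff)
  ultimately show ?thesis unfolding p0W by simp
qed

theorem main_term_cos:
  fixes k :: complex
  shows "integrable lborel (\<lambda>t. mell f (Complex (- c) t) * of_real Y powr (Complex (- c) t) * (Gamma (W t) * cos (pi/2 * W t + k * pi)))"
    and "(LBINT t. mell f (Complex (- c) t) * of_real Y powr (Complex (- c) t) * (Gamma (W t) * cos (pi/2 * W t + k * pi))) =
    2 * pi / D * of_real Y powr (1 + a) *
    integral {1/2..3/2} (\<lambda>u. f u * of_real u powr a * cos (of_real ((Y * u) powr (1 / D)) + k * pi))"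
proof -
  let ?F = "\<lambda>sg t. mell f (Complex (- c) t) * of_real Y powr (Complex (- c) t) * (Gamma (W t) * exp (of_real sg * \<i> * (pi/2) * W t))"
  let ?G = "\<lambda>sg u. f u * of_real u powr a * exp (of_real sg * \<i> * of_real ((Y * u) powr (1 / D)))"
  have cosx: "cos (z + k * pi) = exp (\<i> * k * pi) / 2 * exp (of_real 1 * \<i> * z) + exp (- \<i> * k * pi) / 2 * exp (of_real (-1) * \<i> * z)" for z :: complex
    by (simp add: cos_exp_eq exp_add[symmetric] add_divide_distrib algebra_simps)
  have Fi: "integrable lborel (?F sg)" if "sg = 1 \<or> sg = -1" for sg
  proof (rule int_bound(1))
    show "(\<lambda>t. exp (of_real sg * \<i> * (pi/2) * W t)) \<in> borel_measurable borel" by measurable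
    show "cmod (exp (of_real sg * \<i> * (pi/2) * W t)) \<le> exp (pi/2 * \<bar>Im (W t)\<bar>)" for t
      using that mult_left_mono[of "- Im (W t)" "\<bar>Im (W t)\<bar>" pi] mult_left_mono[of "Im (W t)" "\<bar>Im (W t)\<bar>" pi]
      by auto
  qed
  have eq: "mell f (Complex (- c) t) * of_real Y powr (Complex (- c) t) * (Gamma (W t) * cos (pi/2 * W t + k * pi)) =
     exp (\<i> * k * pi) / 2 * ?F 1 t + exp (- \<i> * k * pi) / 2 * ?F (-1) t" for t
    unfolding cosx by (simp add: algebra_simps)
  show "integrable lborel (\<lambda>t. mell f (Complex (- c) t) * of_real Y powr (Complex (- c) t) * (Gamma (W t) * cos (pi/2 * W t + k * pi)))"
    unfolding eq using Fi[of 1] Fi[of "-1"] by (intro Bochner_Integration.integrable_add integrable_mult_right) simp_all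
  have Gi: "?G sg integrable_on {1/2..3/2}" for sg
    using Y by (intro integrable_continuous_real continuous_intros continuous_on_subset[OF cont]) auto
  have "(LBINT t. mell f (Complex (- c) t) * of_real Y powr (Complex (- c) t) * (Gamma (W t) * cos (pi/2 * W t + k * pi))) =
     exp (\<i> * k * pi) / 2 * (LBINT t. ?F 1 t) + exp (- \<i> * k * pi) / 2 * (LBINT t. ?F (-1) t)"
    unfolding eq using Fi[of 1] Fi[of "-1"]
    by (subst Bochner_Integration.integral_add) (simp_all only: integrable_mult_right integral_mult_right_zero simp_thms)
  also have "\<dots> = 2 * pi / D * of_real Y powr (1 + a) * (exp (\<i> * k * pi) / 2 * integral {1/2..3/2} (?G 1)
       + exp (- \<i> * k * pi) / 2 * integral {1/2..3/2} (?G (-1)))"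
    by (subst (1 2) main_term_exp) (simp_all add: algebra_simps)
  also have "exp (\<i> * k * pi) / 2 * integral {1/2..3/2} (?G 1) + exp (- \<i> * k * pi) / 2 * integral {1/2..3/2} (?G (-1)) =
     integral {1/2..3/2} (\<lambda>u. exp (\<i> * k * pi) / 2 * ?G 1 u + exp (- \<i> * k * pi) / 2 * ?G (-1) u)"
    using Gi[of 1] Gi[of "-1"] by (subst integral_add) (simp_all only: integrable_on_mult_right integral_mult_right simp_thms)
  also have "\<dots> = integral {1/2..3/2} (\<lambda>u. f u * of_real u powr a * cos (of_real ((Y * u) powr (1 / D)) + k * pi))"
    unfolding cosx by (intro integral_cong) (simp add: algebra_simps)
  finally show "(LBINT t. mell f (Complex (- c) t) * of_real Y powr (Complex (- c) t) * (Gamma (W t) * cos (pi/2 * W t + k * pi))) =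
    2 * pi / D * of_real Y powr (1 + a) *
    integral {1/2..3/2} (\<lambda>u. f u * of_real u powr a * cos (of_real ((Y * u) powr (1 / D)) + k * pi))" .
qed

end

end

subsection \<open>Integrals against the weight\<close>

locale smooth_weight =
  fixes \<phi>0 :: "real \<Rightarrow> real"
  assumes smooth: "\<And>n x. ((deriv ^^ n) \<phi>0) differentiable (at x)"
    and supp0: "\<And>u. \<phi>0 u \<noteq> 0 \<Longrightarrow> u \<in> {-1..1}"
begin

definition dp :: "nat \<Rightarrow> real \<Rightarrow> real" where "dp j = (deriv ^^ j) \<phi>0"

lemma dp_deriv: "(dp j has_real_derivative dp (Suc j) x) (at x)"
proof -
  have "dp j differentiable (at x)" unfolding dp_def by (rule smooth)
  then have "dp j field_differentiable at x"
    by (simp add: field_differentiable_def real_differentiable_def)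
  then have "(dp j has_real_derivative deriv (dp j) x) (at x)" by (rule field_differentiable_derivI)
  then show ?thesis by (simp add: dp_def)
qed

lemma dp_cont [continuous_intros]: "continuous_on S g \<Longrightarrow> continuous_on S (\<lambda>x. dp j (g x))"
  by (rule continuous_on_compose2[of UNIV])
     (auto intro!: continuous_at_imp_continuous_on DERIV_isCont dp_deriv)

lemma dp_supp: "\<bar>u\<bar> > 1 \<Longrightarrow> dp j u = 0"
proof (induction j arbitrary: u)
  case 0
  then have "u \<notin> {-1..1}" by auto
  then show ?case using supp0[of u] by (auto simp: dp_def)
next
  case (Suc j)
  \<comment> \<open>The strict inequality describes an open set, so the vanishing of
    \<open>dp j\<close> around u passes to its derivative.\<close>
  have "eventually (\<lambda>x. x \<in> {x. \<bar>x\<bar> > (1::real)}) (nhds u)"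
    using Suc.prems by (intro eventually_nhds_in_open open_Collect_less continuous_intros) auto
  then have "eventually (\<lambda>x. dp j x = 0) (nhds u)"
    by eventually_elim (use Suc.IH in auto)
  then have "deriv (dp j) u = deriv (\<lambda>_. 0) u" by (intro deriv_cong_ev) auto
  then show ?case by (simp add: dp_def)
qed

lemma dp_bounded: obtains B where "B \<ge> 0" "\<And>u. \<bar>dp j u\<bar> \<le> B"
proof -
  have "compact (dp j ` {-1..1})" by (intro compact_continuous_image continuous_intros) auto
  then have "bounded (dp j ` {-1..1})" by (rule compact_imp_bounded)
  then obtain B where B: "\<forall>x\<in>dp j ` {-1..1}. \<bar>x\<bar> \<le> B" by (auto simp: bounded_iff)
  have "\<bar>dp j u\<bar> \<le> max B 0" for u
  proof (cases "\<bar>u\<bar> > 1")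
    case False
    then have "u \<in> {-1..1}" by auto
    then have "\<bar>dp j u\<bar> \<le> B" using B by blast
    then show ?thesis by simp
  qed (simp add: dp_supp)
  then show ?thesis using that[of "max B 0"] by auto
qed

lemma weight_zero:
  assumes "L > 2" "u \<notin> {1 - 1/L..1 + 1/L}"
  shows "dp j ((u - 1) * L) = 0"
proof (rule dp_supp)
  have "\<bar>u - 1\<bar> > 1 / L" using assms(2) unfolding atLeastAtMost_iff by linarith
  then have "\<bar>u - 1\<bar> * L > 1" using assms(1) by (simp add: divide_less_eq)
  then show "\<bar>(u - 1) * L\<bar> > 1" using assms(1) by (simp only: abs_mult abs_of_pos)
qed

text \<open>For L > 2 the support lies strictly inside (1/2, 3/2); in particular the weight vanishes
  at both end points, which removes the boundary terms in all integrations by parts below.\<close>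

lemma weight_zero':
  assumes "L > 2" "\<not> (1/2 < u \<and> u < 3/2)"
  shows "dp j ((u - 1) * L) = 0"
proof (rule weight_zero[OF assms(1)])
  have "1 / L < 1/2" using assms by (simp add: field_simps)
  then show "u \<notin> {1 - 1/L..1 + 1/L}" using assms(2) unfolding atLeastAtMost_iff by linarith
qed

text \<open>The support of the rescaled weight has length 2/L. This is the source of every factor
  1/L in the estimates that follow.\<close>

lemma weight_integral_bound:
  fixes g :: "real \<Rightarrow> complex"
  assumes L: "L > 2" and g: "continuous_on {1/2..3/2} g" "\<And>u. u \<in> {1/2..3/2} \<Longrightarrow> cmod (g u) \<le> G"
    and B: "\<And>u. \<bar>dp j u\<bar> \<le> B"
  shows "cmod (integral {1/2..3/2} (\<lambda>u. of_real (dp j ((u - 1) * L)) * g u)) \<le> 2 * B * G / L"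
proof -
  have L2: "1 / L < 1/2" "1 / L > 0" using L by (auto simp: field_simps)
  have sub: "{1 - 1/L..1 + 1/L} \<subseteq> {1/2..3/2}" using L2 by auto
  have "integral {1/2..3/2} (\<lambda>u. of_real (dp j ((u - 1) * L)) * g u) =
      integral {1/2..3/2} (\<lambda>u. if u \<in> {1 - 1/L..1 + 1/L} then of_real (dp j ((u - 1) * L)) * g u else 0)"
    using weight_zero[OF L] by (intro integral_cong) auto
  also have "\<dots> = integral {1 - 1/L..1 + 1/L} (\<lambda>u. of_real (dp j ((u - 1) * L)) * g u)"
    unfolding integral_restrict_Int by (simp only: Int_absorb1[OF sub] Int_absorb2[OF sub])
  also have "cmod \<dots> \<le> B * G * (1 + 1/L - (1 - 1/L))"
  proof (rule integral_bound)
    show "continuous_on {1 - 1/L..1 + 1/L} (\<lambda>u. of_real (dp j ((u - 1) * L)) * g u)"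
      by (intro continuous_intros continuous_on_subset[OF g(1) sub])
    fix u assume "u \<in> {1 - 1/L..1 + 1/L}"
    then have "u \<in> {1/2..3/2}" using sub by blast
    from g(2)[OF this] B[of "(u - 1) * L"]
    show "cmod (of_real (dp j ((u - 1) * L)) * g u) \<le> B * G"
      by (auto simp: norm_mult intro!: mult_mono order_trans[OF abs_ge_zero B])
  qed (use L2 in auto)
  also have "B * G * (1 + 1/L - (1 - 1/L)) = 2 * B * G / L" by simp
  finally show ?thesis .
qed

section \<open>Mellin transforms of the weight and its derivatives\<close>

definition mel :: "real \<Rightarrow> nat \<Rightarrow> complex \<Rightarrow> complex" where
  "mel L j s = integral {1/2..3/2} (\<lambda>u. of_real (dp j ((u - 1) * L)) * of_real u powr (s - 1))"

lemma norm_powr_half_bound: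
  assumes "u \<in> {1/2..3/2}"
  shows "cmod (of_real u powr z) \<le> 2 powr \<bar>Re z\<bar>"
proof -
  have u: "u > 0" using assms by auto
  have l: "\<bar>ln u\<bar> \<le> ln 2"
  proof -
    have "ln u \<le> ln 2" using u assms by (subst ln_le_cancel_iff) auto
    moreover have "ln (1/2) \<le> ln u" using u assms by (subst ln_le_cancel_iff) auto
    ultimately show ?thesis by (simp add: ln_div abs_if)
  qed
  have "Re z * ln u \<le> \<bar>Re z\<bar> * \<bar>ln u\<bar>" by (metis abs_ge_self abs_mult)
  also have "\<dots> \<le> \<bar>Re z\<bar> * ln 2" using l by (intro mult_left_mono) auto
  finally show ?thesis using u by (simp add: norm_powr_real_powr powr_def)
qed

text \<open>Integration by parts of \<open>of_real u powr s\<close> against the weight: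
  differentiating the weight brings out L and leaves the power u^s, which is the kernel at s +
  1.\<close>

lemma mel_recurrence:
  assumes "L > 2"
  shows "s * mel L j s = - of_real L * mel L (Suc j) (s + 1)"
proof -
  let ?F = "\<lambda>u. complex_of_real (dp j ((u - 1) * L)) * of_real u powr s"
  let ?F1 = "\<lambda>u. complex_of_real (dp (Suc j) ((u - 1) * L)) * of_real u powr s"
  let ?F2 = "\<lambda>u. complex_of_real (dp j ((u - 1) * L)) * of_real u powr (s - 1)"
  have d: "(?F has_vector_derivative (of_real L * ?F1 u + s * ?F2 u)) (at u within {1/2..3/2})"
    if "u \<in> {1/2..3/2}" for u
  proof -
    have u: "u > 0" using that by auto
    have "((\<lambda>u. dp j ((u - 1) * L)) has_real_derivative dp (Suc j) ((u - 1) * L) * L) (at u within {1/2..3/2})"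
      by (intro DERIV_chain2[where f = "dp j" and g = "\<lambda>u. (u - 1) * L"] DERIV_subset[OF dp_deriv subset_UNIV]) (auto intro!: derivative_eq_intros)
    then have 1: "((\<lambda>u. complex_of_real (dp j ((u - 1) * L))) has_vector_derivative of_real (dp (Suc j) ((u - 1) * L) * L)) (at u within {1/2..3/2})"
      unfolding has_real_derivative_iff_has_vector_derivative by (rule bounded_linear.has_vector_derivative[OF bounded_linear_of_real])
    have 2: "((\<lambda>u. complex_of_real u powr s) has_vector_derivative (s * of_real u powr (s - 1))) (at u within {1/2..3/2})"
    proof -
      have "((\<lambda>z. z powr s) has_field_derivative (s * of_real u powr (s - 1))) (at (of_real u))"
        using u by (intro has_field_derivative_powr) (auto simp: complex_nonpos_Reals_iff)
      from has_vector_derivative_real_field[OF this]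
      show ?thesis by (rule has_vector_derivative_at_within)
    qed
    show ?thesis
      using has_vector_derivative_mult[OF 1 2]
      by (simp add: algebra_simps)
  qed
  have "((\<lambda>u. of_real L * ?F1 u + s * ?F2 u) has_integral (?F (3/2) - ?F (1/2))) {1/2..3/2}"
    by (rule fundamental_theorem_of_calculus) (use d in auto)
  note hi = this
  have f0: "?F (3/2) = 0" "?F (1/2) = 0"
    using weight_zero'[OF assms, of "3/2" j] weight_zero'[OF assms, of "1/2" j] by auto
  have 0: "integral {1/2..3/2} (\<lambda>u. of_real L * ?F1 u + s * ?F2 u) = 0"
    by (rule integral_unique[OF hi, unfolded f0 diff_self])
  have i: "?F1 integrable_on {1/2..3/2}" "?F2 integrable_on {1/2..3/2}"
    by (intro integrable_continuous_real continuous_intros; auto)+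
  have "integral {1/2..3/2} (\<lambda>u. of_real L * ?F1 u + s * ?F2 u) = of_real L * mel L (Suc j) (s + 1) + s * mel L j s"
    unfolding mel_def using i
    by (subst integral_add) (simp_all only: integrable_on_mult_right integral_mult_right simp_thms add_diff_cancel_right')
  then show ?thesis using 0 by (simp add: add_eq_0_iff2 add.commute)
qed

text \<open>Each use of \<open>mel_recurrence\<close> gains L/|t|, starting from the trivial bound
  of order 1/L. The induction leaves j and \<sigma> free because each step passes to the next
  derivative and to the line at \<sigma> + 1.\<close>

lemma mel_bound:
  "\<exists>C\<ge>0. \<forall>L>2. \<forall>t. t \<noteq> 0 \<longrightarrow> cmod (mel L j (Complex \<sigma> t)) \<le> C / L * (L / \<bar>t\<bar>) ^ N"
proof (induction N arbitrary: j \<sigma>)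
  case 0
  obtain B where B: "B \<ge> 0" "\<And>u. \<bar>dp j u\<bar> \<le> B" using dp_bounded by blast
  have "cmod (mel L j (Complex \<sigma> t)) \<le> 2 * B * 2 powr \<bar>\<sigma> - 1\<bar> / L" if "L > 2" for L t
    unfolding mel_def
  proof (rule weight_integral_bound[OF that _ _ B(2)])
    show "cmod (of_real u powr (Complex \<sigma> t - 1)) \<le> 2 powr \<bar>\<sigma> - 1\<bar>" if "u \<in> {1/2..3/2}" for u
      using norm_powr_half_bound[OF that, of "Complex \<sigma> t - 1"] by simp
  qed (intro continuous_intros; auto)
  then show ?case using B by (intro exI[of _ "2 * B * 2 powr \<bar>\<sigma> - 1\<bar>"]) auto
next
  case (Suc N)
  obtain C where C: "C \<ge> 0" "\<And>L t. L > 2 \<Longrightarrow> t \<noteq> 0 \<Longrightarrow> cmod (mel L (Suc j) (Complex (\<sigma> + 1) t)) \<le> C / L * (L / \<bar>t\<bar>) ^ N"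
    using Suc[of "Suc j" "\<sigma> + 1"] by blast
  have "cmod (mel L j (Complex \<sigma> t)) \<le> C / L * (L / \<bar>t\<bar>) ^ Suc N" if L: "L > 2" and t: "t \<noteq> 0" for L t
  proof -
    have s1: "Complex \<sigma> t + 1 = Complex (\<sigma> + 1) t" by (simp add: complex_eq_iff)
    have ts: "\<bar>t\<bar> \<le> cmod (Complex \<sigma> t)" using abs_Im_le_cmod[of "Complex \<sigma> t"] by simp
    have "\<bar>t\<bar> * cmod (mel L j (Complex \<sigma> t)) \<le> cmod (Complex \<sigma> t * mel L j (Complex \<sigma> t))"
      unfolding norm_mult using ts by (intro mult_right_mono) auto
    also have "\<dots> = L * cmod (mel L (Suc j) (Complex (\<sigma> + 1) t))"
      unfolding mel_recurrence[OF L] s1 norm_mult using L by simp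
    also have "\<dots> \<le> L * (C / L * (L / \<bar>t\<bar>) ^ N)" using C(2)[OF L t] L by (intro mult_left_mono) auto
    finally have "cmod (mel L j (Complex \<sigma> t)) \<le> L * (C / L * (L / \<bar>t\<bar>) ^ N) / \<bar>t\<bar>"
      using t by (simp add: le_divide_eq mult.commute)
    then show ?thesis by (simp add: mult_ac)
  qed
  then show ?case using C(1) by blast
qed

section \<open>Oscillatory integrals against the weight\<close>

definition osc :: "real \<Rightarrow> real \<Rightarrow> real \<Rightarrow> nat \<Rightarrow> complex \<Rightarrow> real \<Rightarrow> complex" where
  "osc sg \<rho> L j \<beta> Z = integral {1/2..3/2} (\<lambda>u. of_real (dp j ((u - 1) * L)) *
     (of_real u powr \<beta> * exp (of_real sg * \<i> * of_real ((Z * u) powr \<rho>))))"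

text \<open>The derivative of the phase is
  \<open>\<rho> * Z powr \<rho> * u powr (\<rho> - 1)\<close>; an integration by parts starting from
  the exponent \<beta> + 1 - \<rho> therefore restores \<open>u powr \<beta>\<close>, the integrand
  to be estimated.\<close>

lemma osc_recurrence:
  assumes L: "L > 2" and Z: "Z > 0"
  shows "of_real sg * \<i> * of_real (\<rho> * Z powr \<rho>) * osc sg \<rho> L j \<beta> Z =
     - (of_real L * osc sg \<rho> L (Suc j) (\<beta> + 1 - of_real \<rho>) Z) - (\<beta> + 1 - of_real \<rho>) * osc sg \<rho> L j (\<beta> - of_real \<rho>) Z"
proof -
  define E where "E = (\<lambda>u. exp (of_real sg * \<i> * complex_of_real ((Z * u) powr \<rho>)))"
  let ?b = "\<beta> + 1 - of_real \<rho>"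
  let ?F = "\<lambda>u. complex_of_real (dp j ((u - 1) * L)) * (of_real u powr ?b * E u)"
  let ?F1 = "\<lambda>u. complex_of_real (dp (Suc j) ((u - 1) * L)) * (of_real u powr ?b * E u)"
  let ?F2 = "\<lambda>u. complex_of_real (dp j ((u - 1) * L)) * (of_real u powr (\<beta> - of_real \<rho>) * E u)"
  let ?F3 = "\<lambda>u. complex_of_real (dp j ((u - 1) * L)) * (of_real u powr \<beta> * E u)"
  let ?k = "of_real sg * \<i> * of_real (\<rho> * Z powr \<rho>)"
  have d: "(?F has_vector_derivative (of_real L * ?F1 u + ?b * ?F2 u + ?k * ?F3 u)) (at u within {1/2..3/2})"
    if "u \<in> {1/2..3/2}" for u
  proof -
    have u: "u > 0" using that by auto
    have "((\<lambda>u. dp j ((u - 1) * L)) has_real_derivative dp (Suc j) ((u - 1) * L) * L) (at u within {1/2..3/2})"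
      by (intro DERIV_chain2[where f = "dp j" and g = "\<lambda>u. (u - 1) * L"] DERIV_subset[OF dp_deriv subset_UNIV]) (auto intro!: derivative_eq_intros)
    then have 1: "((\<lambda>u. complex_of_real (dp j ((u - 1) * L))) has_vector_derivative of_real (dp (Suc j) ((u - 1) * L) * L)) (at u within {1/2..3/2})"
      unfolding has_real_derivative_iff_has_vector_derivative by (rule bounded_linear.has_vector_derivative[OF bounded_linear_of_real])
    have 2: "((\<lambda>u. complex_of_real u powr ?b) has_vector_derivative (?b * of_real u powr (?b - 1))) (at u within {1/2..3/2})"
    proof -
      have "((\<lambda>z. z powr ?b) has_field_derivative (?b * of_real u powr (?b - 1))) (at (of_real u))"
        using u by (intro has_field_derivative_powr) (auto simp: complex_nonpos_Reals_iff)
      from has_vector_derivative_real_field[OF this]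
      show ?thesis by (rule has_vector_derivative_at_within)
    qed
    have 3: "(E has_vector_derivative (?k * of_real (u powr (\<rho> - 1)) * E u)) (at u within {1/2..3/2})"
    proof -
      have "((\<lambda>u. (Z * u) powr \<rho>) has_real_derivative \<rho> * Z powr \<rho> * u powr (\<rho> - 1)) (at u within {1/2..3/2})"
        using u Z by (auto intro!: derivative_eq_intros simp: powr_diff powr_mult field_simps)
      then have "((\<lambda>u. complex_of_real ((Z * u) powr \<rho>)) has_vector_derivative of_real (\<rho> * Z powr \<rho> * u powr (\<rho> - 1))) (at u within {1/2..3/2})"
        unfolding has_real_derivative_iff_has_vector_derivative by (rule bounded_linear.has_vector_derivative[OF bounded_linear_of_real])
      then have "((\<lambda>u. of_real sg * \<i> * complex_of_real ((Z * u) powr \<rho>)) has_vector_derivative (of_real sg * \<i> * of_real (\<rho> * Z powr \<rho> * u powr (\<rho> - 1)))) (at u within {1/2..3/2})"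
        by (rule has_vector_derivative_mult_right)
      from field_vector_diff_chain_within[OF this, of exp "E u"]
      show ?thesis unfolding E_def o_def
        by (simp add: mult_ac DERIV_exp[THEN has_field_derivative_at_within])
    qed
    have e: "of_real u powr ?b * of_real (u powr (\<rho> - 1)) = complex_of_real u powr \<beta>"
    proof -
      have "complex_of_real (u powr (\<rho> - 1)) = of_real u powr (of_real \<rho> - 1)"
        using powr_of_real[of u "\<rho> - 1"] u by simp
      then show ?thesis using u powr_add[of "of_real u" ?b "of_real \<rho> - 1"] by simp
    qed
    have b1: "?b - 1 = \<beta> - of_real \<rho>" by simp
    have "(?F has_vector_derivative (complex_of_real (dp j ((u - 1) * L)) * (of_real u powr ?b * (?k * of_real (u powr (\<rho> - 1)) * E u) + ?b * of_real u powr (?b - 1) * E u)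
        + of_real (dp (Suc j) ((u - 1) * L) * L) * (of_real u powr ?b * E u))) (at u within {1/2..3/2})"
      by (rule has_vector_derivative_mult[OF 1 has_vector_derivative_mult[OF 2 3]])
    moreover have "of_real u powr ?b * (?k * of_real (u powr (\<rho> - 1)) * E u) = ?k * (of_real u powr \<beta> * E u)"
      unfolding e[symmetric] by (simp only: mult_ac)
    ultimately show ?thesis unfolding b1 by (simp only: of_real_mult) (simp add: algebra_simps)
  qed
  have "((\<lambda>u. of_real L * ?F1 u + ?b * ?F2 u + ?k * ?F3 u) has_integral (?F (3/2) - ?F (1/2))) {1/2..3/2}"
    by (rule fundamental_theorem_of_calculus) (use d in auto)
  note hi = this
  have f0: "?F (3/2) = 0" "?F (1/2) = 0"
    using weight_zero'[OF L, of "3/2" j] weight_zero'[OF L, of "1/2" j] by auto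
  have 0: "integral {1/2..3/2} (\<lambda>u. of_real L * ?F1 u + ?b * ?F2 u + ?k * ?F3 u) = 0"
    by (rule integral_unique[OF hi, unfolded f0 diff_self])
  have i: "?F1 integrable_on {1/2..3/2}" "?F2 integrable_on {1/2..3/2}" "?F3 integrable_on {1/2..3/2}"
    unfolding E_def using Z by (intro integrable_continuous_real continuous_intros; auto)+
  have "integral {1/2..3/2} (\<lambda>u. of_real L * ?F1 u + ?b * ?F2 u + ?k * ?F3 u) =
      of_real L * integral {1/2..3/2} ?F1 + ?b * integral {1/2..3/2} ?F2 + ?k * integral {1/2..3/2} ?F3"
    using i by (simp only: integral_add integrable_add integrable_on_mult_right integral_mult_right)
  then show ?thesis using 0 unfolding osc_def E_def by (simp add: algebra_simps add_eq_0_iff2)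
qed

text \<open>Each integration by parts gains \<open>L / Z powr \<rho>\<close>: differentiating the
  weight costs L, while differentiating the power of u costs only a constant, which L > 2 covers.
  With Z = h mu_n x and L of order x powr \<rho> the gain is a constant times mu_n powr (- \<rho>),
  so a large N makes the sum over n converge.\<close>

lemma osc_bound:
  assumes \<rho>: "\<rho> > 0" and sg: "\<bar>sg\<bar> = 1"
  shows "\<exists>C\<ge>0. \<forall>L>2. \<forall>Z>0. cmod (osc sg \<rho> L j \<beta> Z) \<le> C / L * (L / Z powr \<rho>) ^ N"
proof (induction N arbitrary: j \<beta>)
  case 0
  obtain B where B: "B \<ge> 0" "\<And>u. \<bar>dp j u\<bar> \<le> B" using dp_bounded by blast
  have "cmod (osc sg \<rho> L j \<beta> Z) \<le> 2 * B * 2 powr \<bar>Re \<beta>\<bar> / L" if "L > 2" "Z > 0" for L Z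
    unfolding osc_def
  proof (rule weight_integral_bound[OF that(1) _ _ B(2)])
    show "cmod (of_real u powr \<beta> * exp (of_real sg * \<i> * of_real ((Z * u) powr \<rho>))) \<le> 2 powr \<bar>Re \<beta>\<bar>" if "u \<in> {1/2..3/2}" for u
      using norm_powr_half_bound[OF that, of \<beta>] by (simp add: norm_mult)
  qed (use that in \<open>intro continuous_intros; auto\<close>)
  then show ?case using B by (intro exI[of _ "2 * B * 2 powr \<bar>Re \<beta>\<bar>"]) auto
next
  case (Suc N)
  let ?b = "\<beta> + 1 - of_real \<rho>"
  obtain C1 where C1: "C1 \<ge> 0" "\<And>L Z. L > 2 \<Longrightarrow> Z > 0 \<Longrightarrow> cmod (osc sg \<rho> L (Suc j) ?b Z) \<le> C1 / L * (L / Z powr \<rho>) ^ N"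
    using Suc[of "Suc j" ?b] by blast
  obtain C2 where C2: "C2 \<ge> 0" "\<And>L Z. L > 2 \<Longrightarrow> Z > 0 \<Longrightarrow> cmod (osc sg \<rho> L j (\<beta> - of_real \<rho>) Z) \<le> C2 / L * (L / Z powr \<rho>) ^ N"
    using Suc[of j "\<beta> - of_real \<rho>"] by blast
  define C where "C = (C1 + cmod ?b * C2) / \<rho>"
  have "cmod (osc sg \<rho> L j \<beta> Z) \<le> C / L * (L / Z powr \<rho>) ^ Suc N" if L: "L > 2" and Z: "Z > 0" for L Z
  proof -
    define q where "q = (L / Z powr \<rho>) ^ N"
    have q: "q \<ge> 0" using L by (simp add: q_def)
    have zp: "Z powr \<rho> > 0" using Z by simp
    have "cmod (of_real sg * \<i> * of_real (\<rho> * Z powr \<rho>) * osc sg \<rho> L j \<beta> Z) = \<rho> * Z powr \<rho> * cmod (osc sg \<rho> L j \<beta> Z)"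
      using \<rho> sg by (simp add: norm_mult)
    then have "\<rho> * Z powr \<rho> * cmod (osc sg \<rho> L j \<beta> Z) = cmod (- (of_real L * osc sg \<rho> L (Suc j) ?b Z) - ?b * osc sg \<rho> L j (\<beta> - of_real \<rho>) Z)"
      unfolding osc_recurrence[OF L Z] by simp
    also have "\<dots> \<le> cmod (of_real L * osc sg \<rho> L (Suc j) ?b Z) + cmod (?b * osc sg \<rho> L j (\<beta> - of_real \<rho>) Z)"
      by (rule order_trans[OF norm_triangle_ineq4]) (simp only: norm_minus_cancel order_refl)
    also have "\<dots> \<le> L * (C1 / L * q) + cmod ?b * (C2 / L * q)"
      unfolding norm_mult q_def using C1(2)[OF L Z] C2(2)[OF L Z] L by (intro add_mono mult_mono) auto
    also have "\<dots> \<le> L * (C1 / L * q) + cmod ?b * (C2 * q)"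
    proof -
      have "C2 / L \<le> C2" using L C2(1) by (simp add: divide_le_eq mult_le_cancel_left1)
      then show ?thesis using q by (intro add_left_mono mult_left_mono mult_right_mono) auto
    qed
    also have "\<dots> = (\<rho> * C) * q" using L \<rho> unfolding C_def by (simp add: distrib_right)
    finally have "\<rho> * (Z powr \<rho> * cmod (osc sg \<rho> L j \<beta> Z)) \<le> \<rho> * (C * q)" by (simp add: mult_ac)
    then have "Z powr \<rho> * cmod (osc sg \<rho> L j \<beta> Z) \<le> C * q" using \<rho> by simp
    then have "cmod (osc sg \<rho> L j \<beta> Z) \<le> C * q / Z powr \<rho>" using zp by (simp add: le_divide_eq mult.commute)
    also have "\<dots> = C / L * (L / Z powr \<rho> * q)" using L by simp
    finally show ?thesis by (simp add: q_def)
  qed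
  moreover have "C \<ge> 0" using C1 C2 \<rho> by (simp add: C_def)
  ultimately show ?case by blast
qed

end

subsection \<open>Expansion of the quotient of gamma factors\<close>

lemma exp_decay_le:
  fixes \<kappa> :: real
  assumes "\<kappa> > 0"
  obtains C where "C > 0" "\<And>t. t \<ge> 0 \<Longrightarrow> exp (- \<kappa> * t) \<le> C / (1 + t)^2"
proof -
  \<comment> \<open>This m satisfies m (1 + t) <= 1 + \<kappa> t / 2 <= exp (\<kappa> t / 2);
    squaring gives the claim.\<close>
  define m where "m = min 1 (\<kappa> / 2)"
  have m: "m > 0" "m \<le> 1" "m \<le> \<kappa> / 2" using assms by (auto simp: m_def)
  have "exp (- \<kappa> * t) \<le> 1 / m^2 / (1 + t)^2" if t: "t \<ge> 0" for t
  proof -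
    have "m * t \<le> \<kappa> / 2 * t" using m t by (intro mult_right_mono) auto
    then have "m * (1 + t) \<le> 1 + \<kappa> * t / 2" using m by (simp add: distrib_left)
    also have "\<dots> \<le> exp (\<kappa> * t / 2)" using exp_ge_add_one_self[of "\<kappa> * t / 2"] by simp
    finally have "(m * (1 + t))^2 \<le> (exp (\<kappa> * t / 2))^2"
      using m t by (intro power_mono) auto
    also have "(exp (\<kappa> * t / 2))^2 = exp (\<kappa> * t)" by (simp add: power2_eq_square exp_add[symmetric])
    finally have *: "m^2 * (1 + t)^2 \<le> exp (\<kappa> * t)" by (simp add: power_mult_distrib)
    have "exp (- \<kappa> * t) = 1 / exp (\<kappa> * t)" by (simp add: exp_minus divide_inverse)
    also have "\<dots> \<le> 1 / (m^2 * (1 + t)^2)"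
      using * m t by (intro divide_left_mono) (auto intro!: mult_pos_pos zero_less_power)
    finally show ?thesis by simp
  qed
  then show ?thesis using that[of "1 / m^2"] m by auto
qed

lemma prod_one_minus_bound:
  fixes e :: "nat \<Rightarrow> real \<Rightarrow> complex"
  assumes "\<And>\<nu>. \<nu> < d \<Longrightarrow> \<exists>C. \<forall>t. cmod (e \<nu> t) \<le> C / (1 + \<bar>t\<bar>)^2"
  shows "\<exists>C. \<forall>t. cmod ((\<Prod>\<nu><d. 1 - e \<nu> t) - 1) \<le> C / (1 + \<bar>t\<bar>)^2"
  using assms
proof (induction d)
  case 0
  show ?case by (intro exI[of _ 0]) auto
next
  case (Suc d)
  then obtain C1 where C1: "\<And>t. cmod ((\<Prod>\<nu><d. 1 - e \<nu> t) - 1) \<le> C1 / (1 + \<bar>t\<bar>)^2" by (meson less_Suc_eq)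
  obtain C2 where C2: "\<And>t. cmod (e d t) \<le> C2 / (1 + \<bar>t\<bar>)^2" using Suc.prems by blast
  have C12: "C1 \<ge> 0" "C2 \<ge> 0" using C1[of 0] C2[of 0] by (auto intro: order_trans[OF norm_ge_zero])
  have "cmod ((\<Prod>\<nu><Suc d. 1 - e \<nu> t) - 1) \<le> (C1 * (1 + C2) + C2) / (1 + \<bar>t\<bar>)^2" for t
  proof -
    have v: "C2 / (1 + \<bar>t\<bar>)^2 \<le> C2"
      using C12 by (simp add: divide_le_eq mult_le_cancel_left1)
    have "cmod (1 - e d t) \<le> 1 + C2" using norm_triangle_ineq4[of 1 "e d t"] C2[of t] v by simp
    moreover have "(\<Prod>\<nu><Suc d. 1 - e \<nu> t) - 1 = ((\<Prod>\<nu><d. 1 - e \<nu> t) - 1) * (1 - e d t) - e d t"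
      by (simp add: algebra_simps)
    then have "cmod ((\<Prod>\<nu><Suc d. 1 - e \<nu> t) - 1) \<le> cmod ((\<Prod>\<nu><d. 1 - e \<nu> t) - 1) * cmod (1 - e d t) + cmod (e d t)"
      by (metis norm_triangle_ineq4 norm_mult)
    ultimately have "cmod ((\<Prod>\<nu><Suc d. 1 - e \<nu> t) - 1) \<le> C1 / (1 + \<bar>t\<bar>)^2 * (1 + C2) + C2 / (1 + \<bar>t\<bar>)^2"
      using C1[of t] C2[of t] C12 by (smt (verit) mult_mono norm_ge_zero)
    then show ?thesis by (simp add: add_divide_distrib)
  qed
  then show ?case by blast
qed

text \<open>Factors out the exponential that dominates when sg is the sign of Im z; the remaining
  bracket is then 1 up to an exponentially small term.\<close>

lemma two_sin_eq:
  fixes z :: complex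
  assumes "sg = 1 \<or> sg = - 1"
  shows "2 * sin (pi * z) = of_real sg * \<i> * exp (- of_real sg * \<i> * pi * z) * (1 - exp (2 * of_real sg * \<i> * pi * z))"
proof -
  have "exp (- of_real sg * \<i> * pi * z) * exp (2 * of_real sg * \<i> * pi * z) = exp (of_real sg * \<i> * pi * z)"
    unfolding exp_add[symmetric] by (rule arg_cong[of _ _ exp]) (simp add: algebra_simps)
  then have "of_real sg * \<i> * exp (- of_real sg * \<i> * pi * z) * (1 - exp (2 * of_real sg * \<i> * pi * z)) =
     of_real sg * \<i> * (exp (- of_real sg * \<i> * pi * z) - exp (of_real sg * \<i> * pi * z))"
    by (simp add: algebra_simps)
  also have "\<dots> = 2 * sin (pi * z)" using assms by (auto simp: sin_exp_eq field_simps)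
  finally show ?thesis by simp
qed

lemma exp_half_pi_nat: "exp (of_real sg * \<i> * pi * of_nat d / 2) = (of_real sg * \<i>) ^ d" if "sg = 1 \<or> sg = - 1"
proof -
  have "exp (of_real sg * \<i> * pi / 2) = of_real sg * \<i>"
    using that by (auto simp: exp_eq_polar complex_eq_iff Re_exp Im_exp)
  then have "(of_real sg * \<i>) ^ d = exp (of_real sg * \<i> * pi / 2) ^ d" by simp
  also have "\<dots> = exp (of_nat d * (of_real sg * \<i> * pi / 2))" by (rule exp_of_nat_mult[symmetric])
  finally show ?thesis by (simp add: mult_ac)
qed

lemma two_cos_eq:
  fixes S :: complex
  assumes "sg = 1 \<or> sg = - 1"
  shows "2 * cos (pi * (S - of_nat d / 2)) = (of_real sg * \<i>)^d * exp (- of_real sg * \<i> * pi * S) * (1 + exp (2 * of_real sg * \<i> * pi * (S - of_nat d / 2)))"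
proof -
  let ?x = "of_real sg * \<i> * pi * (S - of_nat d / 2)"
  have "(of_real sg * \<i>)^d * exp (- of_real sg * \<i> * pi * S) = exp (- ?x)"
    unfolding exp_half_pi_nat[OF assms, symmetric] exp_add[symmetric] by (rule arg_cong[of _ _ exp]) (simp add: algebra_simps)
  then have "(of_real sg * \<i>)^d * exp (- of_real sg * \<i> * pi * S) * (1 + exp (2 * of_real sg * \<i> * pi * (S - of_nat d / 2)))
     = exp (- ?x) + exp (- ?x) * exp (2 * ?x)" by (simp add: algebra_simps)
  also have "exp (- ?x) * exp (2 * ?x) = exp ?x"
    unfolding exp_add[symmetric] by (rule arg_cong[of _ _ exp]) simp
  finally have "(of_real sg * \<i>)^d * exp (- of_real sg * \<i> * pi * S) * (1 + exp (2 * of_real sg * \<i> * pi * (S - of_nat d / 2)))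
     = exp (- ?x) + exp ?x" .
  moreover have "2 * cos y = exp (\<i> * y) + exp (- (\<i> * y))" for y :: complex by (simp add: cos_exp_eq)
  then have "2 * cos (pi * (S - of_nat d / 2)) = exp (- ?x) + exp ?x"
    using assms by (auto simp: mult.assoc add.commute)
  ultimately show ?thesis by simp
qed

text \<open>With \<open>sg t\<close> the sign of t, every sine is its dominant exponential times 1
  plus an exponentially small term. The dominant exponentials multiply to \<open>U t\<close>, which
  is also the dominant exponential of 2 cos: the shift by \<open>of_nat d / 2\<close> is there to
  produce the factor (sg i)^d of d sines. Of the exponential decay only the order 2 in t is
  kept.\<close>

lemma sine_product:
  assumes al: "\<And>\<nu>. \<nu> < d \<Longrightarrow> al \<nu> > 0" and d: "d \<ge> 1"
  shows "\<exists>C. \<forall>t. cmod ((\<Prod>\<nu><d. 2 * sin (pi * (of_real (al \<nu>) * Complex \<sigma> t + be \<nu>)))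
      - 2 * cos (pi * (of_real (bigA d al) * Complex \<sigma> t + bigB d be - of_nat d / 2))) \<le> C * exp (pi * bigA d al * \<bar>t\<bar>) / (1 + \<bar>t\<bar>)^2"
    and "\<exists>C. \<forall>t. cmod (2 * cos (pi * (of_real (bigA d al) * Complex \<sigma> t + bigB d be - of_nat d / 2))) \<le> C * exp (pi * bigA d al * \<bar>t\<bar>)"
proof -
  define A where "A = bigA d al"
  have A: "A > 0" unfolding A_def bigA_def using al d by (intro sum_pos) (auto simp: lessThan_empty_iff)
  define sg where "sg = (\<lambda>t::real. if t \<ge> 0 then 1 else - 1 :: real)"
  have sg: "sg t = 1 \<or> sg t = -1" "sg t * t = \<bar>t\<bar>" for t by (auto simp: sg_def)
  define z where "z = (\<lambda>\<nu> t. of_real (al \<nu>) * Complex \<sigma> t + be \<nu>)"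
  define S where "S = (\<lambda>t. of_real A * Complex \<sigma> t + bigB d be)"
  have Sz: "(\<Sum>\<nu><d. z \<nu> t) = S t" for t
    by (simp add: z_def S_def A_def bigA_def bigB_def sum.distrib sum_distrib_right)
  define e where "e = (\<lambda>\<nu> t. exp (2 * of_real (sg t) * \<i> * pi * z \<nu> t))"
  define E where "E = (\<lambda>t. exp (2 * of_real (sg t) * \<i> * pi * (S t - of_nat d / 2)))"
  have sgb: "- (sg t * y) \<le> \<bar>y\<bar>" "sg t * y \<le> \<bar>y\<bar>" for t y using sg(1)[of t] by auto
  have ebound: "\<exists>C. \<forall>t. cmod (exp (2 * of_real (sg t) * \<i> * pi * (of_real k * Complex \<sigma> t + y))) \<le> C / (1 + \<bar>t\<bar>)^2"
    if k: "k > 0" for k y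
  proof -
    obtain C where C: "C > 0" "\<And>t. t \<ge> 0 \<Longrightarrow> exp (- (2 * pi * k) * t) \<le> C / (1 + t)^2"
      using exp_decay_le[of "2 * pi * k"] k by auto
    have "cmod (exp (2 * of_real (sg t) * \<i> * pi * (of_real k * Complex \<sigma> t + y))) \<le> (exp (2 * pi * \<bar>Im y\<bar>) * C) / (1 + \<bar>t\<bar>)^2" for t
    proof -
      have "Re (2 * of_real (sg t) * \<i> * pi * (of_real k * Complex \<sigma> t + y)) = - (2 * pi * k) * (sg t * t) + 2 * pi * (- (sg t * Im y))"
        by (simp add: algebra_simps)
      also have "\<dots> \<le> - (2 * pi * k) * \<bar>t\<bar> + 2 * pi * \<bar>Im y\<bar>"
        unfolding sg(2) using sgb(1)[of t "Im y"] by (intro add_left_mono mult_left_mono) auto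
      finally have "cmod (exp (2 * of_real (sg t) * \<i> * pi * (of_real k * Complex \<sigma> t + y))) \<le> exp (- (2 * pi * k) * \<bar>t\<bar>) * exp (2 * pi * \<bar>Im y\<bar>)"
        unfolding norm_exp_eq_Re exp_add[symmetric] by (simp only: exp_le_cancel_iff)
      also have "\<dots> \<le> (C / (1 + \<bar>t\<bar>)^2) * exp (2 * pi * \<bar>Im y\<bar>)"
        using C(2)[of "\<bar>t\<bar>"] by (intro mult_right_mono) auto
      finally show ?thesis by (simp add: mult_ac)
    qed
    then show ?thesis by blast
  qed
  have "\<exists>C. \<forall>t. cmod (e \<nu> t) \<le> C / (1 + \<bar>t\<bar>)^2" if "\<nu> < d" for \<nu>
    unfolding e_def z_def using ebound[OF al[OF that]] .
  from prod_one_minus_bound[of d e, OF this] obtain C1 where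
    C1: "\<And>t. cmod ((\<Prod>\<nu><d. 1 - e \<nu> t) - 1) \<le> C1 / (1 + \<bar>t\<bar>)^2" by blast
  obtain C2 where C2: "\<And>t. cmod (E t) \<le> C2 / (1 + \<bar>t\<bar>)^2"
    using ebound[OF A, of "bigB d be - of_nat d / 2"] unfolding E_def S_def by (auto simp: add_diff_eq)
  define U where "U = (\<lambda>t. (of_real (sg t) * \<i>)^d * exp (- of_real (sg t) * \<i> * pi * S t))"
  have Ub: "cmod (U t) \<le> exp (pi * \<bar>Im (bigB d be)\<bar>) * exp (pi * A * \<bar>t\<bar>)" for t
  proof -
    have "cmod (of_real (sg t) * \<i>) = 1" using sg(1)[of t] by (auto simp: norm_mult)
    then have "cmod (U t) = exp (Re (- of_real (sg t) * \<i> * pi * S t))" by (simp add: U_def norm_mult norm_power)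
    also have "Re (- of_real (sg t) * \<i> * pi * S t) = pi * A * (sg t * t) + pi * (sg t * Im (bigB d be))"
      by (simp add: S_def algebra_simps)
    also have "\<dots> \<le> pi * A * \<bar>t\<bar> + pi * \<bar>Im (bigB d be)\<bar>"
      unfolding sg(2) using sgb(2) by (intro add_left_mono mult_left_mono) auto
    finally show ?thesis by (simp add: exp_add mult_ac)
  qed
  have P: "(\<Prod>\<nu><d. 2 * sin (pi * z \<nu> t)) = U t * (\<Prod>\<nu><d. 1 - e \<nu> t)" for t
  proof -
    have "(\<Prod>\<nu><d. 2 * sin (pi * z \<nu> t)) = (\<Prod>\<nu><d. of_real (sg t) * \<i>) * (\<Prod>\<nu><d. exp (- of_real (sg t) * \<i> * pi * z \<nu> t)) * (\<Prod>\<nu><d. 1 - e \<nu> t)"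
      unfolding two_sin_eq[OF sg(1)[of t]] e_def prod.distrib by (simp only: mult.assoc)
    also have "(\<Prod>\<nu><d. exp (- of_real (sg t) * \<i> * pi * z \<nu> t)) = exp (- of_real (sg t) * \<i> * pi * S t)"
      by (subst exp_sum[symmetric]) (simp_all add: Sz[symmetric] sum_distrib_left)
    finally show ?thesis by (simp add: U_def)
  qed
  have Cc: "2 * cos (pi * (S t - of_nat d / 2)) = U t * (1 + E t)" for t
    unfolding two_cos_eq[OF sg(1)[of t]] U_def E_def by simp
  have nn: "C1 \<ge> 0" "C2 \<ge> 0" using C1[of 0] C2[of 0] by (auto intro: order_trans[OF norm_ge_zero])
  let ?B = "exp (pi * \<bar>Im (bigB d be)\<bar>)"
  have "cmod ((\<Prod>\<nu><d. 2 * sin (pi * z \<nu> t)) - 2 * cos (pi * (S t - of_nat d / 2))) \<le> (?B * (C1 + C2)) * exp (pi * A * \<bar>t\<bar>) / (1 + \<bar>t\<bar>)^2" for t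
  proof -
    have "(\<Prod>\<nu><d. 2 * sin (pi * z \<nu> t)) - 2 * cos (pi * (S t - of_nat d / 2)) = U t * (((\<Prod>\<nu><d. 1 - e \<nu> t) - 1) - E t)"
      unfolding P Cc by (simp add: algebra_simps)
    then have "cmod ((\<Prod>\<nu><d. 2 * sin (pi * z \<nu> t)) - 2 * cos (pi * (S t - of_nat d / 2))) =
       cmod (U t) * cmod (((\<Prod>\<nu><d. 1 - e \<nu> t) - 1) - E t)" by (simp only: norm_mult)
    also have "\<dots> \<le> (?B * exp (pi * A * \<bar>t\<bar>)) * (C1 / (1 + \<bar>t\<bar>)^2 + C2 / (1 + \<bar>t\<bar>)^2)"
      using Ub[of t] order_trans[OF norm_triangle_ineq4 add_mono[OF C1[of t] C2[of t]]] by (intro mult_mono) auto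
    also have "\<dots> = (?B * (C1 + C2)) * exp (pi * A * \<bar>t\<bar>) / (1 + \<bar>t\<bar>)^2"
      by (simp add: add_divide_distrib[symmetric])
    finally show ?thesis .
  qed
  then show "\<exists>C. \<forall>t. cmod ((\<Prod>\<nu><d. 2 * sin (pi * (of_real (al \<nu>) * Complex \<sigma> t + be \<nu>)))
      - 2 * cos (pi * (of_real (bigA d al) * Complex \<sigma> t + bigB d be - of_nat d / 2))) \<le> C * exp (pi * bigA d al * \<bar>t\<bar>) / (1 + \<bar>t\<bar>)^2"
    unfolding z_def S_def A_def by blast
  have "cmod (2 * cos (pi * (S t - of_nat d / 2))) \<le> (?B * (1 + C2)) * exp (pi * A * \<bar>t\<bar>)" for t
  proof -
    have v: "C2 / (1 + \<bar>t\<bar>)^2 \<le> C2"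
      using nn by (simp add: divide_le_eq mult_le_cancel_left1)
    have "cmod (1 + E t) \<le> 1 + C2" using norm_triangle_ineq[of 1 "E t"] C2[of t] v by simp
    then have "cmod (U t) * cmod (1 + E t) \<le> (?B * exp (pi * A * \<bar>t\<bar>)) * (1 + C2)"
      using Ub[of t] by (intro mult_mono) auto
    then show ?thesis unfolding Cc norm_mult by (simp add: mult_ac)
  qed
  then show "\<exists>C. \<forall>t. cmod (2 * cos (pi * (of_real (bigA d al) * Complex \<sigma> t + bigB d be - of_nat d / 2))) \<le> C * exp (pi * bigA d al * \<bar>t\<bar>)"
    unfolding S_def A_def by blast
qed

section \<open>Reduction of all gamma factors to a single Gamma\<close>

locale gamma_data =
  fixes d :: nat and al :: "nat \<Rightarrow> real" and be bt :: "nat \<Rightarrow> complex"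
  assumes d_pos: "d \<ge> 1" and al_pos: "\<And>\<nu>. \<nu> < d \<Longrightarrow> al \<nu> > 0"
begin

abbreviation "A \<equiv> bigA d al"
abbreviation "a \<equiv> aconst d al be bt"
abbreviation "h \<equiv> hconst d al"
abbreviation "K0 \<equiv> (\<Prod>\<nu><d. complex_of_real (2 * A / al \<nu>) powr (of_real (al \<nu>) + be \<nu> - bt \<nu>))"

lemma A_pos: "A > 0"
  unfolding bigA_def using al_pos d_pos by (intro sum_pos) (auto simp: lessThan_empty_iff)

lemma h_pos: "h > 0"
  unfolding hconst_def
proof (rule prod_pos)
  fix \<nu> assume "\<nu> \<in> {..<d}"
  then have "al \<nu> > 0" using al_pos by simp
  then show "0 < (2 * A / al \<nu>) powr (2 * al \<nu>)" using A_pos by simp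
qed

lemma two_A_a: "2 * of_real A * a = 1/2 + bigB d bt - bigB d be - of_real A"
  using A_pos by (simp add: aconst_def field_simps)

definition "stq b z = Gamma (z + b) / (of_real (sqrt (2 * pi)) * exp ((z + b - 1/2) * Ln z - z))"

lemma Gamma_stq: "Gamma (z + b) = stq b z * (of_real (sqrt (2 * pi)) * exp ((z + b - 1/2) * Ln z - z))"
  by (simp add: stq_def)

text \<open>Reflection replaces each \<open>rGamma\<close> by a Gamma at \<alpha> w + 1 - \<alpha> -
  \<beta> times a sine, so 2d Gammas remain, all in the right half plane and with total slope 2A.
  The shift g = 2A a is the one for which a single Gamma (2A w + g) carries the same power of w;
  this is the origin of the constant a. The leftover logarithms of 2A / \<alpha> collect into
  \<open>h powr (- w)\<close> and \<open>K0\<close>, and R is the quotient of the Stirling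
  corrections, itself of type \<open>asy1\<close>.\<close>

lemma gamma_product:
  "\<exists>R Z0. asy1 R \<and> (\<forall>w. Re w \<ge> Z0 \<longrightarrow> gfac d al bt w * rgfac d al be (1 - w) =
     of_real (1 / sqrt (2 * pi)) * K0 * of_real h powr (- w) * Gamma (of_real (2 * A) * (w + a)) * R w *
     (\<Prod>\<nu><d. 2 * sin (pi * (of_real (al \<nu>) * (1 - w) + be \<nu>))))"
proof -
  define g where "g = 2 * of_real A * a"
  define b' where "b' = (\<lambda>\<nu>. 1 - of_real (al \<nu>) - be \<nu>)"
  define R where "R = (\<lambda>w. (\<Prod>\<nu><d. stq (bt \<nu>) (of_real (al \<nu>) * w) * stq (b' \<nu>) (of_real (al \<nu>) * w)) *
      inverse (stq g (of_real (2 * A) * w)))"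
  have st: "asy1 (stq b)" for b using Gamma_stirling[of b] unfolding stq_def .
  have R: "asy1 R" unfolding R_def
    using al_pos A_pos by (intro asy1_mult asy1_prod asy1_scale asy1_inverse[OF asy1_scale] st) auto
  \<comment> \<open>Large enough for every Gamma argument below, including the single one with shift
    g, to have positive real part.\<close>
  define Z0 where "Z0 = 1 + (\<Sum>\<nu><d. (cmod (bt \<nu>) + cmod (b' \<nu>)) / al \<nu>) + cmod g / (2 * A)"
  have main: "gfac d al bt w * rgfac d al be (1 - w) =
     of_real (1 / sqrt (2 * pi)) * K0 * of_real h powr (- w) * Gamma (of_real (2 * A) * (w + a)) * R w *
     (\<Prod>\<nu><d. 2 * sin (pi * (of_real (al \<nu>) * (1 - w) + be \<nu>)))" if w: "Re w \<ge> Z0" for w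
  proof -
    have snn: "(\<Sum>\<nu><d. (cmod (bt \<nu>) + cmod (b' \<nu>)) / al \<nu>) \<ge> 0"
      using al_pos by (intro sum_nonneg divide_nonneg_pos) auto
    have w0: "Re w > 0" "w \<noteq> 0"
    proof -
      have "cmod g / (2 * A) \<ge> 0" using A_pos by simp
      then show "Re w > 0" using w snn unfolding Z0_def by linarith
      then show "w \<noteq> 0" by auto
    qed
    have pos: "Re (of_real (al \<nu>) * w + bt \<nu>) > 0" "Re (of_real (al \<nu>) * w + b' \<nu>) > 0" if \<nu>: "\<nu> < d" for \<nu>
    proof -
      have "(cmod (bt \<nu>) + cmod (b' \<nu>)) / al \<nu> \<le> (\<Sum>\<nu><d. (cmod (bt \<nu>) + cmod (b' \<nu>)) / al \<nu>)"
        using \<nu> al_pos by (intro member_le_sum divide_nonneg_pos) auto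
      moreover have "cmod g / (2 * A) \<ge> 0" using A_pos by simp
      ultimately have "Re w > (cmod (bt \<nu>) + cmod (b' \<nu>)) / al \<nu>" using w unfolding Z0_def by linarith
      then have "al \<nu> * Re w > cmod (bt \<nu>) + cmod (b' \<nu>)" using al_pos[OF \<nu>] by (simp add: divide_less_eq mult.commute)
      then show "Re (of_real (al \<nu>) * w + bt \<nu>) > 0" "Re (of_real (al \<nu>) * w + b' \<nu>) > 0"
        using abs_Re_le_cmod[of "bt \<nu>"] abs_Re_le_cmod[of "b' \<nu>"] norm_ge_zero[of "bt \<nu>"] norm_ge_zero[of "b' \<nu>"]
        by simp_all
    qed
    have posg: "Re (of_real (2 * A) * w + g) > 0"
    proof -
      have "Re w > cmod g / (2 * A)" using w snn unfolding Z0_def by linarith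
      then have "2 * A * Re w > cmod g" using A_pos by (simp add: divide_less_eq mult.commute)
      then show ?thesis using abs_Re_le_cmod[of g] by simp
    qed
    have gW: "of_real (2 * A) * (w + a) = of_real (2 * A) * w + g" by (simp add: g_def distrib_left)
    define q where "q = stq g (of_real (2 * A) * w)"
    have q0: "q \<noteq> 0"
    proof -
      have "Gamma (of_real (2 * A) * w + g) \<noteq> 0"
        using Re_pos_not_nonpos_Ints[OF posg] by (simp add: Gamma_eq_zero_iff)
      then show ?thesis by (auto simp: q_def stq_def)
    qed
    have LnA: "Ln (of_real x * w) = of_real (ln x) + Ln w" if "x > 0" for x
      using Ln_times_of_real[OF that w0(2)] Ln_of_real[OF that] by simp
    define cc where "cc = (\<lambda>\<nu>. 2 * of_real (al \<nu>) * w + bt \<nu> - of_real (al \<nu>) - be \<nu>)"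
    define E where "E = (\<lambda>\<nu>. cc \<nu> * (of_real (ln (al \<nu>)) + Ln w) - 2 * of_real (al \<nu>) * w)"
    have fac: "Gamma (of_real (al \<nu>) * w + bt \<nu>) * rGamma (of_real (al \<nu>) * (1 - w) + be \<nu>) =
       exp (E \<nu>) * (stq (bt \<nu>) (of_real (al \<nu>) * w) * stq (b' \<nu>) (of_real (al \<nu>) * w)) *
       (2 * sin (pi * (of_real (al \<nu>) * (1 - w) + be \<nu>)))" if \<nu>: "\<nu> < d" for \<nu>
    proof -
      define z where "z = of_real (al \<nu>) * (1 - w) + be \<nu>"
      have z1: "1 - z = of_real (al \<nu>) * w + b' \<nu>" by (simp add: z_def b'_def algebra_simps)
      have "1 - z \<notin> \<int>\<^sub>\<le>\<^sub>0" unfolding z1 using pos(2)[OF \<nu>] by (rule Re_pos_not_nonpos_Ints)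
      then have "rGamma (1 - z) \<noteq> 0" by (simp add: rGamma_eq_zero_iff)
      then have "rGamma z = Gamma (1 - z) * (sin (pi * z) / pi)"
        using rGamma_reflection_complex[of z] by (simp add: Gamma_def field_simps)
      then have rG: "rGamma z = Gamma (of_real (al \<nu>) * w + b' \<nu>) * (sin (pi * z) / pi)" unfolding z1 .
      let ?z = "of_real (al \<nu>) * w"
      have ex: "exp ((?z + bt \<nu> - 1/2) * Ln ?z - ?z) * exp ((?z + b' \<nu> - 1/2) * Ln ?z - ?z) = exp (E \<nu>)"
        unfolding exp_add[symmetric] E_def cc_def b'_def LnA[OF al_pos[OF \<nu>]]
        by (rule arg_cong[of _ _ exp]) (simp add: algebra_simps)
      have sp: "complex_of_real (sqrt (2 * pi)) * of_real (sqrt (2 * pi)) = 2 * pi"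
        by (simp flip: of_real_mult)
      have pi0: "complex_of_real (2 * pi) * (sin (pi * z) / pi) = 2 * sin (pi * z)" by simp
      have "Gamma (?z + bt \<nu>) * rGamma z = (complex_of_real (sqrt (2 * pi)) * of_real (sqrt (2 * pi))) * (sin (pi * z) / pi) *
         (exp ((?z + bt \<nu> - 1/2) * Ln ?z - ?z) * exp ((?z + b' \<nu> - 1/2) * Ln ?z - ?z)) * (stq (bt \<nu>) ?z * stq (b' \<nu>) ?z)"
        unfolding rG Gamma_stq by (simp only: mult_ac)
      then have "Gamma (?z + bt \<nu>) * rGamma z = 2 * sin (pi * z) * exp (E \<nu>) * (stq (bt \<nu>) ?z * stq (b' \<nu>) ?z)"
        unfolding ex sp pi0 .
      then show ?thesis unfolding z_def by (simp only: mult_ac)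
    qed
    have "gfac d al bt w * rgfac d al be (1 - w) =
       (\<Prod>\<nu><d. Gamma (of_real (al \<nu>) * w + bt \<nu>) * rGamma (of_real (al \<nu>) * (1 - w) + be \<nu>))"
      by (simp add: gfac_def rgfac_def prod.distrib)
    also have "\<dots> = (\<Prod>\<nu><d. exp (E \<nu>) * (stq (bt \<nu>) (of_real (al \<nu>) * w) * stq (b' \<nu>) (of_real (al \<nu>) * w)) *
       (2 * sin (pi * (of_real (al \<nu>) * (1 - w) + be \<nu>))))"
      by (intro prod.cong refl fac) auto
    also have "\<dots> = (\<Prod>\<nu><d. exp (E \<nu>)) * (R w * q) * (\<Prod>\<nu><d. 2 * sin (pi * (of_real (al \<nu>) * (1 - w) + be \<nu>)))"
      unfolding prod.distrib R_def q_def[symmetric] using q0 by simp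
    also have "(\<Prod>\<nu><d. exp (E \<nu>)) = K0 * of_real h powr (- w) * exp ((of_real (2 * A) * w + g - 1/2) * Ln (of_real (2 * A) * w) - of_real (2 * A) * w)"
    proof -
      define lm where "lm = (\<lambda>\<nu>. complex_of_real (ln (2 * A) - ln (al \<nu>)))"
      have lq: "ln (2 * A / al \<nu>) = ln (2 * A) - ln (al \<nu>)" if "\<nu> < d" for \<nu>
        using al_pos[OF that] A_pos by (simp add: ln_div)
      have q0: "2 * A / al \<nu> > 0" if "\<nu> < d" for \<nu> using al_pos[OF that] A_pos by simp
      have "K0 = (\<Prod>\<nu><d. exp ((of_real (al \<nu>) + be \<nu> - bt \<nu>) * lm \<nu>))"
      proof (intro prod.cong refl)
        fix \<nu> assume "\<nu> \<in> {..<d}"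
        then have n: "\<nu> < d" by simp
        have "complex_of_real (2 * A / al \<nu>) \<noteq> 0" using q0[OF n] by (simp only: of_real_eq_0_iff)
        then show "complex_of_real (2 * A / al \<nu>) powr (of_real (al \<nu>) + be \<nu> - bt \<nu>) = exp ((of_real (al \<nu>) + be \<nu> - bt \<nu>) * lm \<nu>)"
          unfolding powr_def lm_def using Ln_of_real[OF q0[OF n]] lq[OF n] by (simp only: if_False)
      qed
      then have K: "K0 = exp (\<Sum>\<nu><d. (of_real (al \<nu>) + be \<nu> - bt \<nu>) * lm \<nu>)" by (simp add: exp_sum)
      have "ln h = (\<Sum>\<nu><d. 2 * al \<nu> * (ln (2 * A) - ln (al \<nu>)))"
      proof -
        have "ln h = (\<Sum>\<nu><d. ln ((2 * A / al \<nu>) powr (2 * al \<nu>)))"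
          unfolding hconst_def
        proof (rule ln_prod)
          fix i assume "i \<in> {..<d}"
          then have "2 * A / al i > 0" using q0 by simp
          then show "(2 * A / al i) powr (2 * al i) \<noteq> 0" by (simp only: powr_eq_0_iff less_irrefl)
        qed simp
        also have "\<dots> = (\<Sum>\<nu><d. 2 * al \<nu> * (ln (2 * A) - ln (al \<nu>)))"
          by (intro sum.cong refl) (use q0 lq in \<open>simp add: ln_powr\<close>)
        finally show ?thesis .
      qed
      then have "complex_of_real (ln h) = (\<Sum>\<nu><d. 2 * of_real (al \<nu>) * lm \<nu>)" by (simp add: lm_def)
      then have H: "of_real h powr (- w) = exp (- w * (\<Sum>\<nu><d. 2 * of_real (al \<nu>) * lm \<nu>))"
        using h_pos by (simp add: powr_def Ln_of_real)
      have s1: "of_real (2 * A) * w + g - 1/2 = (\<Sum>\<nu><d. cc \<nu>)"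
        unfolding g_def two_A_a cc_def
        by (simp add: bigA_def bigB_def sum.distrib sum_subtractf sum_distrib_left sum_distrib_right)
      have s2: "of_real (2 * A) * w = (\<Sum>\<nu><d. 2 * of_real (al \<nu>) * w)"
        by (simp add: bigA_def sum_distrib_left sum_distrib_right)
      have LA: "Ln (of_real (2 * A) * w) = of_real (ln (2 * A)) + Ln w" using A_pos by (intro LnA) auto
      have "(\<Sum>\<nu><d. (of_real (al \<nu>) + be \<nu> - bt \<nu>) * lm \<nu>) + - w * (\<Sum>\<nu><d. 2 * of_real (al \<nu>) * lm \<nu>)
          + ((\<Sum>\<nu><d. cc \<nu>) * (of_real (ln (2 * A)) + Ln w) - (\<Sum>\<nu><d. 2 * of_real (al \<nu>) * w))
         = (\<Sum>\<nu><d. (of_real (al \<nu>) + be \<nu> - bt \<nu>) * lm \<nu> + - w * (2 * of_real (al \<nu>) * lm \<nu>)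
          + (cc \<nu> * (of_real (ln (2 * A)) + Ln w) - 2 * of_real (al \<nu>) * w))"
        by (simp only: sum.distrib sum_subtractf sum_distrib_left sum_distrib_right)
      also have "\<dots> = (\<Sum>\<nu><d. E \<nu>)"
        by (intro sum.cong refl) (simp add: E_def cc_def lm_def algebra_simps)
      finally have "exp (\<Sum>\<nu><d. E \<nu>) = K0 * of_real h powr (- w) *
         exp ((\<Sum>\<nu><d. cc \<nu>) * (of_real (ln (2 * A)) + Ln w) - (\<Sum>\<nu><d. 2 * of_real (al \<nu>) * w))"
        unfolding K H exp_add[symmetric] by (simp only:)
      then have "exp (\<Sum>\<nu><d. E \<nu>) = K0 * of_real h powr (- w) * exp ((of_real (2 * A) * w + g - 1/2) * Ln (of_real (2 * A) * w) - of_real (2 * A) * w)"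
        unfolding s1 LA by (simp only: s2)
      then show ?thesis by (simp add: exp_sum)
    qed
    also have "K0 * of_real h powr (- w) * exp ((of_real (2 * A) * w + g - 1/2) * Ln (of_real (2 * A) * w) - of_real (2 * A) * w) * (R w * q)
       = of_real (1 / sqrt (2 * pi)) * K0 * of_real h powr (- w) * Gamma (of_real (2 * A) * (w + a)) * R w"
    proof -
      have "complex_of_real (1 / sqrt (2 * pi)) * of_real (sqrt (2 * pi)) = of_real (1 / sqrt (2 * pi) * sqrt (2 * pi))"
        by (rule of_real_mult[symmetric])
      also have "1 / sqrt (2 * pi) * sqrt (2 * pi) = 1" by simp
      finally have s: "complex_of_real (1 / sqrt (2 * pi)) * of_real (sqrt (2 * pi)) = 1" by simp
      have "of_real (1 / sqrt (2 * pi)) * K0 * of_real h powr (- w) * Gamma (of_real (2 * A) * (w + a)) * R w =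
         (complex_of_real (1 / sqrt (2 * pi)) * of_real (sqrt (2 * pi))) * (K0 * of_real h powr (- w) *
          exp ((of_real (2 * A) * w + g - 1/2) * Ln (of_real (2 * A) * w) - of_real (2 * A) * w) * (R w * q))"
        unfolding gW Gamma_stq q_def by (simp only: mult_ac)
      then show ?thesis unfolding s by simp
    qed
    finally show ?thesis .
  qed
  show ?thesis using R main by blast
qed

end

section \<open>Two-term expansion of the gamma quotient on a vertical line\<close>

context gamma_data
begin

abbreviation "k \<equiv> kconst d al be bt"

definition W :: "real \<Rightarrow> real \<Rightarrow> complex" where
  "W c t = of_real (2 * A) * (1 - Complex (- c) t + a)"

definition rW :: "real \<Rightarrow> real" where "rW c = 2 * A * (1 + c + Re a)"

lemma Re_W: "Re (W c t) = rW c" by (simp add: W_def rW_def algebra_simps)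

lemma Im_W: "Im (W c t) = 2 * A * (Im a - t)" by (simp add: W_def algebra_simps)

text \<open>The two arguments are negatives of each other by the value of 2A a. This is where the
  constant k comes from: it matches the phase of Gamma W with the cosine that replaces the product
  of sines.\<close>

lemma cos_W: "cos (pi/2 * W c t + k * pi) = cos (pi * (of_real A * Complex (- c) t + bigB d be - of_nat d / 2))"
proof -
  have "pi/2 * W c t + k * pi = - (pi * (of_real A * Complex (- c) t + bigB d be - of_nat d / 2))
     + pi / 2 * (2 * of_real A * a - (1/2 + bigB d bt - bigB d be - of_real A))"
    by (simp add: W_def kconst_def algebra_simps add_divide_distrib diff_divide_distrib)
  also have "\<dots> = - (pi * (of_real A * Complex (- c) t + bigB d be - of_nat d / 2))" unfolding two_A_a by simp
  finally show ?thesis by simp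
qed

lemma norm_W_le: "cmod (W c t) + 1 \<le> (2 * A * (1 + \<bar>c\<bar> + cmod a) + 1) * (1 + \<bar>t\<bar>)"
proof -
  have "cmod (1 - Complex (- c) t + a) \<le> cmod (1 - Complex (- c) t) + cmod a" by (rule norm_triangle_ineq)
  also have "cmod (1 - Complex (- c) t) \<le> \<bar>1 + c\<bar> + \<bar>t\<bar>"
    using cmod_le[of "1 - Complex (- c) t"] by simp
  finally have "cmod (1 - Complex (- c) t + a) \<le> (1 + \<bar>c\<bar> + cmod a) + \<bar>t\<bar>" by linarith
  also have "\<dots> \<le> (1 + \<bar>c\<bar> + cmod a) * (1 + \<bar>t\<bar>)"
    using mult_right_mono[of 1 "1 + \<bar>c\<bar> + cmod a" "\<bar>t\<bar>"] by (simp add: distrib_left)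
  finally have "2 * A * cmod (1 - Complex (- c) t + a) \<le> 2 * A * ((1 + \<bar>c\<bar> + cmod a) * (1 + \<bar>t\<bar>))"
    using A_pos by (intro mult_left_mono) auto
  moreover have "cmod (W c t) = 2 * A * cmod (1 - Complex (- c) t + a)"
    using A_pos by (simp add: W_def norm_mult)
  ultimately have "cmod (W c t) \<le> 2 * A * ((1 + \<bar>c\<bar> + cmod a) * (1 + \<bar>t\<bar>))" by (simp only:)
  then have "cmod (W c t) + 1 \<le> 2 * A * ((1 + \<bar>c\<bar> + cmod a) * (1 + \<bar>t\<bar>)) + 1 * (1 + \<bar>t\<bar>)"
    by (intro add_mono) simp_all
  then show ?thesis by (simp only: distrib_right mult.assoc)
qed

lemma Gamma_W_bound:
  "\<exists>c0. \<forall>c\<ge>c0. \<exists>C>0. \<forall>t.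
     cmod (Gamma (W c t)) * exp (pi/2 * \<bar>Im (W c t)\<bar>) \<le> C * (1 + \<bar>t\<bar>) powr (rW c - 1/2) \<and>
     cmod (Gamma (W c t - 1)) * exp (pi/2 * \<bar>Im (W c t)\<bar>) \<le> C * (1 + \<bar>t\<bar>) powr (rW c - 3/2)"
proof -
  obtain C Z where C: "C > 0" "Z \<ge> 1" "\<And>z. Re z \<ge> Z \<Longrightarrow>
     cmod (Gamma z) * exp (pi/2 * \<bar>Im z\<bar>) \<le> C * cmod z powr (Re z - 1/2)"
    using Gamma_upper_bound by blast
  have "\<exists>C>0. \<forall>t.
     cmod (Gamma (W c t)) * exp (pi/2 * \<bar>Im (W c t)\<bar>) \<le> C * (1 + \<bar>t\<bar>) powr (rW c - 1/2) \<and>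
     cmod (Gamma (W c t - 1)) * exp (pi/2 * \<bar>Im (W c t)\<bar>) \<le> C * (1 + \<bar>t\<bar>) powr (rW c - 3/2)"
    if c: "c \<ge> (Z + 1) / (2 * A) + cmod a" for c
  proof -
    \<comment> \<open>The extra 1 keeps W - 1 inside the half plane of the Gamma bound as
      well.\<close>
    have rW: "rW c \<ge> Z + 1"
    proof -
      have "(Z + 1) / (2 * A) \<le> 1 + c + Re a" using c abs_Re_le_cmod[of a] by linarith
      then show ?thesis using A_pos by (simp add: rW_def divide_le_eq mult_ac)
    qed
    define M where "M = 2 * A * (1 + \<bar>c\<bar> + cmod a) + 1"
    have M: "M \<ge> 1" using A_pos by (simp add: M_def)
    have gen: "cmod (Gamma z) * exp (pi/2 * \<bar>Im z\<bar>) \<le> C * M powr rW c * (1 + \<bar>t\<bar>) powr (Re z - 1/2)"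
      if "Re z \<ge> Z" "Re z \<le> rW c" "cmod z \<le> cmod (W c t) + 1" for z t
    proof -
      have "cmod z \<le> M * (1 + \<bar>t\<bar>)" using that(3) norm_W_le[of c t] unfolding M_def by linarith
      then have "cmod z powr (Re z - 1/2) \<le> (M * (1 + \<bar>t\<bar>)) powr (Re z - 1/2)"
        using that(1) C(2) by (intro powr_mono2) auto
      also have "\<dots> = M powr (Re z - 1/2) * (1 + \<bar>t\<bar>) powr (Re z - 1/2)" using M by (simp add: powr_mult)
      also have "\<dots> \<le> M powr rW c * (1 + \<bar>t\<bar>) powr (Re z - 1/2)"
        using M that(2) by (intro mult_right_mono powr_mono) auto
      finally have "C * cmod z powr (Re z - 1/2) \<le> C * (M powr rW c * (1 + \<bar>t\<bar>) powr (Re z - 1/2))"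
        using C(1) by (intro mult_left_mono) auto
      then show ?thesis using C(3)[OF that(1)] by (simp add: mult.assoc)
    qed
    have "cmod (Gamma (W c t)) * exp (pi/2 * \<bar>Im (W c t)\<bar>) \<le> C * M powr rW c * (1 + \<bar>t\<bar>) powr (rW c - 1/2)" for t
      using gen[of "W c t" t] rW by (simp add: Re_W)
    moreover have "cmod (Gamma (W c t - 1)) * exp (pi/2 * \<bar>Im (W c t)\<bar>) \<le> C * M powr rW c * (1 + \<bar>t\<bar>) powr (rW c - 3/2)" for t
      using gen[of "W c t - 1" t] rW norm_triangle_ineq4[of "W c t" 1] by (simp add: Re_W)
    moreover have "C * M powr rW c > 0" using C M by auto
    ultimately show ?thesis by blast
  qed
  then show ?thesis by blast
qed

text \<open>The 1/w term of the correction R has to become a Mellin transform of a cosine too. Since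
  Gamma W / (W - 1) = Gamma (W - 1) and W - 1 = 2A w + m, the term p/w is exchanged for q / (W - 1)
  with q = 2A p; the difference p m / (w (W - 1)) is of second order and joins the error.\<close>

theorem gamma_expansion:
  "\<exists>q c0. \<forall>c\<ge>c0. \<exists>C\<ge>0. \<forall>t.
     cmod (gfac d al bt (1 - Complex (- c) t) * rgfac d al be (Complex (- c) t)
       - e0 d al be bt * of_real h powr (Complex (- c) t - 1) * (Gamma (W c t) * cos (pi/2 * W c t + k * pi))
       - e0 d al be bt * q * of_real h powr (Complex (- c) t - 1) * (Gamma (W c t - 1) * cos (pi/2 * W c t + k * pi)))
     \<le> C * (1 + \<bar>t\<bar>) powr (rW c - 2)"
proof -
  obtain R Z0 where R: "asy1 R" and G: "\<And>w. Re w \<ge> Z0 \<Longrightarrow> gfac d al bt w * rgfac d al be (1 - w) =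
     of_real (1 / sqrt (2 * pi)) * K0 * of_real h powr (- w) * Gamma (of_real (2 * A) * (w + a)) * R w *
     (\<Prod>\<nu><d. 2 * sin (pi * (of_real (al \<nu>) * (1 - w) + be \<nu>)))"
    using gamma_product by blast
  obtain p CR Z1 where CR: "CR \<ge> 0" "Z1 \<ge> 1" "\<And>w. Re w \<ge> Z1 \<Longrightarrow> cmod (R w - 1 - p / w) \<le> CR * cmod w powr (- 3/2)"
    using asy1E[OF R] by metis
  obtain CB Z2 where CB: "\<And>w. Re w \<ge> Z2 \<Longrightarrow> cmod (R w) \<le> CB" using asy1_bounds[OF R] by metis
  obtain c1 where c1: "\<And>c. c \<ge> c1 \<Longrightarrow> \<exists>C>0. \<forall>t.
     cmod (Gamma (W c t)) * exp (pi/2 * \<bar>Im (W c t)\<bar>) \<le> C * (1 + \<bar>t\<bar>) powr (rW c - 1/2)"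
    using Gamma_W_bound by meson
  define \<kappa> where "\<kappa> = of_real (1 / sqrt (2 * pi)) * K0"
  have e0k: "e0 d al be bt = 2 * \<kappa>"
  proof -
    have "sqrt (2 / pi) = 2 * (1 / sqrt (2 * pi))"
      by (simp add: real_sqrt_divide real_sqrt_mult field_simps flip: real_sqrt_mult_self[of 2])
    then show ?thesis by (simp add: e0_def \<kappa>_def)
  qed
  define q where "q = of_real (2 * A) * p"
  define m where "m = 2 * of_real A * a - 1"
  \<comment> \<open>The entry \<open>cmod m / A\<close> makes |m| at most A |w|, so W - 1 is bounded
    below by a multiple of 1 + |t|; the entry \<open>cmod a + 1 / A\<close> makes Re (W - 1)
    positive, as the recursion for Gamma needs.\<close>
  define c0 where "c0 = Max {0, Z0, Z1, Z2, c1, cmod m / A, cmod a + 1 / A}"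
  have c0: "c0 \<ge> 0" "c0 \<ge> Z0" "c0 \<ge> Z1" "c0 \<ge> Z2" "c0 \<ge> c1" "c0 \<ge> cmod m / A" "c0 \<ge> cmod a + 1 / A"
    unfolding c0_def by (intro Max_ge; simp)+
  have "\<exists>C\<ge>0. \<forall>t.
     cmod (gfac d al bt (1 - Complex (- c) t) * rgfac d al be (Complex (- c) t)
       - e0 d al be bt * of_real h powr (Complex (- c) t - 1) * (Gamma (W c t) * cos (pi/2 * W c t + k * pi))
       - e0 d al be bt * q * of_real h powr (Complex (- c) t - 1) * (Gamma (W c t - 1) * cos (pi/2 * W c t + k * pi)))
     \<le> C * (1 + \<bar>t\<bar>) powr (rW c - 2)" if c: "c \<ge> c0" for c
  proof -
    define s where "s = (\<lambda>t. Complex (- c) t)"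
    define w where "w = (\<lambda>t. 1 - s t)"
    have Rew: "Re (w t) = 1 + c" for t by (simp add: w_def s_def)
    have sw: "1 - w t = s t" "s t - 1 = - w t" for t by (auto simp: w_def)
    obtain CG where CG: "CG > 0" "\<And>t. cmod (Gamma (W c t)) * exp (pi/2 * \<bar>Im (W c t)\<bar>) \<le> CG * (1 + \<bar>t\<bar>) powr (rW c - 1/2)"
      using c1[of c] c c0 by force
    define P where "P = (\<lambda>t. \<Prod>\<nu><d. 2 * sin (pi * (of_real (al \<nu>) * s t + be \<nu>)))"
    define X where "X = (\<lambda>t. 2 * cos (pi * (of_real A * s t + bigB d be - of_nat d / 2)))"
    obtain CS where CS: "\<And>t. cmod (P t - X t) \<le> CS * exp (pi * A * \<bar>t\<bar>) / (1 + \<bar>t\<bar>)^2"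
      using sine_product(1)[where d = d and al = al and \<sigma> = "- c" and be = be, OF al_pos d_pos] unfolding P_def X_def s_def by blast
    obtain CX where CX: "\<And>t. cmod (X t) \<le> CX * exp (pi * A * \<bar>t\<bar>)"
      using sine_product(2)[where d = d and al = al and \<sigma> = "- c" and be = be, OF al_pos d_pos] unfolding X_def s_def by blast
    have CX0: "CX \<ge> 0" "CS \<ge> 0" using CX[of 0] CS[of 0] by (auto intro: order_trans[OF norm_ge_zero])
    have CB0: "CB \<ge> 0" using CB[of "of_real Z2"] by (auto intro: order_trans[OF norm_ge_zero])
    define H where "H = h powr (- (1 + c))"
    have H: "cmod (of_real h powr (- w t)) = H" for t
      using h_pos by (simp add: norm_powr_real_powr Rew H_def)
    have wl: "cmod (w t) \<ge> (1 + \<bar>t\<bar>) / 2" for t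
    proof -
      have "cmod (w t) \<ge> 1" using complex_Re_le_cmod[of "w t"] Rew[of t] c c0 by simp
      moreover have "cmod (w t) \<ge> \<bar>t\<bar>" using abs_Im_le_cmod[of "w t"] by (simp add: w_def s_def)
      ultimately show ?thesis by simp
    qed
    have Ww: "W c t - 1 = of_real (2 * A) * w t + m" for t by (simp add: W_def w_def s_def m_def algebra_simps)
    have Wl: "cmod (W c t - 1) \<ge> A * (1 + \<bar>t\<bar>) / 2" for t
    proof -
      have "cmod m \<le> A * c" using order_trans[OF c0(6) c] A_pos by (simp add: divide_le_eq mult.commute)
      also have "\<dots> \<le> A * cmod (w t)" using complex_Re_le_cmod[of "w t"] A_pos by (intro mult_left_mono) (auto simp: Rew)
      finally have "cmod m \<le> A * cmod (w t)" .
      moreover have "cmod (of_real (2 * A) * w t + m) \<ge> 2 * A * cmod (w t) - cmod m"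
        using norm_triangle_ineq2[of "of_real (2 * A) * w t" "- m"] A_pos by (simp add: norm_mult)
      moreover have "A * cmod (w t) \<ge> A * ((1 + \<bar>t\<bar>) / 2)" using wl[of t] A_pos by (intro mult_left_mono) auto
      ultimately show ?thesis unfolding Ww by simp
    qed
    define E where "E = (\<lambda>t. exp (pi * A * \<bar>t\<bar>))"
    have EG: "cmod (Gamma (W c t)) * E t \<le> (CG * exp (pi * A * cmod a)) * (1 + \<bar>t\<bar>) powr (rW c - 1/2)" for t
    proof -
      have "A * \<bar>t\<bar> \<le> A * (\<bar>Im a - t\<bar> + cmod a)"
        using abs_Im_le_cmod[of a] A_pos by (intro mult_left_mono) auto
      then have "pi * A * \<bar>t\<bar> \<le> pi / 2 * \<bar>Im (W c t)\<bar> + pi * A * cmod a"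
      proof -
        have "\<bar>Im (W c t)\<bar> = 2 * A * \<bar>Im a - t\<bar>" unfolding Im_W abs_mult using A_pos by simp
        then have "pi / 2 * \<bar>Im (W c t)\<bar> + pi * A * cmod a = pi * (A * (\<bar>Im a - t\<bar> + cmod a))"
          by (simp add: distrib_left)
        then show ?thesis using \<open>A * \<bar>t\<bar> \<le> A * (\<bar>Im a - t\<bar> + cmod a)\<close> by (simp add: mult.assoc)
      qed
      then have "E t \<le> exp (pi / 2 * \<bar>Im (W c t)\<bar>) * exp (pi * A * cmod a)"
        unfolding E_def exp_add[symmetric] by simp
      then have "cmod (Gamma (W c t)) * E t \<le> cmod (Gamma (W c t)) * (exp (pi / 2 * \<bar>Im (W c t)\<bar>) * exp (pi * A * cmod a))"
        by (intro mult_left_mono) auto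
      also have "\<dots> \<le> (CG * (1 + \<bar>t\<bar>) powr (rW c - 1/2)) * exp (pi * A * cmod a)"
        using CG(2)[of t] by (simp only: mult.assoc[symmetric]) (intro mult_right_mono, auto)
      finally show ?thesis by (simp add: mult_ac)
    qed
    define C4 where "C4 = CB * CS + CX * (CR * 2 powr (3/2)) + CX * (cmod p * cmod m * 4 / A)"
    have C4: "C4 \<ge> 0" unfolding C4_def using CX0 CB0 CR A_pos by auto
    have main: "cmod (gfac d al bt (1 - s t) * rgfac d al be (s t)
       - e0 d al be bt * of_real h powr (s t - 1) * (Gamma (W c t) * cos (pi/2 * W c t + k * pi))
       - e0 d al be bt * q * of_real h powr (s t - 1) * (Gamma (W c t - 1) * cos (pi/2 * W c t + k * pi)))
       \<le> (cmod \<kappa> * H * (CG * exp (pi * A * cmod a)) * C4) * (1 + \<bar>t\<bar>) powr (rW c - 2)" for t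
    proof -
      define u where "u = 1 + \<bar>t\<bar>"
      have u: "u \<ge> 1" by (simp add: u_def)
      have "A * (1 + \<bar>t\<bar>) / 2 > 0" "(1 + \<bar>t\<bar>) / 2 > 0" using A_pos by auto
      from less_le_trans[OF this(1) Wl] less_le_trans[OF this(2) wl]
      have W1: "W c t - 1 \<noteq> 0" "w t \<noteq> 0" by (simp_all only: zero_less_norm_iff not_False_eq_True)
      have Gm: "Gamma (W c t) = (W c t - 1) * Gamma (W c t - 1)"
      proof -
        have "A * (1 + c + Re a) \<ge> 1"
        proof -
          have "1 / A \<le> 1 + c + Re a" using c c0(7) abs_Re_le_cmod[of a] by linarith
          then show ?thesis using A_pos by (simp add: divide_le_eq mult.commute)
        qed
        then have "Re (W c t - 1) > 0" by (simp add: Re_W rW_def)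
        from Gamma_plus1[OF Re_pos_not_nonpos_Ints[OF this]] show ?thesis by simp
      qed
      have Geq: "gfac d al bt (1 - s t) * rgfac d al be (s t) = \<kappa> * of_real h powr (- w t) * Gamma (W c t) * R (w t) * P t"
      proof -
        have "Re (w t) \<ge> Z0" using c c0 by (simp add: Rew)
        from G[OF this] show ?thesis unfolding sw P_def[symmetric]
          by (simp add: \<kappa>_def W_def w_def s_def P_def)
      qed
      have cosX: "cos (pi/2 * W c t + k * pi) = X t / 2" unfolding cos_W X_def s_def by simp
      have "gfac d al bt (1 - s t) * rgfac d al be (s t)
       - e0 d al be bt * of_real h powr (s t - 1) * (Gamma (W c t) * cos (pi/2 * W c t + k * pi))
       - e0 d al be bt * q * of_real h powr (s t - 1) * (Gamma (W c t - 1) * cos (pi/2 * W c t + k * pi)) =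
         \<kappa> * of_real h powr (- w t) * Gamma (W c t) * (R (w t) * P t - X t - q / (W c t - 1) * X t)"
      proof -
        have "Gamma (W c t - 1) = Gamma (W c t) / (W c t - 1)" unfolding Gm using W1 by simp
        moreover have "x * y * g * r * pp - 2 * x * y * (g * (z / 2)) - 2 * x * q * y * (g / v * (z / 2)) =
            x * y * g * (r * pp - z - q / v * z)" if "v \<noteq> 0" for x y g r pp z v :: complex
          using that by (simp add: field_simps)
        ultimately show ?thesis unfolding Geq e0k cosX sw using W1(1) by (simp only:)
      qed
      \<comment> \<open>Three sources of error: the sine product against the cosine, the remainder
        of R, and the exchange of p/w for q / (W - 1).\<close>
      also have "R (w t) * P t - X t - q / (W c t - 1) * X t =
         R (w t) * (P t - X t) + X t * (R (w t) - 1 - p / w t) + X t * (p / w t - q / (W c t - 1))"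
        by (simp add: algebra_simps)
      also have "p / w t - q / (W c t - 1) = p * m / (w t * (W c t - 1))"
        using W1 unfolding Ww q_def by (simp add: divide_simps) (simp add: algebra_simps)
      finally have eq: "cmod (gfac d al bt (1 - s t) * rgfac d al be (s t)
       - e0 d al be bt * of_real h powr (s t - 1) * (Gamma (W c t) * cos (pi/2 * W c t + k * pi))
       - e0 d al be bt * q * of_real h powr (s t - 1) * (Gamma (W c t - 1) * cos (pi/2 * W c t + k * pi))) =
        cmod \<kappa> * H * cmod (Gamma (W c t)) * cmod (R (w t) * (P t - X t) + X t * (R (w t) - 1 - p / w t) + X t * (p * m / (w t * (W c t - 1))))"
        by (simp only: norm_mult H)
      have b1: "cmod (R (w t) * (P t - X t)) \<le> CB * (CS * E t * u powr (-3/2))"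
      proof -
        have "cmod (P t - X t) \<le> CS * E t * (1 / u^2)" using CS[of t] by (simp add: E_def u_def)
        also have "\<dots> \<le> CS * E t * u powr (-3/2)"
          using powr_minus_three_halves(2)[OF u] CX0 by (intro mult_left_mono) (auto simp: E_def)
        finally show ?thesis unfolding norm_mult using CB[of "w t"] c c0 CB0 by (intro mult_mono) (auto simp: Rew)
      qed
      have w32: "cmod (w t) powr (-3/2) \<le> 2 powr (3/2) * u powr (-3/2)"
      proof -
        have "cmod (w t) powr (-3/2) \<le> (u / 2) powr (-3/2)"
          using wl[of t] u by (intro powr_mono2') (auto simp: u_def)
        also have "\<dots> = 2 powr (3/2) * u powr (-3/2)" using u by (simp add: powr_divide powr_minus field_simps)
        finally show ?thesis .
      qed
      have b2: "cmod (X t * (R (w t) - 1 - p / w t)) \<le> (CX * E t) * (CR * (2 powr (3/2) * u powr (-3/2)))"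
      proof -
        have "cmod (R (w t) - 1 - p / w t) \<le> CR * cmod (w t) powr (-3/2)" using CR(3)[of "w t"] c c0 by (simp add: Rew)
        also have "\<dots> \<le> CR * (2 powr (3/2) * u powr (-3/2))" using w32 CR by (intro mult_left_mono) auto
        finally show ?thesis unfolding norm_mult using CX[of t] CX0 by (intro mult_mono) (auto simp: E_def)
      qed
      have b3: "cmod (X t * (p * m / (w t * (W c t - 1)))) \<le> (CX * E t) * (cmod p * cmod m * 4 / A * u powr (-3/2))"
      proof -
        have "cmod (p * m / (w t * (W c t - 1))) = cmod p * cmod m / (cmod (w t) * cmod (W c t - 1))" by (simp add: norm_mult norm_divide)
        also have "\<dots> \<le> cmod p * cmod m / (u / 2 * (A * u / 2))"
          using wl[of t] Wl[of t] u A_pos W1 by (intro divide_left_mono mult_mono mult_nonneg_nonneg mult_pos_pos) (auto simp: u_def)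
        also have "\<dots> = cmod p * cmod m * 4 / A * (1 / u^2)" by (simp add: power2_eq_square)
        also have "\<dots> \<le> cmod p * cmod m * 4 / A * u powr (-3/2)"
          using powr_minus_three_halves(2)[OF u] A_pos by (intro mult_left_mono) auto
        finally show ?thesis unfolding norm_mult using CX[of t] CX0 by (intro mult_mono) (auto simp: E_def)
      qed
      have "cmod (R (w t) * (P t - X t) + X t * (R (w t) - 1 - p / w t) + X t * (p * m / (w t * (W c t - 1)))) \<le>
        CB * (CS * E t * u powr (-3/2)) + (CX * E t) * (CR * (2 powr (3/2) * u powr (-3/2))) + (CX * E t) * (cmod p * cmod m * 4 / A * u powr (-3/2))"
        by (rule order_trans[OF norm_add3_le]) (intro add_mono b1 b2 b3)
      also have "\<dots> = E t * (C4 * u powr (-3/2))" by (simp add: C4_def algebra_simps)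
      finally have "cmod \<kappa> * H * cmod (Gamma (W c t)) * cmod (R (w t) * (P t - X t) + X t * (R (w t) - 1 - p / w t) + X t * (p * m / (w t * (W c t - 1))))
        \<le> cmod \<kappa> * H * cmod (Gamma (W c t)) * (E t * (C4 * u powr (-3/2)))"
        by (intro mult_left_mono) (auto simp: H_def)
      also have "\<dots> = cmod \<kappa> * H * (cmod (Gamma (W c t)) * E t) * (C4 * u powr (-3/2))" by (simp only: mult_ac)
      also have "\<dots> \<le> cmod \<kappa> * H * ((CG * exp (pi * A * cmod a)) * u powr (rW c - 1/2)) * (C4 * u powr (-3/2))"
        using EG[of t] C4 by (intro mult_right_mono mult_left_mono) (auto simp: H_def u_def)
      also have "\<dots> = (cmod \<kappa> * H * (CG * exp (pi * A * cmod a)) * C4) * (u powr (rW c - 1/2) * u powr (-3/2))" by (simp only: mult_ac)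
      also have "u powr (rW c - 1/2) * u powr (-3/2) = u powr (rW c - 2)" using u by (simp add: powr_add[symmetric])
      finally show ?thesis unfolding eq u_def .
    qed
    have "(cmod \<kappa> * H * (CG * exp (pi * A * cmod a)) * C4) \<ge> 0" using C4 CG by (simp add: H_def)
    then show ?thesis using main unfolding s_def by blast
  qed
  then show ?thesis by blast
qed

end

subsection \<open>The smoothed sum\<close>

lemma integral_pos_eq:
  fixes g :: "real \<Rightarrow> complex"
  assumes "\<And>u. u \<notin> {1/2..3/2} \<Longrightarrow> g u = 0"
  shows "integral {0<..} g = integral {1/2..3/2} g"
proof -
  have "g = (\<lambda>u. if u \<in> {1/2..3/2} then g u else 0)" using assms by (auto simp: fun_eq_iff)
  then have "integral {0<..} g = integral {0<..} (\<lambda>u. if u \<in> {1/2..3/2} then g u else 0)" by simp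
  also have "\<dots> = integral ({0<..} \<inter> {1/2..3/2}) g" by (subst integral_restrict_Int) (simp add: Int_commute)
  also have "{0<..} \<inter> {1/2..3/2} = {1/2..3/2::real}" by auto
  finally show ?thesis .
qed

lemma integral_inverse_square_scaled:
  assumes "L > 0"
  shows "integrable lborel (\<lambda>t. inverse (1 + (t / L)^2))" "(LBINT t. inverse (1 + (t / L)^2)) = L * pi"
proof -
  have i: "integrable lborel (\<lambda>t::real. inverse (1 + t^2))" and v: "(LBINT t. inverse (1 + t^2)) = pi"
    using integrable_inverse_1_plus_square LBINT_inverse_1_plus_square
    by (simp_all add: set_integrable_def set_lebesgue_integral_def interval_lebesgue_integral_def einterval_def)
  have "integrable lborel (\<lambda>t. inverse (1 + (0 + 1 / L * t)^2))"
    using assms by (intro lborel_integrable_real_affine[OF i]) auto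
  then show "integrable lborel (\<lambda>t. inverse (1 + (t / L)^2))" by simp
  have "pi = \<bar>1 / L\<bar> *\<^sub>R (LBINT t. inverse (1 + (0 + 1 / L * t)^2))"
    unfolding v[symmetric] using assms by (intro lborel_integral_real_affine) auto
  then show "(LBINT t. inverse (1 + (t / L)^2)) = L * pi" using assms by (simp add: field_simps)
qed

section \<open>The Mellin transform of the weight on vertical lines, uniformly in L\<close>

context smooth_weight
begin

definition fL :: "real \<Rightarrow> real \<Rightarrow> complex" where "fL L u = of_real (dp 0 ((u - 1) * L))"

lemma wt_eq: "wt \<phi>0 L u = dp 0 ((u - 1) * L)" by (simp add: wt_def dp_def)

lemma mell_fL: "mell (fL L) s = mel L 0 s" by (simp add: mell_def mel_def fL_def)

lemma fL_cont: "continuous_on S (fL L)" unfolding fL_def by (intro continuous_intros)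

lemma fL_supp: "L > 2 \<Longrightarrow> u \<notin> {1/2..3/2} \<Longrightarrow> fL L u = 0"
  unfolding fL_def using weight_zero'[of L u 0] by auto

lemma mellin_wt: "L > 2 \<Longrightarrow> mellin (wt \<phi>0 L) s = mel L 0 s"
  unfolding mellin_def mel_def wt_eq by (rule integral_pos_eq) (use weight_zero'[of L _ 0] in auto)

lemma mel_holomorphic: "mel L j holomorphic_on UNIV"
proof -
  have "(\<lambda>s. integral (cbox (1/2) (3/2)) (\<lambda>u. of_real (dp j ((u - 1) * L)) * of_real u powr (s - 1))) holomorphic_on UNIV"
  proof (rule leibniz_rule_holomorphic)
    show "((\<lambda>s. of_real (dp j ((u - 1) * L)) * of_real u powr (s - 1)) has_field_derivative
      of_real (dp j ((u - 1) * L)) * (of_real u powr (s - 1) * Ln (of_real u))) (at s within UNIV)" if "u \<in> cbox (1/2) (3/2)" for s u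
    proof -
      have "complex_of_real u \<noteq> 0" using that by auto
      then have "((\<lambda>s. of_real u powr (s - 1)) has_field_derivative (Ln (of_real u) * of_real u powr (s - 1)) * 1) (at s)"
        by (intro DERIV_chain2[OF has_field_derivative_powr_right]) (auto intro!: derivative_eq_intros)
      from DERIV_cmult[OF this, of "of_real (dp j ((u - 1) * L))"] show ?thesis by (simp add: mult_ac)
    qed
    show "(\<lambda>u. complex_of_real (dp j ((u - 1) * L)) * of_real u powr (s - 1)) integrable_on cbox (1/2) (3/2)" for s
      by (intro integrable_continuous continuous_intros) auto
    show "continuous_on (UNIV \<times> cbox (1/2) (3/2)) (\<lambda>(s, u). complex_of_real (dp j ((u - 1) * L)) * (of_real u powr (s - 1) * Ln (of_real u)))"
      unfolding case_prod_unfold by (intro continuous_intros) (auto simp: complex_nonpos_Reals_iff)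
  qed auto
  then show ?thesis unfolding mel_def[abs_def] by simp
qed

lemma mel_bound0:
  "\<exists>C\<ge>0. \<forall>L>2. \<forall>s. cmod (mel L j s) \<le> C * 2 powr \<bar>Re s - 1\<bar> / L"
proof -
  obtain B where B: "B \<ge> 0" "\<And>u. \<bar>dp j u\<bar> \<le> B" using dp_bounded by blast
  have "cmod (mel L j s) \<le> 2 * B * 2 powr \<bar>Re s - 1\<bar> / L" if "L > 2" for L s
    unfolding mel_def
  proof (rule weight_integral_bound[OF that _ _ B(2)])
    show "cmod (of_real u powr (s - 1)) \<le> 2 powr \<bar>Re s - 1\<bar>" if "u \<in> {1/2..3/2}" for u
      using norm_powr_half_bound[OF that, of "s - 1"] by simp
  qed (intro continuous_intros; auto)
  then show ?thesis using B by (intro exI[of _ "2 * B"]) auto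
qed

text \<open>For 1 + |t| <= L the trivial bound of order 1/L is used, beyond that N integrations by
  parts. The choice N >= Q + 2 absorbs the power Q and leaves two powers of L / (1 + |t|), hence an
  integrable profile in t / L with a constant independent of L.\<close>

lemma mel_line:
  assumes "Q \<ge> 0"
  shows "\<exists>C\<ge>0. \<forall>L>2. \<forall>t. (1 + \<bar>t\<bar>) powr Q * cmod (mel L 0 (Complex \<sigma> t)) \<le> C * L powr (Q - 1) * inverse (1 + (t / L)^2)"
proof -
  obtain N :: nat where N: "real N \<ge> Q + 2" using real_arch_simple by blast
  obtain C0 where C0: "C0 \<ge> 0" "\<And>L t. L > 2 \<Longrightarrow> cmod (mel L 0 (Complex \<sigma> t)) \<le> C0 / L"
  proof -
    obtain C where C: "C \<ge> 0" "\<And>L s. L > 2 \<Longrightarrow> cmod (mel L 0 s) \<le> C * 2 powr \<bar>Re s - 1\<bar> / L" using mel_bound0 by blast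
    show ?thesis
    proof (rule that[of "C * 2 powr \<bar>\<sigma> - 1\<bar>"])
      show "cmod (mel L 0 (Complex \<sigma> t)) \<le> C * 2 powr \<bar>\<sigma> - 1\<bar> / L" if "L > 2" for L t
        using C(2)[OF that, of "Complex \<sigma> t"] by simp
    qed (use C in auto)
  qed
  obtain C1 where C1: "C1 \<ge> 0" "\<And>L t. L > 2 \<Longrightarrow> t \<noteq> 0 \<Longrightarrow> cmod (mel L 0 (Complex \<sigma> t)) \<le> C1 / L * (L / \<bar>t\<bar>) ^ N"
    using mel_bound[of 0 \<sigma> N] by blast
  define C where "C = 2 * (C0 + C1 * 2 ^ N)"
  have "(1 + \<bar>t\<bar>) powr Q * cmod (mel L 0 (Complex \<sigma> t)) \<le> C * L powr (Q - 1) * inverse (1 + (t / L)^2)" if L: "L > 2" for L t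
  proof -
    define y where "y = (1 + \<bar>t\<bar>) / L"
    have y: "y > 0" using L by (simp add: y_def)
    have ty: "(1 + \<bar>t\<bar>) = L * y" using L by (simp add: y_def)
    have inv: "inverse (1 + y^2) \<le> inverse (1 + (t / L)^2)"
    proof -
      have "\<bar>t / L\<bar> \<le> \<bar>y\<bar>" using L by (simp add: y_def abs_divide divide_right_mono)
      then have "(t / L)^2 \<le> y^2" by (rule abs_le_square_iff[THEN iffD1])
      then show ?thesis by (intro le_imp_inverse_le) (auto intro: add_pos_nonneg)
    qed
    have m: "cmod (mel L 0 (Complex \<sigma> t)) \<le> (C0 + C1 * 2 ^ N) / L * min 1 (1 / y ^ N)"
    proof (cases "y \<le> 1")
      case True
      then have "1 / y ^ N \<ge> 1" using y by (simp add: power_le_one)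
      then have "min 1 (1 / y ^ N) = 1" by simp
      moreover have "C0 / L \<le> (C0 + C1 * 2 ^ N) / L" using C1 L by (intro divide_right_mono) auto
      ultimately show ?thesis using C0(2)[OF L, of t] by simp
    next
      case False
      then have "1 + \<bar>t\<bar> > L" using L by (simp add: y_def divide_le_eq)
      then have t1: "\<bar>t\<bar> \<ge> 1" "t \<noteq> 0" using L by auto
      have "L / \<bar>t\<bar> \<le> 2 * (1 / y)" using t1 L by (simp add: y_def divide_simps)
      then have "(L / \<bar>t\<bar>) ^ N \<le> (2 * (1 / y)) ^ N" using L by (intro power_mono) auto
      also have "\<dots> = 2 ^ N * (1 / y ^ N)" by (simp add: power_mult_distrib power_divide)
      finally have "C1 / L * (L / \<bar>t\<bar>) ^ N \<le> C1 / L * (2 ^ N * (1 / y ^ N))" using C1 L by (intro mult_left_mono) auto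
      also have "\<dots> \<le> (C0 + C1 * 2 ^ N) / L * (1 / y ^ N)"
        using C0 C1 L y by (simp add: divide_right_mono mult_right_mono)
      finally have *: "cmod (mel L 0 (Complex \<sigma> t)) \<le> (C0 + C1 * 2 ^ N) / L * (1 / y ^ N)"
        using C1(2)[OF L t1(2)] by linarith
      have "1 / y ^ N \<le> 1" using False by (simp add: one_le_power)
      then have "min 1 (1 / y ^ N) = 1 / y ^ N" by simp
      then show ?thesis using * by simp
    qed
    have yy: "y powr Q * min 1 (1 / y ^ N) \<le> 2 * inverse (1 + y^2)"
    proof (cases "y \<le> 1")
      case True
      have "y powr Q \<le> 1" using True y assms by (intro powr_le1) auto
      moreover have "1 \<le> 2 * inverse (1 + y^2)"
      proof -
        have "y^2 \<le> 1" using True y by (simp add: power_le_one)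
        moreover have "1 + y^2 > 0" by (simp add: add_pos_nonneg)
        ultimately show ?thesis by (simp add: divide_simps)
      qed
      moreover have "min 1 (1 / y ^ N) \<le> 1" "0 \<le> min 1 (1 / y ^ N)" using y by auto
      ultimately show ?thesis using mult_mono[of "y powr Q" 1 "min 1 (1 / y ^ N)" 1] by simp
    next
      case False
      have "y powr Q * min 1 (1 / y ^ N) \<le> y powr Q * (1 / y ^ N)" by (intro mult_left_mono) auto
      also have "\<dots> = y powr (Q - real N)" using y by (simp add: powr_diff powr_realpow)
      also have "\<dots> \<le> y powr (-2)" using False N by (intro powr_mono) auto
      also have "\<dots> = 1 / y^2" using y by (simp add: powr_minus_divide)
      also have "\<dots> \<le> 2 * inverse (1 + y^2)"
      proof -
        have "y^2 \<ge> 1" using False by (simp add: one_le_power)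
        moreover have "1 + y^2 > 0" by (simp add: add_pos_nonneg)
        ultimately show ?thesis by (simp add: divide_simps)
      qed
      finally show ?thesis .
    qed
    have "(1 + \<bar>t\<bar>) powr Q * cmod (mel L 0 (Complex \<sigma> t)) \<le> (L * y) powr Q * ((C0 + C1 * 2 ^ N) / L * min 1 (1 / y ^ N))"
      unfolding ty using m by (intro mult_left_mono) auto
    also have "\<dots> = ((C0 + C1 * 2 ^ N) * L powr (Q - 1)) * (y powr Q * min 1 (1 / y ^ N))"
      using L y by (simp add: powr_mult powr_diff)
    also have "\<dots> \<le> ((C0 + C1 * 2 ^ N) * L powr (Q - 1)) * (2 * inverse (1 + (t / L)^2))"
      using yy inv C0 C1 by (intro mult_left_mono) (auto intro: order_trans)
    finally show ?thesis by (simp only: C_def mult_ac)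
  qed
  moreover have "C \<ge> 0" using C0 C1 by (simp add: C_def)
  ultimately show ?thesis by blast
qed

lemma mel_line_measurable [measurable]: "(\<lambda>t. mel L j (Complex \<sigma> t)) \<in> borel_measurable borel"
  by (intro borel_measurable_continuous_onI
      continuous_on_compose2[OF holomorphic_on_imp_continuous_on[OF mel_holomorphic]] continuous_intros) auto

text \<open>A profile of height \<open>L powr (Q - 1)\<close> and width of order L.\<close>

lemma mel_line_integral:
  assumes "Q \<ge> 0"
  shows "\<exists>C\<ge>0. \<forall>L>2. integrable lborel (\<lambda>t. (1 + \<bar>t\<bar>) powr Q * cmod (mel L 0 (Complex \<sigma> t))) \<and>
     (LBINT t. (1 + \<bar>t\<bar>) powr Q * cmod (mel L 0 (Complex \<sigma> t))) \<le> C * L powr Q"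
proof -
  obtain C where C: "C \<ge> 0" "\<And>L t. L > 2 \<Longrightarrow> (1 + \<bar>t\<bar>) powr Q * cmod (mel L 0 (Complex \<sigma> t)) \<le> C * L powr (Q - 1) * inverse (1 + (t / L)^2)"
    using mel_line[OF assms] by blast
  have "integrable lborel (\<lambda>t. (1 + \<bar>t\<bar>) powr Q * cmod (mel L 0 (Complex \<sigma> t))) \<and>
     (LBINT t. (1 + \<bar>t\<bar>) powr Q * cmod (mel L 0 (Complex \<sigma> t))) \<le> (C * pi) * L powr Q" if L: "L > 2" for L
  proof -
    have L0: "L > 0" using L by simp
    have i: "integrable lborel (\<lambda>t. C * L powr (Q - 1) * inverse (1 + (t / L)^2))"
      by (intro integrable_mult_right integral_inverse_square_scaled L0)
    have i2: "integrable lborel (\<lambda>t. (1 + \<bar>t\<bar>) powr Q * cmod (mel L 0 (Complex \<sigma> t)))"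
    proof (rule Bochner_Integration.integrable_bound[OF i])
      show "AE t in lborel. norm ((1 + \<bar>t\<bar>) powr Q * cmod (mel L 0 (Complex \<sigma> t))) \<le> norm (C * L powr (Q - 1) * inverse (1 + (t / L)^2))"
      proof (intro AE_I2)
        fix t
        have "norm ((1 + \<bar>t\<bar>) powr Q * cmod (mel L 0 (Complex \<sigma> t))) = (1 + \<bar>t\<bar>) powr Q * cmod (mel L 0 (Complex \<sigma> t))"
          by (simp add: abs_mult)
        also note C(2)[OF L, of t]
        also note abs_ge_self
        finally show "norm ((1 + \<bar>t\<bar>) powr Q * cmod (mel L 0 (Complex \<sigma> t))) \<le> norm (C * L powr (Q - 1) * inverse (1 + (t / L)^2))"
          by (simp only: real_norm_def)
      qed
    qed measurable
    have "(LBINT t. (1 + \<bar>t\<bar>) powr Q * cmod (mel L 0 (Complex \<sigma> t))) \<le> (LBINT t. C * L powr (Q - 1) * inverse (1 + (t / L)^2))"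
      by (intro integral_mono i i2 C(2) L)
    also have "\<dots> = C * L powr (Q - 1) * (L * pi)" by (simp add: integral_inverse_square_scaled(2)[OF L0])
    also have "\<dots> = (C * pi) * L powr Q" using L by (simp add: powr_diff)
    finally show ?thesis using i2 by blast
  qed
  then show ?thesis using C(1) by (intro exI[of _ "C * pi"]) auto
qed

end

section \<open>The setting of the theorem and its Dirichlet series on vertical lines\<close>

lemma norm_cos_le: "cmod (cos z) \<le> exp \<bar>Im z\<bar>"
proof -
  have "cmod (cos z) = cmod (exp (\<i> * z) + exp (- (\<i> * z))) / 2" by (simp add: cos_exp_eq norm_divide)
  also have "\<dots> \<le> (cmod (exp (\<i> * z)) + cmod (exp (- (\<i> * z)))) / 2"
    by (intro divide_right_mono norm_triangle_ineq) auto
  also have "\<dots> = (exp (- Im z) + exp (Im z)) / 2" by simp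
  also have "\<dots> \<le> (exp \<bar>Im z\<bar> + exp \<bar>Im z\<bar>) / 2" by (intro divide_right_mono add_mono) auto
  finally show ?thesis by simp
qed

lemma norm_powr_pos: "x > 0 \<Longrightarrow> cmod (of_real x powr z) = x powr Re z"
  by (simp add: norm_powr_real_powr)

text \<open>On the line the modulus of \<open>\<nu> n powr (- z t)\<close> is constant, so the L1
  norms of the terms are multiples of one norm and absolute convergence of the series allows
  termwise integration.\<close>

lemma dirichlet_line_sums:
  fixes cc :: "nat \<Rightarrow> complex" and \<nu> :: "nat \<Rightarrow> real" and g z :: "real \<Rightarrow> complex"
  assumes \<nu>: "\<And>n. \<nu> n > 0" and z: "continuous_on UNIV z" "\<And>t. Re (z t) = \<sigma>"
    and s: "summable (\<lambda>n. cmod (cc n) * \<nu> n powr (- \<sigma>))" and g: "integrable lborel g"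
  shows "integrable lborel (\<lambda>t. dser cc \<nu> (z t) * g t)"
    and "(\<lambda>n. LBINT t. cc n * of_real (\<nu> n) powr (- z t) * g t) sums (LBINT t. dser cc \<nu> (z t) * g t)"
proof -
  define f where "f = (\<lambda>n t. cc n * of_real (\<nu> n) powr (- z t) * g t)"
  have [measurable]: "g \<in> borel_measurable borel" using g by auto
  have m: "(\<lambda>t. complex_of_real (\<nu> n) powr (- z t)) \<in> borel_measurable borel" for n
    using \<nu>[of n] by (intro borel_measurable_continuous_onI continuous_intros z) auto
  have nf: "cmod (f n t) = cmod (cc n) * \<nu> n powr (- \<sigma>) * cmod (g t)" for n t
    using \<nu>[of n] by (simp add: f_def norm_mult norm_powr_real_powr z)
  have fi: "integrable lborel (f n)" for n
  proof (rule Bochner_Integration.integrable_bound[of _ "\<lambda>t. (cmod (cc n) * \<nu> n powr (- \<sigma>)) *\<^sub>R g t"])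
    show "f n \<in> borel_measurable lborel" unfolding f_def using m[of n] by measurable
    show "AE t in lborel. cmod (f n t) \<le> cmod ((cmod (cc n) * \<nu> n powr (- \<sigma>)) *\<^sub>R g t)"
      by (simp add: nf abs_mult)
  qed (use g in auto)
  have sa: "summable (\<lambda>n. cmod (f n t))" for t unfolding nf by (intro summable_mult2 s)
  have si: "summable (\<lambda>n. LBINT t. cmod (f n t))"
    unfolding nf integral_mult_right_zero by (intro summable_mult2 s)
  have eq: "(\<lambda>t. \<Sum>n. f n t) = (\<lambda>t. dser cc \<nu> (z t) * g t)"
  proof
    fix t
    have "summable (\<lambda>n. cmod (cc n * of_real (\<nu> n) powr (- z t)))"
      using s by (simp add: norm_mult norm_powr_pos[OF \<nu>] z)
    then have "summable (\<lambda>n. cc n * of_real (\<nu> n) powr (- z t))" by (rule summable_norm_cancel)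
    then show "(\<Sum>n. f n t) = dser cc \<nu> (z t) * g t"
      unfolding f_def dser_def by (rule suminf_mult2[symmetric])
  qed
  show "integrable lborel (\<lambda>t. dser cc \<nu> (z t) * g t)"
    using integrable_suminf[OF fi _ si] sa unfolding eq by simp
  show "(\<lambda>n. LBINT t. cc n * of_real (\<nu> n) powr (- z t) * g t) sums (LBINT t. dser cc \<nu> (z t) * g t)"
    using sums_integral[OF fi _ si] sa unfolding eq by (simp add: f_def)
qed

text \<open>\<open>F\<close> is the continuation of \<Delta> \<phi>; the functional equation is
  asked only where the series of the dual side converges absolutely, and this is where the left line
  runs. The coefficients are called \<open>ca\<close> and \<open>cb\<close> because \<open>a\<close>
  already abbreviates \<open>aconst\<close>.\<close>

locale hecke_setup = gamma_data d al be bt + smooth_weight \<phi>0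
  for d :: nat and al :: "nat \<Rightarrow> real" and be bt :: "nat \<Rightarrow> complex" and \<phi>0 :: "real \<Rightarrow> real" +
  fixes ca cb :: "nat \<Rightarrow> complex" and lam mu :: "nat \<Rightarrow> real"
    and \<sigma>s :: real and \<omega> :: complex and F :: "complex \<Rightarrow> complex" and R :: real
  assumes lam_pos: "\<And>n. lam n > 0" and mu_pos: "\<And>n. mu n > 0" and mu_ge: "\<And>n. mu n \<ge> mu 0"
    and A1a: "\<And>s. Re s \<ge> \<sigma>s \<Longrightarrow> summable (\<lambda>n. norm (ca n * of_real (lam n) powr (- s)))"
    and A1b: "\<And>s. Re s \<ge> \<sigma>s \<Longrightarrow> summable (\<lambda>n. norm (cb n * of_real (mu n) powr (- s)))"
    and omega: "norm \<omega> = 1"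
    and F_mero: "F meromorphic_on UNIV"
    and F_cont: "\<And>s. Re s \<ge> \<sigma>s \<Longrightarrow> gfac_regular d al be s \<Longrightarrow> F s = gfac d al be s * dser ca lam s"
    and F_funeq: "\<And>s. Re (1 - s) \<ge> \<sigma>s \<Longrightarrow> gfac_regular d al bt (1 - s) \<Longrightarrow>
                    F s = \<omega> * gfac d al bt (1 - s) * dser cb mu (1 - s)"
    and R_pos: "R > 0"
    and F_sing: "F analytic_on {z. cmod z \<ge> R}"
    and F_decay: "\<And>c c' \<epsilon>. \<epsilon> > 0 \<Longrightarrow> \<exists>T. \<forall>s. c \<le> Re s \<and> Re s \<le> c' \<and> \<bar>Im s\<bar> \<ge> T \<longrightarrow> cmod (F s) \<le> \<epsilon>"
begin

lemma summable_ca: "\<sigma> \<ge> \<sigma>s \<Longrightarrow> summable (\<lambda>n. cmod (ca n) * lam n powr (- \<sigma>))"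
  using A1a[of "of_real \<sigma>"] by (simp add: norm_mult norm_powr_pos[OF lam_pos])

lemma summable_cb: "\<sigma> \<ge> \<sigma>s \<Longrightarrow> summable (\<lambda>n. cmod (cb n) * mu n powr (- \<sigma>))"
  using A1b[of "of_real \<sigma>"] by (simp add: norm_mult norm_powr_pos[OF mu_pos])

definition J :: "real \<Rightarrow> complex \<Rightarrow> complex \<Rightarrow> real \<Rightarrow> complex" where
  "J L aa kk Y = integral {1/2..3/2} (\<lambda>u. fL L u * of_real u powr aa * cos (of_real ((Y * u) powr (1 / (2 * A))) + kk * pi))"

lemma J_bound:
  "\<exists>C\<ge>0. \<forall>L>2. \<forall>Y>0. cmod (J L aa kk Y) \<le> C / L * (L / Y powr (1 / (2 * A))) ^ N"
proof -
  let ?r = "1 / (2 * A)"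
  have r: "?r > 0" using A_pos by simp
  obtain C1 where C1: "C1 \<ge> 0" "\<And>L Y. L > 2 \<Longrightarrow> Y > 0 \<Longrightarrow> cmod (osc 1 ?r L 0 aa Y) \<le> C1 / L * (L / Y powr ?r) ^ N"
    using osc_bound[OF r, of 1 0 aa N] by auto
  obtain C2 where C2: "C2 \<ge> 0" "\<And>L Y. L > 2 \<Longrightarrow> Y > 0 \<Longrightarrow> cmod (osc (- 1) ?r L 0 aa Y) \<le> C2 / L * (L / Y powr ?r) ^ N"
    using osc_bound[OF r, of "-1" 0 aa N] by auto
  define P1 P2 where "P1 = exp (\<i> * kk * pi) / 2" and "P2 = exp (- (\<i> * kk * pi)) / 2"
  have "cmod (J L aa kk Y) \<le> (cmod P1 * C1 + cmod P2 * C2) / L * (L / Y powr ?r) ^ N" if L: "L > 2" and Y: "Y > 0" for L Y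
  proof -
    have cosx: "cos (z + kk * pi) = P1 * exp (of_real 1 * \<i> * z) + P2 * exp (of_real (-1) * \<i> * z)" for z :: complex
      by (simp add: P1_def P2_def cos_exp_eq exp_add[symmetric] add_divide_distrib algebra_simps)
    let ?G = "\<lambda>sg u. of_real (dp 0 ((u - 1) * L)) * (of_real u powr aa * exp (of_real sg * \<i> * of_real ((Y * u) powr ?r)))"
    have i: "?G sg integrable_on {1/2..3/2}" for sg
      using Y by (intro integrable_continuous_real continuous_intros) auto
    have "J L aa kk Y = integral {1/2..3/2} (\<lambda>u. P1 * ?G 1 u + P2 * ?G (-1) u)"
      unfolding J_def cosx fL_def by (intro integral_cong) (simp add: algebra_simps)
    also have "\<dots> = P1 * osc 1 ?r L 0 aa Y + P2 * osc (-1) ?r L 0 aa Y"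
      unfolding osc_def using i[of 1] i[of "-1"]
      by (subst integral_add) (simp_all only: integrable_on_mult_right integral_mult_right simp_thms)
    also have "cmod \<dots> \<le> cmod P1 * cmod (osc 1 ?r L 0 aa Y) + cmod P2 * cmod (osc (-1) ?r L 0 aa Y)"
      by (metis norm_triangle_ineq norm_mult)
    also have "\<dots> \<le> cmod P1 * (C1 / L * (L / Y powr ?r) ^ N) + cmod P2 * (C2 / L * (L / Y powr ?r) ^ N)"
      by (intro add_mono mult_left_mono C1 C2 L Y) auto
    also have "\<dots> = (cmod P1 * C1 + cmod P2 * C2) / L * (L / Y powr ?r) ^ N" by (simp add: add_divide_distrib distrib_right)
    finally show ?thesis .
  qed
  then show ?thesis using C1 C2 by (intro exI[of _ "cmod P1 * C1 + cmod P2 * C2"]) auto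
qed

text \<open>Stated for free aa and kk because it is applied twice: with (a, k) to the main term and
  with (a - 1/(2A), k + 1/2) to the second term.\<close>

lemma main_J:
  fixes aa kk :: complex
  assumes L: "L > 2" and Y: "Y > 0" and aa: "1 + c + Re aa > 0" and Q: "Q \<ge> 0"
    and G: "\<And>t. cmod (Gamma (of_real (2 * A) * (1 - Complex (- c) t + aa))) *
        exp (pi/2 * \<bar>Im (of_real (2 * A) * (1 - Complex (- c) t + aa))\<bar>) \<le> CG * (1 + \<bar>t\<bar>) powr Q"
  shows "integrable lborel (\<lambda>t. mel L 0 (Complex (- c) t) * of_real Y powr (Complex (- c) t) *
        (Gamma (of_real (2 * A) * (1 - Complex (- c) t + aa)) * cos (pi/2 * (of_real (2 * A) * (1 - Complex (- c) t + aa)) + kk * pi)))"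
    and "(LBINT t. mel L 0 (Complex (- c) t) * of_real Y powr (Complex (- c) t) *
        (Gamma (of_real (2 * A) * (1 - Complex (- c) t + aa)) * cos (pi/2 * (of_real (2 * A) * (1 - Complex (- c) t + aa)) + kk * pi))) =
      of_real (2 * pi / (2 * A)) * of_real Y powr (1 + aa) * J L aa kk Y"
proof -
  have mi: "integrable lborel (\<lambda>t. (1 + \<bar>t\<bar>) powr Q * cmod (mel L 0 (Complex (- c) t)))"
    if "Q \<ge> 0" for Q using mel_line_integral[OF that] L by blast
  have i0: "integrable lborel (\<lambda>t. mell (fL L) (Complex (- c) t))"
  proof -
    have "1 + \<bar>t\<bar> \<noteq> 0" for t :: real by linarith
    then have "integrable lborel (\<lambda>t. cmod (mel L 0 (Complex (- c) t)))" using mi[of 0] by simp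
    then show ?thesis unfolding mell_fL by (subst (asm) integrable_norm_iff) auto
  qed
  interpret ms: mellin_setup "fL L" c "2 * A" Y aa
    by unfold_locales (use A_pos Y aa fL_cont fL_supp[OF L] i0 in auto)
  have W: "ms.W t = of_real (2 * A) * (1 - Complex (- c) t + aa)" for t by (simp add: ms.W_def)
  have int1: "integrable lborel (\<lambda>t. cmod (mell (fL L) (Complex (- c) t)) * (cmod (Gamma (ms.W t)) * exp (pi/2 * \<bar>Im (ms.W t)\<bar>)))"
  proof (rule Bochner_Integration.integrable_bound)
    show "integrable lborel (\<lambda>t. \<bar>CG\<bar> * ((1 + \<bar>t\<bar>) powr Q * cmod (mel L 0 (Complex (- c) t))))"
      by (intro integrable_mult_right mi Q)
    have [measurable]: "(\<lambda>t. Gamma (ms.W t)) \<in> borel_measurable borel"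
    proof (rule borel_measurable_continuous_onI)
      have "Gamma holomorphic_on {z. Re z > 0}"
        by (intro holomorphic_Gamma) (use Re_pos_not_nonpos_Ints in auto)
      then show "continuous_on UNIV (\<lambda>t. Gamma (ms.W t))"
        by (intro continuous_on_compose2[OF holomorphic_on_imp_continuous_on ms.continuous_W]) (use ms.Re_W_pos in auto)
    qed
    show "(\<lambda>t. cmod (mell (fL L) (Complex (- c) t)) * (cmod (Gamma (ms.W t)) * exp (pi/2 * \<bar>Im (ms.W t)\<bar>))) \<in> borel_measurable lborel"
      unfolding mell_fL by measurable
    show "AE t in lborel. norm (cmod (mell (fL L) (Complex (- c) t)) * (cmod (Gamma (ms.W t)) * exp (pi/2 * \<bar>Im (ms.W t)\<bar>)))
       \<le> norm (\<bar>CG\<bar> * ((1 + \<bar>t\<bar>) powr Q * cmod (mel L 0 (Complex (- c) t))))"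
    proof (intro AE_I2)
      fix t
      have "cmod (Gamma (ms.W t)) * exp (pi/2 * \<bar>Im (ms.W t)\<bar>) \<le> CG * (1 + \<bar>t\<bar>) powr Q"
        unfolding W by (rule G)
      also have "\<dots> \<le> \<bar>CG\<bar> * (1 + \<bar>t\<bar>) powr Q" by (intro mult_right_mono) auto
      finally have "cmod (mel L 0 (Complex (- c) t)) * (cmod (Gamma (ms.W t)) * exp (pi/2 * \<bar>Im (ms.W t)\<bar>)) \<le>
        cmod (mel L 0 (Complex (- c) t)) * (\<bar>CG\<bar> * (1 + \<bar>t\<bar>) powr Q)" by (intro mult_left_mono) auto
      then show "norm (cmod (mell (fL L) (Complex (- c) t)) * (cmod (Gamma (ms.W t)) * exp (pi/2 * \<bar>Im (ms.W t)\<bar>)))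
       \<le> norm (\<bar>CG\<bar> * ((1 + \<bar>t\<bar>) powr Q * cmod (mel L 0 (Complex (- c) t))))"
        by (simp add: mell_fL abs_mult mult_ac)
    qed
  qed
  show "integrable lborel (\<lambda>t. mel L 0 (Complex (- c) t) * of_real Y powr (Complex (- c) t) *
        (Gamma (of_real (2 * A) * (1 - Complex (- c) t + aa)) * cos (pi/2 * (of_real (2 * A) * (1 - Complex (- c) t + aa)) + kk * pi)))"
    using ms.main_term_cos(1)[OF int1, of kk] unfolding mell_fL W .
  show "(LBINT t. mel L 0 (Complex (- c) t) * of_real Y powr (Complex (- c) t) *
        (Gamma (of_real (2 * A) * (1 - Complex (- c) t + aa)) * cos (pi/2 * (of_real (2 * A) * (1 - Complex (- c) t + aa)) + kk * pi))) =
      of_real (2 * pi / (2 * A)) * of_real Y powr (1 + aa) * J L aa kk Y"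
    using ms.main_term_cos(2)[OF int1, of kk] unfolding mell_fL W J_def .
qed

end

text \<open>A line \<open>Re s = -c\<close> so far to the left that the Dirichlet series of \<open>cb\<close> converges at \<open>1 - s\<close>,
  the gamma factors have no poles there and the expansion of their quotient is valid, together with
  the constants of that expansion; \<open>Re s = c1\<close> is the line on the right.\<close>

locale hecke_line = hecke_setup +
  fixes c c1 CG CE :: real and q :: complex
  assumes c_R: "R < c" and c_sig: "\<sigma>s \<le> 1 + c" and c_rW: "rW c \<ge> 2"
    and c_reg: "\<And>\<nu>. \<nu> < d \<Longrightarrow> al \<nu> * (1 + c) + Re (bt \<nu>) > 0"
    and c1_R: "R < c1" and c1_sig: "\<sigma>s \<le> c1"
    and c1_reg: "\<And>\<nu>. \<nu> < d \<Longrightarrow> al \<nu> * c1 + Re (be \<nu>) > 0"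
    and CG0: "CG \<ge> 0"
    and CG1: "\<And>t. cmod (Gamma (W c t)) * exp (pi/2 * \<bar>Im (W c t)\<bar>) \<le> CG * (1 + \<bar>t\<bar>) powr (rW c - 1/2)"
    and CG2: "\<And>t. cmod (Gamma (W c t - 1)) * exp (pi/2 * \<bar>Im (W c t)\<bar>) \<le> CG * (1 + \<bar>t\<bar>) powr (rW c - 3/2)"
    and CE0: "CE \<ge> 0"
    and CE: "\<And>t. cmod (gfac d al bt (1 - Complex (- c) t) * rgfac d al be (Complex (- c) t)
       - e0 d al be bt * of_real h powr (Complex (- c) t - 1) * (Gamma (W c t) * cos (pi/2 * W c t + k * pi))
       - e0 d al be bt * q * of_real h powr (Complex (- c) t - 1) * (Gamma (W c t - 1) * cos (pi/2 * W c t + k * pi)))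
     \<le> CE * (1 + \<bar>t\<bar>) powr (rW c - 2)"
begin

abbreviation "EE \<equiv> e0 d al be bt"

definition G :: "real \<Rightarrow> complex" where
  "G t = gfac d al bt (1 - Complex (- c) t) * rgfac d al be (Complex (- c) t)"

definition M0 :: "real \<Rightarrow> complex" where
  "M0 t = EE * of_real h powr (Complex (- c) t - 1) * (Gamma (W c t) * cos (pi/2 * W c t + k * pi))"

definition M1 :: "real \<Rightarrow> complex" where
  "M1 t = EE * q * of_real h powr (Complex (- c) t - 1) * (Gamma (W c t - 1) * cos (pi/2 * W c t + k * pi))"

lemma G_err: "cmod (G t - M0 t - M1 t) \<le> CE * (1 + \<bar>t\<bar>) powr (rW c - 2)"
  using CE[of t] by (simp only: G_def M0_def M1_def)

lemma bt_reg: "gfac_regular d al bt (1 - Complex (- c) t)"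
  unfolding gfac_regular_def using c_reg by (intro allI impI Re_pos_not_nonpos_Ints) (simp add: algebra_simps)

lemma be_reg: "gfac_regular d al be (Complex c1 t)"
  unfolding gfac_regular_def using c1_reg by (intro allI impI Re_pos_not_nonpos_Ints) simp

lemma G_continuous: "continuous_on UNIV G"
proof -
  have Gh: "Gamma holomorphic_on {z. Re z > 0}"
    by (intro holomorphic_Gamma) (use Re_pos_not_nonpos_Ints in auto)
  have rh: "rGamma holomorphic_on UNIV" by (intro holomorphic_rGamma)
  show ?thesis unfolding G_def[abs_def] gfac_def rgfac_def
    by (intro continuous_intros continuous_on_prod continuous_on_compose2[OF holomorphic_on_imp_continuous_on[OF Gh]]
        continuous_on_compose2[OF holomorphic_on_imp_continuous_on[OF rh]])
       (use c_reg in \<open>auto simp: algebra_simps\<close>)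
qed

lemma G_measurable [measurable]: "G \<in> borel_measurable borel"
  by (rule borel_measurable_continuous_onI[OF G_continuous])

text \<open>Read off from the two-term expansion. It makes the integrand on the left line
  integrable, which precedes any splitting into terms.\<close>

lemma G_bound: "\<exists>C\<ge>0. \<forall>t. cmod (G t) \<le> C * (1 + \<bar>t\<bar>) powr (rW c - 1/2)"
proof -
  define H where "H = h powr (- c - 1)"
  define C where "C = cmod EE * H * (CG * exp (pi * \<bar>Im k\<bar>)) + cmod EE * cmod q * H * (CG * exp (pi * \<bar>Im k\<bar>)) + CE"
  have H: "cmod (of_real h powr (Complex (- c) t - 1)) = H" for t
    using h_pos by (simp add: norm_powr_pos H_def)
  have co: "cmod (cos (pi/2 * W c t + k * pi)) \<le> exp (pi/2 * \<bar>Im (W c t)\<bar>) * exp (pi * \<bar>Im k\<bar>)" for t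
  proof -
    have "\<bar>Im (pi/2 * W c t + k * pi)\<bar> \<le> pi/2 * \<bar>Im (W c t)\<bar> + pi * \<bar>Im k\<bar>"
      using abs_triangle_ineq[of "pi/2 * Im (W c t)" "pi * Im k"] by (simp add: abs_mult mult.commute)
    then show ?thesis using norm_cos_le[of "pi/2 * W c t + k * pi"]
      unfolding exp_add[symmetric] by (meson exp_le_cancel_iff order_trans)
  qed
  have "cmod (G t) \<le> C * (1 + \<bar>t\<bar>) powr (rW c - 1/2)" for t
  proof -
    let ?u = "(1 + \<bar>t\<bar>) powr (rW c - 1/2)"
    have gc: "cmod (Gm * cos (pi/2 * W c t + k * pi)) \<le> CG * exp (pi * \<bar>Im k\<bar>) * ?u"
      if "cmod Gm * exp (pi/2 * \<bar>Im (W c t)\<bar>) \<le> CG * ?u" for Gm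
    proof -
      have "cmod (Gm * cos (pi/2 * W c t + k * pi)) \<le> cmod Gm * (exp (pi/2 * \<bar>Im (W c t)\<bar>) * exp (pi * \<bar>Im k\<bar>))"
        unfolding norm_mult by (intro mult_left_mono co) auto
      also have "\<dots> \<le> (CG * ?u) * exp (pi * \<bar>Im k\<bar>)"
        unfolding mult.assoc[symmetric] using that by (intro mult_right_mono) auto
      finally show ?thesis by (simp only: mult_ac)
    qed
    have p1: "(1 + \<bar>t\<bar>) powr (rW c - 3/2) \<le> ?u" "(1 + \<bar>t\<bar>) powr (rW c - 2) \<le> ?u" by (intro powr_mono; simp)+
    have "CG * (1 + \<bar>t\<bar>) powr (rW c - 3/2) \<le> CG * ?u" using p1 CG0 by (intro mult_left_mono) auto
    then have g2: "cmod (Gamma (W c t - 1)) * exp (pi/2 * \<bar>Im (W c t)\<bar>) \<le> CG * ?u" using CG2[of t] by linarith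
    have m0: "cmod (M0 t) \<le> cmod EE * H * (CG * exp (pi * \<bar>Im k\<bar>) * ?u)"
      unfolding M0_def using gc[OF CG1[of t]] by (subst norm_mult, intro mult_mono) (simp_all only: norm_mult H norm_ge_zero order_refl, auto simp: H_def)
    have m1: "cmod (M1 t) \<le> cmod EE * cmod q * H * (CG * exp (pi * \<bar>Im k\<bar>) * ?u)"
      unfolding M1_def using gc[OF g2] by (subst norm_mult, intro mult_mono) (simp_all only: norm_mult H norm_ge_zero order_refl, auto simp: H_def)
    have er: "cmod (G t - M0 t - M1 t) \<le> CE * ?u"
      by (rule order_trans[OF G_err]) (use p1 CE0 in \<open>intro mult_left_mono; simp\<close>)
    have "cmod (G t) = cmod (M0 t + M1 t + (G t - M0 t - M1 t))" by simp
    also have "\<dots> \<le> cmod (M0 t) + cmod (M1 t) + cmod (G t - M0 t - M1 t)" by (rule norm_add3_le)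
    also have "\<dots> \<le> C * ?u" using m0 m1 er unfolding C_def by (simp add: algebra_simps)
    finally show ?thesis .
  qed
  moreover have "C \<ge> 0" using CG0 CE0 by (simp add: C_def H_def)
  ultimately show ?thesis by blast
qed

lemma mel_int:
  assumes "L > 2" "Q \<ge> 0"
  shows "integrable lborel (\<lambda>t. (1 + \<bar>t\<bar>) powr Q * cmod (mel L 0 (Complex \<sigma> t)))"
  using mel_line_integral[OF assms(2), of \<sigma>] assms(1) by blast

lemma mel_int0:
  assumes "L > 2"
  shows "integrable lborel (\<lambda>t. mel L 0 (Complex \<sigma> t))"
proof -
  have "1 + \<bar>t\<bar> \<noteq> 0" for t :: real by linarith
  then have "integrable lborel (\<lambda>t. cmod (mel L 0 (Complex \<sigma> t)))" using mel_int[OF assms, of 0] by simp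
  then show ?thesis by (subst (asm) integrable_norm_iff) auto
qed

lemma powr_line_measurable [measurable]:
  "x > 0 \<Longrightarrow> (\<lambda>t. complex_of_real x powr (Complex \<sigma> t)) \<in> borel_measurable borel"
  by (intro borel_measurable_continuous_onI continuous_intros) auto

definition gl :: "real \<Rightarrow> real \<Rightarrow> real \<Rightarrow> complex" where
  "gl L x t = G t * of_real x powr (Complex (- c) t) * mel L 0 (Complex (- c) t)"

lemma gl_integrable:
  assumes L: "L > 2" and x: "x > 0"
  shows "integrable lborel (gl L x)"
proof -
  obtain C where C: "C \<ge> 0" "\<And>t. cmod (G t) \<le> C * (1 + \<bar>t\<bar>) powr (rW c - 1/2)" using G_bound by blast
  show ?thesis
  proof (rule Bochner_Integration.integrable_bound)
    show "integrable lborel (\<lambda>t. (C * x powr (- c)) * ((1 + \<bar>t\<bar>) powr (rW c - 1/2) * cmod (mel L 0 (Complex (- c) t))))"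
      using c_rW by (intro integrable_mult_right mel_int L) auto
    show "gl L x \<in> borel_measurable lborel" unfolding gl_def using powr_line_measurable[OF x, of "- c"] by measurable
    show "AE t in lborel. cmod (gl L x t) \<le> norm ((C * x powr (- c)) * ((1 + \<bar>t\<bar>) powr (rW c - 1/2) * cmod (mel L 0 (Complex (- c) t))))"
    proof (intro AE_I2)
      fix t
      have "cmod (gl L x t) = cmod (G t) * (x powr (- c) * cmod (mel L 0 (Complex (- c) t)))"
        using x by (simp add: gl_def norm_mult norm_powr_pos)
      also have "\<dots> \<le> (C * (1 + \<bar>t\<bar>) powr (rW c - 1/2)) * (x powr (- c) * cmod (mel L 0 (Complex (- c) t)))"
        using C(2) by (intro mult_right_mono) auto
      also have "\<dots> \<le> norm ((C * x powr (- c)) * ((1 + \<bar>t\<bar>) powr (rW c - 1/2) * cmod (mel L 0 (Complex (- c) t))))"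
        using C(1) by (simp add: abs_mult)
      finally show "cmod (gl L x t) \<le> norm ((C * x powr (- c)) * ((1 + \<bar>t\<bar>) powr (rW c - 1/2) * cmod (mel L 0 (Complex (- c) t))))" .
    qed
  qed
qed

text \<open>The integrand \<phi>(s) times the Mellin transform times x^s. Writing \<phi> as
  \<open>F\<close> times the entire function \<open>rgfac\<close> leaves the singularities of F as
  the only ones.\<close>

definition ff :: "real \<Rightarrow> real \<Rightarrow> complex \<Rightarrow> complex" where
  "ff L x s = F s * rgfac d al be s * mel L 0 s * of_real x powr s"

lemma ff_left: "ff L x (Complex (- c) t) = \<omega> * (dser cb mu (1 - Complex (- c) t) * gl L x t)"
proof -
  have "Re (1 - Complex (- c) t) \<ge> \<sigma>s" using c_sig by simp
  from F_funeq[OF this bt_reg] show ?thesis by (simp add: ff_def gl_def G_def)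
qed

lemma ff_right: "ff L x (Complex c1 t) = dser ca lam (Complex c1 t) * (of_real x powr (Complex c1 t) * mel L 0 (Complex c1 t))"
proof -
  have "gfac d al be (Complex c1 t) * rgfac d al be (Complex c1 t) = 1"
    unfolding gfac_def rgfac_def prod.distrib[symmetric]
  proof (rule prod.neutral, intro ballI)
    fix \<nu> assume "\<nu> \<in> {..<d}"
    then have "of_real (al \<nu>) * Complex c1 t + be \<nu> \<notin> \<int>\<^sub>\<le>\<^sub>0" using be_reg[of t] by (auto simp: gfac_regular_def)
    then show "Gamma (of_real (al \<nu>) * Complex c1 t + be \<nu>) * rGamma (of_real (al \<nu>) * Complex c1 t + be \<nu>) = 1"
      by (simp add: Gamma_def rGamma_eq_zero_iff)
  qed
  moreover have "F (Complex c1 t) = gfac d al be (Complex c1 t) * dser ca lam (Complex c1 t)"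
    using c1_sig by (intro F_cont be_reg) simp
  ultimately show ?thesis unfolding ff_def by (simp add: mult_ac)
qed

text \<open>On the right line the gamma factors cancel and the series converges absolutely, so each
  term is a Mellin inversion at lam_n / x.\<close>

lemma ff_right_sums:
  assumes L: "L > 2" and x: "x > 0"
  shows "integrable lborel (\<lambda>t. ff L x (Complex c1 t))"
    and "(\<lambda>n. ca n * (2 * pi * fL L (lam n / x))) sums (LBINT t. ff L x (Complex c1 t))"
proof -
  have gi: "integrable lborel (\<lambda>t. of_real x powr (Complex c1 t) * mel L 0 (Complex c1 t))"
  proof (rule Bochner_Integration.integrable_bound[of _ "\<lambda>t. (x powr c1) *\<^sub>R mel L 0 (Complex c1 t)"])
    show "(\<lambda>t. of_real x powr (Complex c1 t) * mel L 0 (Complex c1 t)) \<in> borel_measurable lborel"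
      using powr_line_measurable[OF x, of c1] by measurable
  qed (use x mel_int0[OF L] in \<open>auto simp: norm_mult norm_powr_pos\<close>)
  have cz: "continuous_on UNIV (\<lambda>t. Complex c1 t)" by (intro continuous_intros)
  note ds = dirichlet_line_sums[where \<nu> = lam and cc = ca and \<sigma> = c1, OF lam_pos cz _ summable_ca[OF c1_sig] gi]
  show "integrable lborel (\<lambda>t. ff L x (Complex c1 t))" unfolding ff_right by (rule ds(1)) simp
  have "(LBINT t. ca n * of_real (lam n) powr (- Complex c1 t) * (of_real x powr (Complex c1 t) * mel L 0 (Complex c1 t))) =
     ca n * (2 * pi * fL L (lam n / x))" for n
  proof -
    have lx: "lam n / x > 0" using lam_pos x by simp
    have lxp: "of_real (lam n) powr (- Complex c1 t) * of_real x powr (Complex c1 t) = of_real (lam n / x) powr (- Complex c1 t)" for t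
      unfolding powr_of_real_pos_eq_exp[OF lam_pos] powr_of_real_pos_eq_exp[OF x] powr_of_real_pos_eq_exp[OF lx] exp_add[symmetric]
      using lam_pos[of n] x by (intro arg_cong[of _ _ exp]) (simp add: ln_div algebra_simps)
    have "ca n * of_real (lam n) powr (- Complex c1 t) * (of_real x powr (Complex c1 t) * mel L 0 (Complex c1 t)) =
        ca n * (mell (fL L) (Complex c1 t) * of_real (lam n / x) powr (- Complex c1 t))" for t
      unfolding mell_fL lxp[symmetric] by (simp only: mult_ac)
    then have "(LBINT t. ca n * of_real (lam n) powr (- Complex c1 t) * (of_real x powr (Complex c1 t) * mel L 0 (Complex c1 t))) =
      ca n * (LBINT t. mell (fL L) (Complex c1 t) * of_real (lam n / x) powr (- Complex c1 t))"
      by (simp only: integral_mult_right_zero)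
    also have "(LBINT t. mell (fL L) (Complex c1 t) * of_real (lam n / x) powr (- Complex c1 t)) = 2 * pi * fL L (lam n / x)"
      by (rule mellin_inversion[OF fL_cont fL_supp[OF L] _ lx]) (use mel_int0[OF L] in \<open>simp_all only: mell_fL not_False_eq_True\<close>)
    finally show ?thesis .
  qed
  then show "(\<lambda>n. ca n * (2 * pi * fL L (lam n / x))) sums (LBINT t. ff L x (Complex c1 t))"
    using ds(2) unfolding ff_right by simp
qed

lemma ff_left_sums:
  assumes L: "L > 2" and x: "x > 0"
  shows "integrable lborel (\<lambda>t. ff L x (Complex (- c) t))"
    and "(\<lambda>n. \<omega> * (LBINT t. cb n * of_real (mu n) powr (Complex (- c) t - 1) * gl L x t)) sums (LBINT t. ff L x (Complex (- c) t))"
proof -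
  have cz: "continuous_on UNIV (\<lambda>t. 1 - Complex (- c) t)" by (intro continuous_intros)
  note ds = dirichlet_line_sums[where \<nu> = mu and cc = cb and \<sigma> = "1 + c", OF mu_pos cz _ summable_cb[OF c_sig] gl_integrable[OF L x]]
  show "integrable lborel (\<lambda>t. ff L x (Complex (- c) t))" unfolding ff_left by (intro integrable_mult_right ds(1)) simp
  have "(\<lambda>n. \<omega> * (LBINT t. cb n * of_real (mu n) powr (- (1 - Complex (- c) t)) * gl L x t)) sums (\<omega> * (LBINT t. dser cb mu (1 - Complex (- c) t) * gl L x t))"
    by (intro sums_mult ds(2)) simp
  then show "(\<lambda>n. \<omega> * (LBINT t. cb n * of_real (mu n) powr (Complex (- c) t - 1) * gl L x t)) sums (LBINT t. ff L x (Complex (- c) t))"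
    unfolding ff_left by (simp only: minus_diff_eq integral_mult_right_zero)
qed

text \<open>F is analytic for |z| >= R, so its singular points lie in a compact disk, where
  meromorphy makes them sparse and hence finite in number. In the strip F is eventually bounded by
  1, \<open>rgfac\<close> grows at most exponentially and the other factors are bounded, which is
  what \<open>contour_shift\<close> allows.\<close>

lemma ff_shift:
  assumes L: "L > 2" and x: "x > 0"
  shows "(LBINT t. ff L x (Complex c1 t)) - (LBINT t. ff L x (Complex (- c) t)) = - \<i> * contour_integral (circlepath 0 R) (ff L x)"
proof -
  define P where "P = {z. \<not> F analytic_on {z}}"
  have PR: "cmod z < R" if "z \<in> P" for z
  proof (rule ccontr)
    assume "\<not> cmod z < R"
    then have "F analytic_on {z}" using F_sing by (auto intro: analytic_on_subset)
    then show False using that by (simp add: P_def)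
  qed
  have "finite (cball 0 R \<inter> P)"
    unfolding P_def
    by (rule sparse_in_compact_finite[OF meromorphic_on_imp_sparse_singularities]) (use F_mero meromorphic_on_subset in auto)
  moreover have "cball 0 R \<inter> P = P" using less_imp_le[OF PR] by auto
  ultimately have Pf: "finite P" by simp
  have Fh: "F holomorphic_on - P"
  proof (rule analytic_imp_holomorphic)
    show "F analytic_on - P" by (subst analytic_on_analytic_at) (auto simp: P_def)
  qed
  have rg: "rgfac d al be holomorphic_on - P" unfolding rgfac_def[abs_def] by (intro holomorphic_intros)
  obtain T where T: "\<And>s. - c \<le> Re s \<Longrightarrow> Re s \<le> c1 \<Longrightarrow> \<bar>Im s\<bar> \<ge> T \<Longrightarrow> cmod (F s) \<le> 1"
    using F_decay[of 1 "- c" c1] by auto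
  obtain K M where KM: "K \<ge> 0" "M \<ge> 0" "\<And>s. Re s \<ge> - c \<Longrightarrow> cmod (rgfac d al be s) \<le> K * exp (M * cmod s)"
    by (rule rgfac_exp_bound[where d = d and al = al and be = be and b = "- c", OF al_pos]) (assumption, rule that)
  obtain Cm where Cm: "Cm \<ge> 0" "\<And>s. cmod (mel L 0 s) \<le> Cm * 2 powr \<bar>Re s - 1\<bar> / L" using mel_bound0[of 0] L by blast
  define b where "b = c1 + c + 1"
  show ?thesis
  proof (rule contour_shift[OF Pf _ _ R_pos c1_R c_R])
    show "P \<subseteq> ball 0 R" using PR by auto
    show "ff L x holomorphic_on - P"
      unfolding ff_def[abs_def] using x
      by (intro holomorphic_intros Fh rg holomorphic_on_subset[OF mel_holomorphic]) auto
    show "integrable lborel (\<lambda>t. ff L x (Complex c1 t))" "integrable lborel (\<lambda>t. ff L x (Complex (- c) t))"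
      by (rule ff_right_sums ff_left_sums; fact)+
    fix s assume s: "- c \<le> Re s" "Re s \<le> c1" "\<bar>Im s\<bar> \<ge> T"
    have bs: "\<bar>Re s\<bar> \<le> b" "\<bar>Re s - 1\<bar> \<le> b" using s c_R c1_R R_pos by (auto simp: b_def)
    have "cmod s \<le> b + \<bar>Im s\<bar>" using cmod_le[of s] bs by linarith
    then have "M * cmod s \<le> M * (b + \<bar>Im s\<bar>)" using KM by (intro mult_left_mono) auto
    then have r: "cmod (rgfac d al be s) \<le> K * (exp (M * b) * exp (M * \<bar>Im s\<bar>))"
      using order_trans[OF KM(3)[OF s(1)] mult_left_mono[OF _ KM(1)]] by (simp add: exp_add[symmetric] distrib_left)
    have m: "cmod (mel L 0 s) \<le> Cm * 2 powr b / L"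
      by (rule order_trans[OF Cm(2)]) (use Cm(1) bs L in \<open>intro divide_right_mono mult_left_mono powr_mono; simp\<close>)
    have y: "cmod (of_real x powr s) \<le> exp (b * \<bar>ln x\<bar>)"
    proof -
      have "Re s * ln x \<le> \<bar>Re s\<bar> * \<bar>ln x\<bar>" by (metis abs_ge_self abs_mult)
      also have "\<dots> \<le> b * \<bar>ln x\<bar>" using bs by (intro mult_right_mono) auto
      finally show ?thesis using x by (simp add: norm_powr_pos powr_def)
    qed
    have "cmod (ff L x s) \<le> 1 * (K * (exp (M * b) * exp (M * \<bar>Im s\<bar>))) * (Cm * 2 powr b / L) * exp (b * \<bar>ln x\<bar>)"
      unfolding ff_def norm_mult using T[OF s] r m y KM Cm L by (intro mult_mono mult_nonneg_nonneg) auto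
    then show "cmod (ff L x s) \<le> (K * exp (M * b) * (Cm * 2 powr b / L) * exp (b * \<bar>ln x\<bar>)) * exp (M * \<bar>Im s\<bar>)"
      by (simp only: mult_ac mult_1)
  qed
qed

end

section \<open>The contribution of a single n on the left line\<close>

context hecke_line
begin

abbreviation "\<rho> \<equiv> 1 / (2 * A)"

text \<open>Both explicit terms of the expansion are evaluated by \<open>main_J\<close>, once the
  powers of h, mu_n and x have been combined into
  \<open>of_real Y powr s / of_real (h * mu n)\<close>. What remains is bounded absolutely through
  \<open>G_err\<close>.\<close>

lemma term_expansion:
  fixes n :: nat and x :: real
  assumes L: "L > 2" and x: "x > 0"
  defines "Y \<equiv> h * mu n * x"
  shows "cmod ((LBINT t. of_real (mu n) powr (Complex (- c) t - 1) * gl L x t)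
     - EE / of_real (h * mu n) * (of_real (2 * pi / (2 * A)) * of_real Y powr (1 + a) * J L a k Y)
     - EE * q / of_real (h * mu n) * (of_real (2 * pi / (2 * A)) * of_real Y powr (1 + (a - of_real \<rho>)) * J L (a - of_real \<rho>) (k + 1/2) Y))
    \<le> CE * mu n powr (- (1 + c)) * x powr (- c) * (LBINT t. (1 + \<bar>t\<bar>) powr (rW c - 2) * cmod (mel L 0 (Complex (- c) t)))"
proof -
  let ?s = "\<lambda>t. Complex (- c) t" and ?m = "\<lambda>t. mel L 0 (Complex (- c) t)"
  have mu: "mu n > 0" by (rule mu_pos)
  have hm: "h * mu n > 0" and Y: "Y > 0" using mu h_pos x by (auto simp: Y_def)
  have Re_a: "1 + c + Re a > 0" "1 + c + Re (a - of_real \<rho>) > 0"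
  proof -
    have "\<rho> < 1 + c + Re a" using c_rW A_pos by (simp add: rW_def divide_less_eq mult.commute)
    moreover have "\<rho> > 0" using A_pos by simp
    moreover have "Re (a - complex_of_real \<rho>) = Re a - \<rho>" by simp
    ultimately show "1 + c + Re a > 0" "1 + c + Re (a - of_real \<rho>) > 0" by linarith+
  qed
  \<comment> \<open>Lowering the exponent a by 1/(2A) lowers W by exactly 1, so the second term has
    the form that \<open>main_J\<close> treats.\<close>
  have W1: "of_real (2 * A) * (1 - ?s t + (a - of_real \<rho>)) = W c t - 1" for t
  proof -
    have "complex_of_real (2 * A) * of_real \<rho> = of_real (2 * A * \<rho>)" by (rule of_real_mult[symmetric])
    also have "2 * A * \<rho> = 1" using A_pos by simp
    finally have "complex_of_real (2 * A) * of_real \<rho> = 1" by simp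
    then show ?thesis unfolding W_def by (simp only: right_diff_distrib distrib_left) (simp add: algebra_simps)
  qed
  \<comment> \<open>Passing to W - 1 moves the phase by - pi/2, and k + 1/2 moves it back.\<close>
  have cos1: "cos (pi/2 * (W c t - 1) + (k + 1/2) * pi) = cos (pi/2 * W c t + k * pi)" for t
    by (rule arg_cong[of _ _ cos]) (simp add: algebra_simps)
  have yx: "of_real (mu n) powr (?s t - 1) * of_real x powr (?s t) * of_real h powr (?s t - 1) = of_real Y powr (?s t) / of_real (h * mu n)" for t
  proof -
    have lY: "ln Y = ln h + ln (mu n) + ln x" using h_pos mu x by (simp add: Y_def ln_mult)
    have "complex_of_real (h * mu n) = exp (of_real (ln h) + of_real (ln (mu n)))"
      using h_pos mu by (simp add: exp_add exp_of_real)
    then show ?thesis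
      unfolding powr_of_real_pos_eq_exp[OF mu] powr_of_real_pos_eq_exp[OF x] powr_of_real_pos_eq_exp[OF h_pos] powr_of_real_pos_eq_exp[OF Y] lY
      by (simp only: exp_add[symmetric] exp_diff[symmetric]) (rule arg_cong[of _ _ exp], simp add: algebra_simps)
  qed
  define f1 where "f1 = (\<lambda>t. ?m t * of_real Y powr (?s t) * (Gamma (W c t) * cos (pi/2 * W c t + k * pi)))"
  define f2 where "f2 = (\<lambda>t. ?m t * of_real Y powr (?s t) * (Gamma (W c t - 1) * cos (pi/2 * W c t + k * pi)))"
  define f0 where "f0 = (\<lambda>t. of_real (mu n) powr (?s t - 1) * gl L x t)"
  define er where "er = (\<lambda>t. (G t - M0 t - M1 t) * (of_real (mu n) powr (?s t - 1) * of_real x powr (?s t) * ?m t))"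
  have f1: "integrable lborel f1" "(LBINT t. f1 t) = of_real (2 * pi / (2 * A)) * of_real Y powr (1 + a) * J L a k Y"
  proof -
    have "cmod (Gamma (of_real (2 * A) * (1 - ?s t + a))) * exp (pi/2 * \<bar>Im (of_real (2 * A) * (1 - ?s t + a))\<bar>) \<le> CG * (1 + \<bar>t\<bar>) powr (rW c - 1/2)" for t
      using CG1[of t] unfolding W_def .
    note mj = main_J[OF L Y Re_a(1) _ this, of k]
    show "integrable lborel f1" unfolding f1_def W_def using mj(1) c_rW by simp
    show "(LBINT t. f1 t) = of_real (2 * pi / (2 * A)) * of_real Y powr (1 + a) * J L a k Y"
      unfolding f1_def W_def by (rule mj(2)) (use c_rW in simp)
  qed
  have f2: "integrable lborel f2" "(LBINT t. f2 t) = of_real (2 * pi / (2 * A)) * of_real Y powr (1 + (a - of_real \<rho>)) * J L (a - of_real \<rho>) (k + 1/2) Y"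
  proof -
    have "cmod (Gamma (of_real (2 * A) * (1 - ?s t + (a - of_real \<rho>)))) * exp (pi/2 * \<bar>Im (of_real (2 * A) * (1 - ?s t + (a - of_real \<rho>)))\<bar>) \<le> CG * (1 + \<bar>t\<bar>) powr (rW c - 3/2)" for t
      unfolding W1 using CG2[of t] by simp
    note mj = main_J[OF L Y Re_a(2) _ this, of "k + 1/2"]
    show "integrable lborel f2" unfolding f2_def using mj(1) c_rW unfolding W1 cos1 by simp
    show "(LBINT t. f2 t) = of_real (2 * pi / (2 * A)) * of_real Y powr (1 + (a - of_real \<rho>)) * J L (a - of_real \<rho>) (k + 1/2) Y"
      unfolding f2_def using mj(2) c_rW unfolding W1 cos1 by simp
  qed
  have f0: "integrable lborel f0"
  proof (rule Bochner_Integration.integrable_bound[of _ "\<lambda>t. (mu n powr (- c - 1)) *\<^sub>R gl L x t"])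
    have "continuous_on UNIV (\<lambda>t. complex_of_real (mu n) powr (?s t - 1))" using mu by (intro continuous_intros) auto
    then have [measurable]: "(\<lambda>t. complex_of_real (mu n) powr (?s t - 1)) \<in> borel_measurable borel"
      by (rule borel_measurable_continuous_onI)
    have [measurable]: "gl L x \<in> borel_measurable borel" using gl_integrable[OF L x] by auto
    show "f0 \<in> borel_measurable lborel" unfolding f0_def by measurable
  qed (use mu gl_integrable[OF L x] in \<open>auto simp: f0_def norm_mult norm_powr_pos\<close>)
  have er_eq: "er t = f0 t - EE / of_real (h * mu n) * f1 t - EE * q / of_real (h * mu n) * f2 t" for t
  proof -
    have e: "EE / of_real (h * mu n) * f1 t = M0 t * (of_real (mu n) powr (?s t - 1) * of_real x powr (?s t) * ?m t)"
    proof -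
      have "EE / of_real (h * mu n) * f1 t = EE * (of_real Y powr (?s t) / of_real (h * mu n)) * ?m t * (Gamma (W c t) * cos (pi/2 * W c t + k * pi))"
        by (simp add: f1_def)
      then show ?thesis unfolding yx[symmetric] M0_def by (simp only: mult_ac)
    qed
    have e': "EE * q / of_real (h * mu n) * f2 t = M1 t * (of_real (mu n) powr (?s t - 1) * of_real x powr (?s t) * ?m t)"
    proof -
      have "EE * q / of_real (h * mu n) * f2 t = EE * q * (of_real Y powr (?s t) / of_real (h * mu n)) * ?m t * (Gamma (W c t - 1) * cos (pi/2 * W c t + k * pi))"
        by (simp add: f2_def)
      then show ?thesis unfolding yx[symmetric] M1_def by (simp only: mult_ac)
    qed
    show ?thesis unfolding e e' er_def f0_def gl_def by (simp add: algebra_simps)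
  qed
  have i1: "integrable lborel (\<lambda>t. EE / of_real (h * mu n) * f1 t)" using f1(1) by (rule integrable_mult_right)
  have i2: "integrable lborel (\<lambda>t. EE * q / of_real (h * mu n) * f2 t)" using f2(1) by (rule integrable_mult_right)
  have eri: "integrable lborel er" unfolding er_eq[abs_def] by (intro Bochner_Integration.integrable_diff f0 i1 i2)
  have "(LBINT t. er t) = (LBINT t. f0 t) - EE / of_real (h * mu n) * (LBINT t. f1 t) - EE * q / of_real (h * mu n) * (LBINT t. f2 t)"
    unfolding er_eq using f0 i1 i2
    by (simp only: Bochner_Integration.integral_diff Bochner_Integration.integrable_diff integral_mult_right_zero)
  then have "(LBINT t. er t) = (LBINT t. of_real (mu n) powr (Complex (- c) t - 1) * gl L x t)
     - EE / of_real (h * mu n) * (of_real (2 * pi / (2 * A)) * of_real Y powr (1 + a) * J L a k Y)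
     - EE * q / of_real (h * mu n) * (of_real (2 * pi / (2 * A)) * of_real Y powr (1 + (a - of_real \<rho>)) * J L (a - of_real \<rho>) (k + 1/2) Y)"
    unfolding f1(2) f2(2) f0_def .
  moreover have "cmod (LBINT t. er t) \<le> CE * mu n powr (- (1 + c)) * x powr (- c) * (LBINT t. (1 + \<bar>t\<bar>) powr (rW c - 2) * cmod (?m t))"
  proof -
    have mi: "integrable lborel (\<lambda>t. CE * mu n powr (- (1 + c)) * x powr (- c) * ((1 + \<bar>t\<bar>) powr (rW c - 2) * cmod (?m t)))"
      using c_rW by (intro integrable_mult_right mel_int L) auto
    have "cmod (LBINT t. er t) \<le> (LBINT t. cmod (er t))" by (rule integral_norm_bound)
    also have "\<dots> \<le> (LBINT t. CE * mu n powr (- (1 + c)) * x powr (- c) * ((1 + \<bar>t\<bar>) powr (rW c - 2) * cmod (?m t)))"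
    proof (rule integral_mono[OF _ mi])
      show "integrable lborel (\<lambda>t. cmod (er t))" using eri by (rule integrable_norm)
      fix t
      have pc: "mu n powr (- (1 + c)) = mu n powr (- c - 1)" by (rule arg_cong[of _ _ "\<lambda>e. mu n powr e"]) simp
      have "cmod (er t) = cmod (G t - M0 t - M1 t) * (mu n powr (- (1 + c)) * x powr (- c) * cmod (?m t))"
        unfolding pc using mu x by (simp add: er_def norm_mult norm_powr_pos)
      also have "\<dots> \<le> (CE * (1 + \<bar>t\<bar>) powr (rW c - 2)) * (mu n powr (- (1 + c)) * x powr (- c) * cmod (?m t))"
        by (intro mult_right_mono G_err) auto
      finally show "cmod (er t) \<le> CE * mu n powr (- (1 + c)) * x powr (- c) * ((1 + \<bar>t\<bar>) powr (rW c - 2) * cmod (?m t))"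
        by (simp only: mult_ac)
    qed
    finally show ?thesis by (simp only: integral_mult_right_zero)
  qed
  ultimately show ?thesis by simp
qed

text \<open>Trades an exponent beyond \<sigma>s for \<sigma>s itself, where the series is known to
  converge. The price is a power of mu_0, since mu_0 may be smaller than 1.\<close>

lemma mu_powr_le:
  assumes "e \<ge> \<sigma>s"
  shows "mu n powr (- e) \<le> mu 0 powr (- (e - \<sigma>s)) * mu n powr (- \<sigma>s)"
proof -
  have "mu n powr (- e) = mu n powr (- (e - \<sigma>s)) * mu n powr (- \<sigma>s)"
    using mu_pos[of n] by (simp add: powr_add[symmetric])
  also have "\<dots> \<le> mu 0 powr (- (e - \<sigma>s)) * mu n powr (- \<sigma>s)"
    using assms mu_pos[of 0] mu_ge[of n] by (intro mult_right_mono powr_mono2') auto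
  finally show ?thesis .
qed

text \<open>In \<open>ff_shift\<close> the right line gives the smoothed sum by Mellin inversion,
  the circle gives M, and the left line expands into the stated series by the functional
  equation.\<close>

lemma S_identity:
  assumes L: "L > 2" and x: "x > 0"
  shows "(\<lambda>n. \<omega> * cb n * (LBINT t. of_real (mu n) powr (Complex (- c) t - 1) * gl L x t) / (2 * pi)) sums
     ((\<Sum>n. ca n * fL L (lam n / x)) - (1 / (2 * pi * \<i>)) * contour_integral (circlepath 0 R) (ff L x))"
proof -
  define I1 I2 where "I1 = (LBINT t. ff L x (Complex c1 t))" and "I2 = (LBINT t. ff L x (Complex (- c) t))"
  have "(\<lambda>n. ca n * (2 * pi * fL L (lam n / x)) / (2 * pi)) sums (I1 / (2 * pi))"
    unfolding I1_def by (intro sums_divide ff_right_sums L x)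
  then have "(\<lambda>n. ca n * fL L (lam n / x)) sums (I1 / (2 * pi))" by simp
  then have s1: "(\<Sum>n. ca n * fL L (lam n / x)) = I1 / (2 * pi)" by (simp add: sums_iff)
  have "I1 - I2 = - \<i> * contour_integral (circlepath 0 R) (ff L x)"
    unfolding I1_def I2_def by (rule ff_shift[OF L x])
  then have "contour_integral (circlepath 0 R) (ff L x) = \<i> * (I1 - I2)" by simp
  then have s2: "(1 / (2 * pi * \<i>)) * contour_integral (circlepath 0 R) (ff L x) = (I1 - I2) / (2 * pi)" by simp
  have "(\<lambda>n. \<omega> * (LBINT t. cb n * of_real (mu n) powr (Complex (- c) t - 1) * gl L x t) / (2 * pi)) sums (I2 / (2 * pi))"
    unfolding I2_def by (intro sums_divide ff_left_sums L x)
  moreover have "(LBINT t. cb n * of_real (mu n) powr (Complex (- c) t - 1) * gl L x t) =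
     cb n * (LBINT t. of_real (mu n) powr (Complex (- c) t - 1) * gl L x t)" for n
    by (simp only: mult.assoc integral_mult_right_zero)
  ultimately have "(\<lambda>n. \<omega> * cb n * (LBINT t. of_real (mu n) powr (Complex (- c) t - 1) * gl L x t) / (2 * pi)) sums (I2 / (2 * pi))"
    by (simp only: mult.assoc)
  moreover have "I2 / (2 * pi) = I1 / (2 * pi) - (I1 - I2) / (2 * pi)" by (simp add: diff_divide_distrib)
  ultimately show ?thesis unfolding s1 s2 by simp
qed

end

section \<open>Summation over n and the two estimates\<close>

context hecke_line
begin

text \<open>The n-th term of S_{\<phi>,0}: the exponent a = - \<theta> + i \<xi> unites the division
  by mu_n powr (\<theta> - i \<xi>) with the two powers of u under the integral.\<close>

definition TT :: "real \<Rightarrow> real \<Rightarrow> nat \<Rightarrow> complex" where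
  "TT L x n = cb n * of_real (mu n) powr a * J L a k (h * mu n * x)"

definition SS :: "real \<Rightarrow> real \<Rightarrow> complex" where
  "SS L x = (\<Sum>n. ca n * fL L (lam n / x)) - (1 / (2 * pi * \<i>)) * contour_integral (circlepath 0 R) (ff L x)"

text \<open>Summing \<open>term_expansion\<close> over n: the first explicit term gives the main
  term exactly, the second carries the extra factor x powr (-1/(2A)) and is bounded through
  \<open>J_bound\<close>, and the error is bounded absolutely. The bound for SS itself follows by
  applying \<open>J_bound\<close> to the main term as well.\<close>

lemma estimate:
  assumes \<delta>: "\<delta> > 0"
  shows "\<exists>C X0. X0 \<ge> 1 \<and> (\<forall>X\<ge>X0. Lpar A \<delta> X > 2 \<and> (\<forall>x\<in>{X..4*X}.
     summable (TT (Lpar A \<delta> X) x)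
     \<and> cmod (SS (Lpar A \<delta> X) x - \<omega> * EE / of_real (2 * A * h) * of_real (h * x) powr (1 + a) * (\<Sum>n. TT (Lpar A \<delta> X) x n))
         \<le> C * x powr (1 + Re a - \<rho>) / Lpar A \<delta> X
     \<and> cmod (SS (Lpar A \<delta> X) x) \<le> C * x powr (1 + Re a) / Lpar A \<delta> X))"
proof -
  have r: "\<rho> > 0" using A_pos by simp
  \<comment> \<open>N integrations by parts give mu_n powr (- \<rho> N) against the factor mu_n powr
    (Re a) of the n-th term; N is chosen so that the total exponent is at most - \<sigma>s, where
    absolute convergence is assumed.\<close>
  obtain N :: nat where N0: "real N \<ge> (\<sigma>s + Re a) / \<rho>" using real_arch_simple by blast
  have N: "\<rho> * real N - Re a \<ge> \<sigma>s"
  proof -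
    have "(\<sigma>s + Re a) / \<rho> * \<rho> \<le> real N * \<rho>" using N0 r by (intro mult_right_mono) auto
    moreover have "(\<sigma>s + Re a) / \<rho> * \<rho> = \<sigma>s + Re a" using r by simp
    ultimately show ?thesis by (simp only: mult.commute[of _ \<rho>])
  qed
  have N2: "\<rho> * real N + \<rho> - Re a \<ge> \<sigma>s" using N r by linarith
  obtain CJ where CJ: "CJ \<ge> 0" "\<And>L Y. L > 2 \<Longrightarrow> Y > 0 \<Longrightarrow> cmod (J L a k Y) \<le> CJ / L * (L / Y powr \<rho>) ^ N"
    using J_bound[of a k N] by blast
  obtain CK where CK: "CK \<ge> 0" "\<And>L Y. L > 2 \<Longrightarrow> Y > 0 \<Longrightarrow> cmod (J L (a - of_real \<rho>) (k + 1/2) Y) \<le> CK / L * (L / Y powr \<rho>) ^ N"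
    using J_bound[of "a - of_real \<rho>" "k + 1/2" N] by blast
  obtain CL where CL: "CL \<ge> 0" "\<And>L. L > 2 \<Longrightarrow> (LBINT t. (1 + \<bar>t\<bar>) powr (rW c - 2) * cmod (mel L 0 (Complex (- c) t))) \<le> CL * L powr (rW c - 2)"
    using mel_line_integral[of "rW c - 2" "- c"] c_rW by auto
  define Sb where "Sb = (\<Sum>n. cmod (cb n) * mu n powr (- \<sigma>s))"
  have sb: "summable (\<lambda>n. cmod (cb n) * mu n powr (- \<sigma>s))" by (rule summable_cb) simp
  have Sb0: "Sb \<ge> 0" unfolding Sb_def using sb by (intro suminf_nonneg) auto
  \<comment> \<open>The product \<open>\<kappa> * mu n powr (- \<rho>)\<close> bounds the gain
    \<open>L / Y n powr \<rho>\<close> of one integration by parts.\<close>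
  define \<kappa> where "\<kappa> = 1 / (\<delta> * h powr \<rho>)"
  have \<kappa>: "\<kappa> > 0" using \<delta> h_pos by (simp add: \<kappa>_def)
  define m1 where "m1 = mu 0 powr (- (\<rho> * real N - Re a - \<sigma>s))"
  define m2 where "m2 = mu 0 powr (- (\<rho> * real N + \<rho> - Re a - \<sigma>s))"
  define m3 where "m3 = mu 0 powr (- (1 + c - \<sigma>s))"
  define CT where "CT = CJ * \<kappa> ^ N * m1"
  define CU1 where "CU1 = cmod EE * cmod q / (2 * A * h) * h powr (1 + Re a - \<rho>) * (CK * \<kappa> ^ N) * m2"
  define CU2 where "CU2 = CE * CL * m3 * \<delta> powr (- (rW c - 1))"
  define CU where "CU = CU1 + CU2"
  have nn: "CT \<ge> 0" "CU1 \<ge> 0" "CU2 \<ge> 0" "CU \<ge> 0"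
    using CJ CK CL CE0 \<kappa> A_pos h_pos \<delta> by (auto simp: CT_def CU1_def CU2_def CU_def m1_def m2_def m3_def)
  define CS where "CS = cmod EE / (2 * A * h) * h powr (1 + Re a) * (CT * Sb) + CU * Sb"
  define C where "C = max CS (CU * Sb)"
  \<comment> \<open>The second entry gives L >= 3, hence the condition L > 2 under which the weight
    is supported inside (1/2, 3/2).\<close>
  define X0 where "X0 = max 1 ((3 * \<delta>) powr (2 * A))"
  have main: "Lpar A \<delta> X > 2 \<and> (\<forall>x\<in>{X..4*X}.
     summable (TT (Lpar A \<delta> X) x)
     \<and> cmod (SS (Lpar A \<delta> X) x - \<omega> * EE / of_real (2 * A * h) * of_real (h * x) powr (1 + a) * (\<Sum>n. TT (Lpar A \<delta> X) x n))
         \<le> C * x powr (1 + Re a - \<rho>) / Lpar A \<delta> X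
     \<and> cmod (SS (Lpar A \<delta> X) x) \<le> C * x powr (1 + Re a) / Lpar A \<delta> X)" if X: "X \<ge> X0" for X
  proof (intro conjI ballI)
    define L where "L = Lpar A \<delta> X"
    have X1: "X \<ge> 1" using X by (simp add: X0_def)
    show L2: "Lpar A \<delta> X > 2"
    proof -
      have "3 * \<delta> = ((3 * \<delta>) powr (2 * A)) powr \<rho>" using \<delta> A_pos by (simp add: powr_powr)
      also have "\<dots> \<le> X powr \<rho>" using X r by (intro powr_mono2) (auto simp: X0_def)
      finally have "3 * \<delta> \<le> X powr \<rho>" .
      then have "3 \<le> X powr \<rho> / \<delta>" using \<delta> by (simp add: le_divide_eq)
      then show ?thesis unfolding Lpar_def by linarith
    qed
    have L: "L > 2" using L2 by (simp add: L_def)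
    fix x assume xX: "x \<in> {X..4*X}"
    have x1: "x \<ge> 1" and x: "x > 0" and xX': "X \<le> x" using xX X1 by auto
    \<comment> \<open>From x >= X; through this bound every positive power of L becomes a power of
      x.\<close>
    have Lx: "L \<le> x powr \<rho> / \<delta>"
      unfolding L_def Lpar_def using xX' X1 r \<delta> by (intro divide_right_mono powr_mono2) auto
    define Y where "Y = (\<lambda>n. h * mu n * x)"
    have Y: "Y n > 0" for n using h_pos mu_pos x by (simp add: Y_def)
    have LY: "(L / Y n powr \<rho>) ^ N \<le> \<kappa> ^ N * mu n powr (- (\<rho> * real N))" for n
    proof -
      have mu: "mu n > 0" by (rule mu_pos)
      have YY: "Y n powr \<rho> = h powr \<rho> * mu n powr \<rho> * x powr \<rho>"
        unfolding Y_def using h_pos mu x by (simp add: powr_mult)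
      have "L / Y n powr \<rho> \<le> (x powr \<rho> / \<delta>) / Y n powr \<rho>" using Lx by (intro divide_right_mono) auto
      also have "(x powr \<rho> / \<delta>) / Y n powr \<rho> = \<kappa> * mu n powr (- \<rho>)"
        unfolding YY using x mu h_pos \<delta> unfolding \<kappa>_def powr_minus by (simp add: divide_simps)
      finally have "L / Y n powr \<rho> \<le> \<kappa> * mu n powr (- \<rho>)" .
      then have "(L / Y n powr \<rho>) ^ N \<le> (\<kappa> * mu n powr (- \<rho>)) ^ N" using L by (intro power_mono) auto
      also have "\<dots> = \<kappa> ^ N * mu n powr (- (\<rho> * real N))"
        using mu by (simp add: power_mult_distrib powr_realpow[symmetric] powr_powr)
      finally show ?thesis .
    qed
    have Jb: "cmod (J L a k (Y n)) \<le> CJ / L * (\<kappa> ^ N * mu n powr (- (\<rho> * real N)))" for n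
      by (rule order_trans[OF CJ(2)[OF L Y]]) (use LY CJ(1) L in \<open>intro mult_left_mono; simp\<close>)
    have Kb: "cmod (J L (a - of_real \<rho>) (k + 1/2) (Y n)) \<le> CK / L * (\<kappa> ^ N * mu n powr (- (\<rho> * real N)))" for n
      by (rule order_trans[OF CK(2)[OF L Y]]) (use LY CK(1) L in \<open>intro mult_left_mono; simp\<close>)
    have Tb: "cmod (TT L x n) \<le> CT / L * (cmod (cb n) * mu n powr (- \<sigma>s))" for n
    proof -
      have mu: "mu n > 0" by (rule mu_pos)
      have "cmod (TT L x n) = cmod (cb n) * mu n powr Re a * cmod (J L a k (Y n))"
        using mu by (simp add: TT_def Y_def norm_mult norm_powr_pos)
      also have "\<dots> \<le> cmod (cb n) * mu n powr Re a * (CJ / L * (\<kappa> ^ N * mu n powr (- (\<rho> * real N))))"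
        by (intro mult_left_mono Jb) auto
      also have "\<dots> = CJ / L * \<kappa> ^ N * cmod (cb n) * (mu n powr Re a * mu n powr (- (\<rho> * real N)))" by (simp only: mult_ac)
      also have "mu n powr Re a * mu n powr (- (\<rho> * real N)) = mu n powr (- (\<rho> * real N - Re a))"
        unfolding powr_add[symmetric] by (rule arg_cong[of _ _ "\<lambda>e. mu n powr e"]) simp
      also have "CJ / L * \<kappa> ^ N * cmod (cb n) * \<dots> \<le> CJ / L * \<kappa> ^ N * cmod (cb n) * (m1 * mu n powr (- \<sigma>s))"
        unfolding m1_def using mu_powr_le[OF N, of n] CJ(1) \<kappa> L by (intro mult_left_mono) auto
      finally show ?thesis by (simp add: CT_def mult_ac)
    qed
    have sT: "summable (\<lambda>n. CT / L * (cmod (cb n) * mu n powr (- \<sigma>s)))" by (intro summable_mult sb)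
    have Tsum: "summable (TT L x)" by (rule summable_comparison_test'[OF sT]) (use Tb in auto)
    then show "summable (TT (Lpar A \<delta> X) x)" by (simp add: L_def)
    have TS: "cmod (\<Sum>n. TT L x n) \<le> CT / L * Sb"
      using norm_suminf_le[OF Tb sT] unfolding Sb_def suminf_mult[OF sb] .
    define K where "K = \<omega> * EE / of_real (2 * A * h) * of_real (h * x) powr (1 + a)"
    define Z where "Z = (\<lambda>n. \<omega> * cb n * (LBINT t. of_real (mu n) powr (Complex (- c) t - 1) * gl L x t) / (2 * pi))"
    have Zs: "Z sums SS L x" unfolding Z_def SS_def by (rule S_identity[OF L x])
    define U where "U = (\<lambda>n. Z n - K * TT L x n)"
    have Us: "U sums (SS L x - K * (\<Sum>n. TT L x n))"
      unfolding U_def by (intro sums_diff Zs sums_mult summable_sums Tsum)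
    have Ub: "cmod (U n) \<le> CU * x powr (1 + Re a - \<rho>) / L * (cmod (cb n) * mu n powr (- \<sigma>s))" for n
    proof -
      have mu: "mu n > 0" by (rule mu_pos)
      have hm: "h * mu n > 0" and hx: "h * x > 0" using mu h_pos x by auto
      define I where "I = (LBINT t. of_real (mu n) powr (Complex (- c) t - 1) * gl L x t)"
      define P1 where "P1 = EE / of_real (h * mu n) * (of_real (2 * pi / (2 * A)) * of_real (Y n) powr (1 + a) * J L a k (Y n))"
      define P2 where "P2 = EE * q / of_real (h * mu n) * (of_real (2 * pi / (2 * A)) * of_real (Y n) powr (1 + (a - of_real \<rho>)) * J L (a - of_real \<rho>) (k + 1/2) (Y n))"
      have e3: "cmod (I - P1 - P2) \<le> CE * mu n powr (- (1 + c)) * x powr (- c) * (CL * L powr (rW c - 2))"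
        unfolding I_def P1_def P2_def Y_def
        by (rule order_trans[OF term_expansion[OF L x]]) (use CL(2)[OF L] CE0 in \<open>intro mult_left_mono; simp\<close>)
      \<comment> \<open>\<open>P1\<close> reproduces the n-th term of the claimed main term exactly,
        so \<open>U n\<close> contains only the second term and the error.\<close>
      have KT: "K * TT L x n = \<omega> * cb n * P1 / (2 * pi)"
      proof -
        have "complex_of_real (Y n) powr (1 + a) / of_real (mu n) = of_real (h * x) powr (1 + a) * of_real (mu n) powr a"
        proof -
          have lY: "ln (Y n) = ln (h * x) + ln (mu n)" using h_pos mu x by (simp add: Y_def ln_mult)
          have "complex_of_real (mu n) = exp (of_real (ln (mu n)))" using mu by (simp add: exp_of_real)
          then have "complex_of_real (Y n) powr (1 + a) / of_real (mu n) = exp ((1 + a) * of_real (ln (Y n))) / exp (of_real (ln (mu n)))"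
            by (simp only: powr_of_real_pos_eq_exp[OF Y])
          also have "\<dots> = exp ((1 + a) * of_real (ln (h * x))) * exp (a * of_real (ln (mu n)))"
            unfolding exp_add[symmetric] exp_diff[symmetric] lY by (rule arg_cong[of _ _ exp]) (simp add: algebra_simps)
          finally show ?thesis by (simp only: powr_of_real_pos_eq_exp[OF hx] powr_of_real_pos_eq_exp[OF mu])
        qed
        then have "K * TT L x n = \<omega> * EE / of_real (2 * A * h) * cb n * (of_real (Y n) powr (1 + a) / of_real (mu n)) * J L a k (Y n)"
          unfolding K_def TT_def Y_def by (simp add: mult_ac)
        also have "\<dots> = \<omega> * cb n * P1 / (2 * pi)" unfolding P1_def by (simp add: field_simps)
        finally show ?thesis .
      qed
      have Un: "U n = \<omega> * cb n / (2 * pi) * (P2 + (I - P1 - P2))"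
        unfolding U_def KT Z_def I_def[symmetric] by (simp add: field_simps)
      have p2: "cmod P2 \<le> 2 * pi * (CU1 * x powr (1 + Re a - \<rho>) / L * mu n powr (- \<sigma>s))"
      proof -
        have "cmod (of_real (Y n) powr (1 + (a - of_real \<rho>))) = Y n powr (1 + Re a - \<rho>)"
          unfolding norm_powr_pos[OF Y] by (rule arg_cong[of _ _ "\<lambda>e. Y n powr e"]) simp
        moreover have "Y n powr (1 + Re a - \<rho>) = h powr (1 + Re a - \<rho>) * mu n powr (1 + Re a - \<rho>) * x powr (1 + Re a - \<rho>)"
          unfolding Y_def using h_pos mu x by (simp add: powr_mult)
        ultimately have "cmod P2 = cmod EE * cmod q / (h * mu n) * (2 * pi / (2 * A) * (h powr (1 + Re a - \<rho>) * mu n powr (1 + Re a - \<rho>) * x powr (1 + Re a - \<rho>)) * cmod (J L (a - of_real \<rho>) (k + 1/2) (Y n)))"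
          unfolding P2_def using h_pos mu A_pos by (simp add: norm_mult norm_divide)
        also have "\<dots> \<le> cmod EE * cmod q / (h * mu n) * (2 * pi / (2 * A) * (h powr (1 + Re a - \<rho>) * mu n powr (1 + Re a - \<rho>) * x powr (1 + Re a - \<rho>)) * (CK / L * (\<kappa> ^ N * mu n powr (- (\<rho> * real N)))))"
          using h_pos mu A_pos x by (intro mult_left_mono Kb) auto
        also have "\<dots> = 2 * pi * (cmod EE * cmod q / (2 * A * h) * h powr (1 + Re a - \<rho>) * (CK * \<kappa> ^ N) * x powr (1 + Re a - \<rho>) / L) * (mu n powr (1 + Re a - \<rho>) / mu n * mu n powr (- (\<rho> * real N)))"
        proof -
          have "e * f / (g * m) * (p / b * (u * v * w) * (r / l * (z * y))) = p * (e * f / (b * g) * u * (r * z) * w / l) * (v / m * y)"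
            for e f g m p b u v w r l z y :: real
            by (simp only: divide_inverse inverse_mult_distrib mult_ac)
          then show ?thesis .
        qed
        also have "mu n powr (1 + Re a - \<rho>) / mu n * mu n powr (- (\<rho> * real N)) = mu n powr (- (\<rho> * real N + \<rho> - Re a))"
        proof -
          have "mu n powr (1 + Re a - \<rho>) / mu n = mu n powr (1 + Re a - \<rho> - 1)"
            using powr_diff[of "mu n" "1 + Re a - \<rho>" 1] powr_one[of "mu n"] mu by (simp only: less_imp_le)
          then show ?thesis by (simp only: powr_add[symmetric]) (rule arg_cong[of _ _ "\<lambda>e. mu n powr e"], simp)
        qed
        also have "2 * pi * (cmod EE * cmod q / (2 * A * h) * h powr (1 + Re a - \<rho>) * (CK * \<kappa> ^ N) * x powr (1 + Re a - \<rho>) / L) * \<dots> \<le>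
          2 * pi * (cmod EE * cmod q / (2 * A * h) * h powr (1 + Re a - \<rho>) * (CK * \<kappa> ^ N) * x powr (1 + Re a - \<rho>) / L) * (m2 * mu n powr (- \<sigma>s))"
          unfolding m2_def using CK(1) \<kappa> L h_pos A_pos
          by (intro mult_left_mono mu_powr_le[OF N2]) (auto intro!: mult_nonneg_nonneg divide_nonneg_pos)
        finally show ?thesis unfolding CU1_def by (simp add: mult_ac)
      qed
      have p3: "cmod (I - P1 - P2) \<le> CU2 * x powr (1 + Re a - \<rho>) / L * mu n powr (- \<sigma>s)"
      proof -
        \<comment> \<open>One factor 1/L is kept for the final bound. The remaining
          \<open>L powr (rW c - 1)\<close> becomes a multiple of x powr (1 + c + Re a - \<rho>), and
          the factor x powr (- c) then removes c.\<close>
        have "L powr (rW c - 2) = L powr (rW c - 1) / L" using L powr_diff[of L "rW c - 1" 1] by simp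
        also have "\<dots> \<le> (x powr \<rho> / \<delta>) powr (rW c - 1) / L"
          using Lx L c_rW by (intro divide_right_mono powr_mono2) auto
        also have "(x powr \<rho> / \<delta>) powr (rW c - 1) = \<delta> powr (- (rW c - 1)) * x powr (1 + c + Re a - \<rho>)"
        proof -
          have "\<rho> * (rW c - 1) = 1 + c + Re a - \<rho>" unfolding rW_def using A_pos by (simp add: field_simps)
          moreover have "(x powr \<rho> / \<delta>) powr (rW c - 1) = x powr (\<rho> * (rW c - 1)) / \<delta> powr (rW c - 1)"
            using x \<delta> by (simp add: powr_divide powr_powr)
          ultimately show ?thesis unfolding powr_minus by (simp only: divide_inverse mult.commute)
        qed
        finally have lw: "L powr (rW c - 2) \<le> \<delta> powr (- (rW c - 1)) * x powr (1 + c + Re a - \<rho>) / L" .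
        have "CE * mu n powr (- (1 + c)) * x powr (- c) * (CL * L powr (rW c - 2)) \<le>
          CE * (m3 * mu n powr (- \<sigma>s)) * x powr (- c) * (CL * (\<delta> powr (- (rW c - 1)) * x powr (1 + c + Re a - \<rho>) / L))"
          using mu_powr_le[OF c_sig, of n] lw CE0 CL(1) L unfolding m3_def
          by (intro mult_mono mult_left_mono mult_right_mono) (auto intro!: mult_nonneg_nonneg divide_nonneg_pos)
        also have "\<dots> = CU2 / L * mu n powr (- \<sigma>s) * (x powr (- c) * x powr (1 + c + Re a - \<rho>))"
          unfolding CU2_def by (simp add: mult_ac)
        also have "x powr (- c) * x powr (1 + c + Re a - \<rho>) = x powr (1 + Re a - \<rho>)"
          unfolding powr_add[symmetric] by (rule arg_cong[of _ _ "\<lambda>e. x powr e"]) simp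
        finally show ?thesis using e3 by (simp add: mult_ac)
      qed
      have "cmod (U n) = cmod (cb n) / (2 * pi) * cmod (P2 + (I - P1 - P2))"
        unfolding Un by (simp add: norm_mult norm_divide omega)
      also have "\<dots> \<le> cmod (cb n) / (2 * pi) * (2 * pi * (CU1 * x powr (1 + Re a - \<rho>) / L * mu n powr (- \<sigma>s)) + 2 * pi * (CU2 * x powr (1 + Re a - \<rho>) / L * mu n powr (- \<sigma>s)))"
      proof (intro mult_left_mono order_trans[OF norm_triangle_ineq] add_mono p2 order_trans[OF p3])
        have "1 * (CU2 * x powr (1 + Re a - \<rho>) / L * mu n powr (- \<sigma>s)) \<le> (2 * pi) * (CU2 * x powr (1 + Re a - \<rho>) / L * mu n powr (- \<sigma>s))"
          using nn L pi_gt3 by (intro mult_right_mono) auto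
        then show "CU2 * x powr (1 + Re a - \<rho>) / L * mu n powr (- \<sigma>s) \<le> 2 * pi * (CU2 * x powr (1 + Re a - \<rho>) / L * mu n powr (- \<sigma>s))" by simp
      qed auto
      also have "\<dots> = CU * x powr (1 + Re a - \<rho>) / L * (cmod (cb n) * mu n powr (- \<sigma>s))"
      proof -
        have "b / p * (p * (u * v / l * w) + p * (u' * v / l * w)) = (u + u') * v / l * (b * w)" if "p \<noteq> 0" for b p u u' v l w :: real
          using that by (simp add: distrib_left distrib_right add_divide_distrib mult_ac)
        then show ?thesis unfolding CU_def by simp
      qed
      finally show ?thesis .
    qed
    have sU: "summable (\<lambda>n. CU * x powr (1 + Re a - \<rho>) / L * (cmod (cb n) * mu n powr (- \<sigma>s)))" by (intro summable_mult sb)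
    have "SS L x - K * (\<Sum>n. TT L x n) = (\<Sum>n. U n)" using Us by (simp add: sums_iff)
    then have US: "cmod (SS L x - K * (\<Sum>n. TT L x n)) \<le> CU * x powr (1 + Re a - \<rho>) / L * Sb"
      using norm_suminf_le[OF Ub sU] unfolding Sb_def suminf_mult[OF sb] by simp
    also have "\<dots> = (CU * Sb) * x powr (1 + Re a - \<rho>) / L" by simp
    also have "\<dots> \<le> C * x powr (1 + Re a - \<rho>) / L"
      using L by (intro divide_right_mono mult_right_mono) (auto simp: C_def)
    finally show "cmod (SS (Lpar A \<delta> X) x - \<omega> * EE / of_real (2 * A * h) * of_real (h * x) powr (1 + a) * (\<Sum>n. TT (Lpar A \<delta> X) x n))
         \<le> C * x powr (1 + Re a - \<rho>) / Lpar A \<delta> X" unfolding K_def L_def .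
    have Kn: "cmod K = cmod EE / (2 * A * h) * h powr (1 + Re a) * x powr (1 + Re a)"
    proof -
      have hx: "h * x > 0" using h_pos x by simp
      have "cmod (of_real (h * x) powr (1 + a)) = h powr (1 + Re a) * x powr (1 + Re a)"
        unfolding norm_powr_pos[OF hx] using h_pos x by (simp add: powr_mult)
      then show ?thesis unfolding K_def using omega A_pos h_pos
        by (simp add: norm_mult norm_divide del: of_real_mult)
    qed
    have "cmod (SS L x) \<le> cmod (K * (\<Sum>n. TT L x n)) + cmod (SS L x - K * (\<Sum>n. TT L x n))"
      using norm_triangle_ineq[of "K * (\<Sum>n. TT L x n)" "SS L x - K * (\<Sum>n. TT L x n)"] by simp
    also have "\<dots> \<le> cmod EE / (2 * A * h) * h powr (1 + Re a) * x powr (1 + Re a) * (CT / L * Sb) + CU * x powr (1 + Re a) / L * Sb"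
    proof (intro add_mono)
      show "cmod (K * (\<Sum>n. TT L x n)) \<le> cmod EE / (2 * A * h) * h powr (1 + Re a) * x powr (1 + Re a) * (CT / L * Sb)"
        unfolding norm_mult Kn using TS A_pos h_pos by (intro mult_left_mono) auto
      have "x powr (1 + Re a - \<rho>) \<le> x powr (1 + Re a)" using x1 r by (intro powr_mono) auto
      then have "CU * x powr (1 + Re a - \<rho>) / L * Sb \<le> CU * x powr (1 + Re a) / L * Sb"
        using nn Sb0 L by (intro mult_right_mono divide_right_mono mult_left_mono) auto
      then show "cmod (SS L x - K * (\<Sum>n. TT L x n)) \<le> CU * x powr (1 + Re a) / L * Sb" using US by linarith
    qed
    also have "\<dots> = CS * x powr (1 + Re a) / L" unfolding CS_def by (simp only: divide_inverse distrib_right distrib_left mult_ac)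
    also have "\<dots> \<le> C * x powr (1 + Re a) / L"
      using L by (intro divide_right_mono mult_right_mono) (auto simp: C_def)
    finally show "cmod (SS (Lpar A \<delta> X) x) \<le> C * x powr (1 + Re a) / Lpar A \<delta> X" unfolding L_def .
  qed
  then show ?thesis by (intro exI[of _ C] exI[of _ X0]) (simp add: X0_def)
qed

end

section \<open>Choice of the two lines, and translation into the notation of the theorem\<close>

lemma (in hecke_setup) line_exists:
  "\<exists>c c1 CG CE q. hecke_line d al be bt \<phi>0 ca cb lam mu \<sigma>s \<omega> F R c c1 CG CE q"
proof -
  obtain q c2 where q: "\<And>c. c \<ge> c2 \<Longrightarrow> \<exists>C\<ge>0. \<forall>t.
     cmod (gfac d al bt (1 - Complex (- c) t) * rgfac d al be (Complex (- c) t)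
       - e0 d al be bt * of_real h powr (Complex (- c) t - 1) * (Gamma (W c t) * cos (pi/2 * W c t + k * pi))
       - e0 d al be bt * q * of_real h powr (Complex (- c) t - 1) * (Gamma (W c t - 1) * cos (pi/2 * W c t + k * pi)))
     \<le> C * (1 + \<bar>t\<bar>) powr (rW c - 2)"
    using gamma_expansion by blast
  obtain c3 where c3: "\<And>c. c \<ge> c3 \<Longrightarrow> \<exists>C>0. \<forall>t.
     cmod (Gamma (W c t)) * exp (pi/2 * \<bar>Im (W c t)\<bar>) \<le> C * (1 + \<bar>t\<bar>) powr (rW c - 1/2) \<and>
     cmod (Gamma (W c t - 1)) * exp (pi/2 * \<bar>Im (W c t)\<bar>) \<le> C * (1 + \<bar>t\<bar>) powr (rW c - 3/2)"
    using Gamma_W_bound by blast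
  have reg: "\<exists>Z. \<forall>y\<ge>Z. \<forall>\<nu><d. al \<nu> * y + Re (b \<nu>) > 0" for b :: "nat \<Rightarrow> complex"
  proof (intro exI[of _ "1 + (\<Sum>\<nu><d. cmod (b \<nu>) / al \<nu>)"] allI impI)
    fix y \<nu> assume y: "y \<ge> 1 + (\<Sum>\<nu><d. cmod (b \<nu>) / al \<nu>)" and \<nu>: "\<nu> < d"
    have "cmod (b \<nu>) / al \<nu> \<le> (\<Sum>\<nu><d. cmod (b \<nu>) / al \<nu>)"
      using \<nu> al_pos by (intro member_le_sum divide_nonneg_pos) auto
    then have "cmod (b \<nu>) / al \<nu> < y" using y by linarith
    then have "cmod (b \<nu>) < al \<nu> * y" using al_pos[OF \<nu>] by (simp add: divide_less_eq mult.commute)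
    then show "al \<nu> * y + Re (b \<nu>) > 0" using abs_Re_le_cmod[of "b \<nu>"] by linarith
  qed
  obtain Z1 where Z1: "\<And>y \<nu>. y \<ge> Z1 \<Longrightarrow> \<nu> < d \<Longrightarrow> al \<nu> * y + Re (bt \<nu>) > 0" using reg[of bt] by blast
  obtain Z2 where Z2: "\<And>y \<nu>. y \<ge> Z2 \<Longrightarrow> \<nu> < d \<Longrightarrow> al \<nu> * y + Re (be \<nu>) > 0" using reg[of be] by blast
  \<comment> \<open>Every requirement on c in \<open>hecke_line\<close> is a lower bound. The entry
    \<open>1 / A + cmod a\<close> yields rW c >= 2, so that the exponent rW c - 2 is nonnegative as
    \<open>mel_line_integral\<close> requires.\<close>
  define c where "c = Max {c2, c3, R + 1, \<sigma>s, 1 / A + cmod a, Z1}"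
  have c: "c \<ge> c2" "c \<ge> c3" "c \<ge> R + 1" "c \<ge> \<sigma>s" "c \<ge> 1 / A + cmod a" "c \<ge> Z1"
    unfolding c_def by (intro Max_ge; simp)+
  define c1 where "c1 = Max {R + 1, \<sigma>s, Z2}"
  have c1: "c1 \<ge> R + 1" "c1 \<ge> \<sigma>s" "c1 \<ge> Z2" unfolding c1_def by (intro Max_ge; simp)+
  obtain CE where CE: "CE \<ge> 0" "\<And>t. cmod (gfac d al bt (1 - Complex (- c) t) * rgfac d al be (Complex (- c) t)
       - e0 d al be bt * of_real h powr (Complex (- c) t - 1) * (Gamma (W c t) * cos (pi/2 * W c t + k * pi))
       - e0 d al be bt * q * of_real h powr (Complex (- c) t - 1) * (Gamma (W c t - 1) * cos (pi/2 * W c t + k * pi)))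
     \<le> CE * (1 + \<bar>t\<bar>) powr (rW c - 2)" using q[OF c(1)] by blast
  obtain CG where CG: "CG > 0"
     "\<And>t. cmod (Gamma (W c t)) * exp (pi/2 * \<bar>Im (W c t)\<bar>) \<le> CG * (1 + \<bar>t\<bar>) powr (rW c - 1/2)"
     "\<And>t. cmod (Gamma (W c t - 1)) * exp (pi/2 * \<bar>Im (W c t)\<bar>) \<le> CG * (1 + \<bar>t\<bar>) powr (rW c - 3/2)"
    using c3[OF c(2)] by blast
  have rW: "rW c \<ge> 2"
  proof -
    have "1 / A \<le> 1 + c + Re a" using c(5) abs_Re_le_cmod[of a] by linarith
    then have "1 \<le> A * (1 + c + Re a)" using A_pos by (simp add: divide_le_eq mult.commute)
    then show ?thesis unfolding rW_def by linarith
  qed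
  have "hecke_line d al be bt \<phi>0 ca cb lam mu \<sigma>s \<omega> F R c c1 CG CE q"
    by unfold_locales
       (use c c1 CE CG rW Z1[of "1 + c"] Z2[of c1] R_pos in \<open>auto intro: less_imp_le\<close>)
  then show ?thesis by blast
qed

theorem theorem1:
  fixes a b :: "nat \<Rightarrow> complex" and lam mu :: "nat \<Rightarrow> real"
    and \<sigma>s :: real and d :: nat and al :: "nat \<Rightarrow> real" and be bt :: "nat \<Rightarrow> complex"
    and \<omega> :: complex and F :: "complex \<Rightarrow> complex" and R :: real
    and \<phi>0 :: "real \<Rightarrow> real" and \<delta> :: real
  assumes a1: "a 0 \<noteq> 0" and b1: "b 0 \<noteq> 0"
    and lam_pos: "lam 0 > 0" and lam_mono: "strict_mono lam" and lam_lim: "filterlim lam at_top sequentially"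
    and mu_pos: "mu 0 > 0" and mu_mono: "strict_mono mu" and mu_lim: "filterlim mu at_top sequentially"
    (* (A1) *)
    and sig_pos: "\<sigma>s > 0"
    and A1a: "\<And>s. Re s \<ge> \<sigma>s \<Longrightarrow> summable (\<lambda>n. norm (a n * of_real (lam n) powr (- s)))"
    and A1b: "\<And>s. Re s \<ge> \<sigma>s \<Longrightarrow> summable (\<lambda>n. norm (b n * of_real (mu n) powr (- s)))"
    (* (A2), (A3): F is the meromorphic continuation of Delta(s) phi(s) *)
    and d_pos: "d \<ge> 1" and al_pos: "\<And>\<nu>. \<nu> < d \<Longrightarrow> al \<nu> > 0"
    and omega: "norm \<omega> = 1"
    and F_mero: "F meromorphic_on UNIV"
    and F_cont: "\<And>s. Re s \<ge> \<sigma>s \<Longrightarrow> gfac_regular d al be s \<Longrightarrow>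
                    F s = gfac d al be s * dser a lam s"
    and F_funeq: "\<And>s. Re (1 - s) \<ge> \<sigma>s \<Longrightarrow> gfac_regular d al bt (1 - s) \<Longrightarrow>
                    F s = \<omega> * gfac d al bt (1 - s) * dser b mu (1 - s)"
    and R_pos: "R > 0"
    and F_sing: "F analytic_on {z. cmod z \<ge> R}"
    and F_decay: "\<And>c c' \<epsilon>. \<epsilon> > 0 \<Longrightarrow> \<exists>T. \<forall>s. c \<le> Re s \<and> Re s \<le> c' \<and> \<bar>Im s\<bar> \<ge> T
                    \<longrightarrow> cmod (F s) \<le> \<epsilon>"
    (* weight *)
    and phi0_smooth: "\<And>n x. ((deriv ^^ n) \<phi>0) differentiable (at x)"
    and phi0_supp: "\<And>u. \<phi>0 u \<noteq> 0 \<Longrightarrow> u \<in> {-1..1}"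
    and phi0_range: "\<And>u. 0 \<le> \<phi>0 u \<and> \<phi>0 u \<le> 1"
    and phi0_int: "1 \<le> integral UNIV \<phi>0" "integral UNIV \<phi>0 \<le> 2"
    and delta_pos: "\<delta> > 0"
  defines "A \<equiv> bigA d al" and "h \<equiv> hconst d al"
    and "\<theta> \<equiv> theta d al be bt" and "\<xi> \<equiv> xi d al be bt" and "k \<equiv> kconst d al be bt"
  shows "\<exists>C X0. \<forall>X \<ge> X0. \<forall>x \<in> {X..4*X}.
     (let L = Lpar A \<delta> X; \<phi> = wt \<phi>0 L;
          M = (1 / (2 * pi * \<i>)) * contour_integral (circlepath 0 R)
                 (\<lambda>s. F s * rgfac d al be s * mellin \<phi> s * of_real x powr s);
          S = (\<Sum>n. a n * of_real (\<phi> (lam n / x))) - M;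
          T = (\<lambda>n. b n / of_real (mu n) powr (of_real \<theta> - \<i> * of_real \<xi>) *
                 integral {0<..} (\<lambda>u. of_real (\<phi> u / u powr \<theta>) * of_real u powr (\<i> * of_real \<xi>) *
                    cos (of_real ((h * mu n * x * u) powr (1 / (2 * A))) + k * of_real pi)));
          S0 = (\<Sum>n. T n)
      in summable T
         \<and> cmod (S - \<omega> * e0 d al be bt / of_real (2 * A * h)
                  * of_real (h * x) powr (1 - of_real \<theta> + \<i> * of_real \<xi>) * S0)
             \<le> C * x powr (1 - \<theta> - 1 / (2 * A)) / L
         \<and> cmod S \<le> C * x powr (1 - \<theta>) / L)"
proof -
  have lam_all: "lam n > 0" for n
    using lam_pos strict_mono_less_eq[OF lam_mono, of 0 n] by simp
  have mu_ge: "mu n \<ge> mu 0" for n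
    using strict_mono_less_eq[OF mu_mono, of 0 n] by simp
  have mu_all: "mu n > 0" for n using mu_pos mu_ge[of n] by linarith
  interpret hecke_setup d al be bt \<phi>0 a b lam mu \<sigma>s \<omega> F R
    by unfold_locales (fact assms lam_all mu_all mu_ge)+
  obtain c c1 CG CE q where "hecke_line d al be bt \<phi>0 a b lam mu \<sigma>s \<omega> F R c c1 CG CE q"
    using line_exists by blast
  then interpret hl: hecke_line d al be bt \<phi>0 a b lam mu \<sigma>s \<omega> F R c c1 CG CE q .
  \<comment> \<open>The constant a of the locale under another name, since \<open>a\<close> denotes
    the coefficients here.\<close>
  define ac where "ac = aconst d al be bt"
  have ac: "ac = - of_real \<theta> + \<i> * of_real \<xi>"
    by (simp add: ac_def \<theta>_def theta_def \<xi>_def xi_def complex_eq_iff)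
  have Re_ac: "Re ac = - \<theta>" by (simp add: ac)
  obtain C X0 where X0: "X0 \<ge> 1" and est:
    "\<forall>X\<ge>X0. Lpar A \<delta> X > 2 \<and> (\<forall>x\<in>{X..4*X}. summable (hl.TT (Lpar A \<delta> X) x)
     \<and> cmod (hl.SS (Lpar A \<delta> X) x - \<omega> * e0 d al be bt / of_real (2 * A * h) * of_real (h * x) powr (1 + ac) * (\<Sum>n. hl.TT (Lpar A \<delta> X) x n))
         \<le> C * x powr (1 + Re ac - 1 / (2 * A)) / Lpar A \<delta> X
     \<and> cmod (hl.SS (Lpar A \<delta> X) x) \<le> C * x powr (1 + Re ac) / Lpar A \<delta> X)"
    by (rule exE[OF hl.estimate[OF delta_pos, folded A_def h_def ac_def]], erule exE, erule conjE, rule that)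
  show ?thesis
  proof (rule exI[of _ C], rule exI[of _ X0], intro allI impI ballI)
    fix X x assume X: "X \<ge> X0" and x: "x \<in> {X..4*X}"
    define L where "L = Lpar A \<delta> X"
    have L: "L > 2" using est[rule_format, OF X, THEN conjunct1] by (simp add: L_def)
    have x0: "x > 0" using X X0 x by auto
    have ff: "(\<lambda>s. F s * rgfac d al be s * mellin (wt \<phi>0 L) s * of_real x powr s) = hl.ff L x"
      by (simp add: hl.ff_def[abs_def] mellin_wt[OF L])
    have SS: "(\<Sum>n. a n * of_real (wt \<phi>0 L (lam n / x))) - (1 / (2 * pi * \<i>)) * contour_integral (circlepath 0 R)
        (\<lambda>s. F s * rgfac d al be s * mellin (wt \<phi>0 L) s * of_real x powr s) = hl.SS L x"
      unfolding ff hl.SS_def by (simp add: fL_def wt_eq)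
    have TT: "(\<lambda>n. b n / of_real (mu n) powr (of_real \<theta> - \<i> * of_real \<xi>) *
         integral {0<..} (\<lambda>u. of_real (wt \<phi>0 L u / u powr \<theta>) * of_real u powr (\<i> * of_real \<xi>) *
            cos (of_real ((h * mu n * x * u) powr (1 / (2 * A))) + k * of_real pi))) = hl.TT L x"
    proof
      fix n
      have "of_real \<theta> - \<i> * of_real \<xi> = - ac" by (simp add: ac)
      then have 1: "b n / of_real (mu n) powr (of_real \<theta> - \<i> * of_real \<xi>) = b n * of_real (mu n) powr ac"
        by (simp add: powr_minus divide_inverse)
      have "integral {0<..} (\<lambda>u. of_real (wt \<phi>0 L u / u powr \<theta>) * of_real u powr (\<i> * of_real \<xi>) *
            cos (of_real ((h * mu n * x * u) powr (1 / (2 * A))) + k * of_real pi)) =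
         integral {1/2..3/2} (\<lambda>u. of_real (wt \<phi>0 L u / u powr \<theta>) * of_real u powr (\<i> * of_real \<xi>) *
            cos (of_real ((h * mu n * x * u) powr (1 / (2 * A))) + k * of_real pi))"
        \<comment> \<open>L > 2 confines the weight to [1/2, 3/2], so the integral over the positive
          half line reduces to the compact interval used throughout.\<close>
        by (rule integral_pos_eq) (use weight_zero'[OF L, of _ 0] in \<open>auto simp: wt_eq\<close>)
      also have "\<dots> = integral {1/2..3/2} (\<lambda>u. fL L u * of_real u powr ac *
            cos (of_real ((h * mu n * x * u) powr (1 / (2 * A))) + k * of_real pi))"
      proof (rule integral_cong)
        fix u :: real assume "u \<in> {1/2..3/2}"
        then have u: "u > 0" by auto
        have "complex_of_real (u powr \<theta>) = of_real u powr of_real \<theta>" using u powr_of_real[of u \<theta>] by simp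
        then have "of_real (wt \<phi>0 L u / u powr \<theta>) * of_real u powr (\<i> * of_real \<xi>) =
           fL L u * (of_real u powr (- of_real \<theta>) * of_real u powr (\<i> * of_real \<xi>))"
          by (simp add: fL_def wt_eq powr_minus divide_inverse)
        also have "complex_of_real u powr (- of_real \<theta>) * of_real u powr (\<i> * of_real \<xi>) = of_real u powr ac"
          unfolding ac by (rule powr_add[symmetric])
        finally show "of_real (wt \<phi>0 L u / u powr \<theta>) * of_real u powr (\<i> * of_real \<xi>) *
            cos (of_real ((h * mu n * x * u) powr (1 / (2 * A))) + k * of_real pi) =
            fL L u * of_real u powr ac * cos (of_real ((h * mu n * x * u) powr (1 / (2 * A))) + k * of_real pi)" by simp
      qed
      finally show "b n / of_real (mu n) powr (of_real \<theta> - \<i> * of_real \<xi>) *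
         integral {0<..} (\<lambda>u. of_real (wt \<phi>0 L u / u powr \<theta>) * of_real u powr (\<i> * of_real \<xi>) *
            cos (of_real ((h * mu n * x * u) powr (1 / (2 * A))) + k * of_real pi)) = hl.TT L x n"
        unfolding 1 hl.TT_def J_def A_def h_def k_def ac_def by simp
    qed
    have e1: "1 - of_real \<theta> + \<i> * of_real \<xi> = 1 + ac" by (simp add: ac)
    have e2: "1 - \<theta> = 1 + Re ac" by (simp add: Re_ac)
    show "let L = Lpar A \<delta> X; \<phi> = wt \<phi>0 L;
          M = (1 / (2 * pi * \<i>)) * contour_integral (circlepath 0 R)
                 (\<lambda>s. F s * rgfac d al be s * mellin \<phi> s * of_real x powr s);
          S = (\<Sum>n. a n * of_real (\<phi> (lam n / x))) - M;
          T = (\<lambda>n. b n / of_real (mu n) powr (of_real \<theta> - \<i> * of_real \<xi>) *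
                 integral {0<..} (\<lambda>u. of_real (\<phi> u / u powr \<theta>) * of_real u powr (\<i> * of_real \<xi>) *
                    cos (of_real ((h * mu n * x * u) powr (1 / (2 * A))) + k * of_real pi)));
          S0 = (\<Sum>n. T n)
      in summable T
         \<and> cmod (S - \<omega> * e0 d al be bt / of_real (2 * A * h)
                  * of_real (h * x) powr (1 - of_real \<theta> + \<i> * of_real \<xi>) * S0)
             \<le> C * x powr (1 - \<theta> - 1 / (2 * A)) / L
         \<and> cmod S \<le> C * x powr (1 - \<theta>) / L"
      unfolding Let_def L_def[symmetric] SS TT e1 e2
      using bspec[OF est[rule_format, OF X, THEN conjunct2] x] unfolding L_def[symmetric] .
  qed
qed

end
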